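(* Let $\mathcal{G}=(\mathcal{V},\mathcal{E})$ be a strongly connected directed graph on $\mathcal{V}=\{1,\dots,n\}$, $n\ge 2$, with all self-loops. Let $f_1,\dots,f_n:\mathbb{R}^m\to\mathbb{R}$ be (possibly non-convex) functions such that $f=\sum_{i=1}^n f_i$ is convex and, for a constant $\hat D>0$, $|f_i(x)-f_i(y)|\le \hat D\|x-y\|$ for all $x,y\in\mathbb{R}^m$ and all $i\in\mathcal V$. Let $\mu>0$ and let $\{x^i_k\}_{k\ge0}$, $\{y^i_k\}_{k\geq 0}$, $i\in\mathcal{V}$, be generated by the gradient-free update law $$x_{k+1}^i = \sum_{j=1}^n [W_r]_{ij}x^j_k + \epsilon y^i_k - \alpha_k g^i_{\mu}(x^i_k),\qquad y_{k+1}^i = x^i_k - \sum_{j=1}^n [W_r]_{ij}x^j_k + \sum_{j=1}^n [W_c]_{ij} y^j_k - \epsilon y^i_k,$$ where the oracle $g^i_\mu$, the weight matrices $W_r,W_c$, the matrix $W$, and the constants $\bar\epsilon$, $\Gamma$, $\gamma$ are as defined in the context. Suppose $0<\epsilon\le\min\big(\bar\epsilon,\frac{1-\gamma}{2n\Gamma\gamma}\big)$ and that the step-sizes $\alpha_k\ge0$ satisfy $\sum_{k=0}^\infty\alpha_k=\infty$ and $\sum_{k=0}^\infty\alpha_k^2<\infty$. Let $\mathcal{X}^\star_\mu=\arg\min f_\mu$ (the minimizer set of the Gaussian-smoothed problem) and $f^\star=\min f$. Then: 1. There is a random vector $x^\star_\mu$, taking values in $\mathcal{X}^\star_\mu$ almost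 surely, such that for every $i\in\mathcal V$ the sequence $\{x^i_k\}_{k\ge0}$ converges to $x^\star_\mu$ with probability 1 and in mean (i.e. $\lim_{k\to\infty}\mathbf{E}[\|x^i_k-x^\star_\mu\|]=0$). 2. For every $i\in\mathcal V$, $\displaystyle\lim_{k\to\infty}\mathbf{E}[f(x^i_k)]-f^\star\le 2n\sqrt{m}\,\mu\hat D$.
   Context: Smoothing. For $\mu\geq 0$, $f_{i,\mu}(x)=\frac1\kappa\int_{\mathbb{R}^m} f_i(x+\mu\zeta)\exp(-\frac12\|\zeta\|^2)\,d\zeta$ with $\kappa=(2\pi)^{m/2}$, and $f_\mu=\sum_{i=1}^n f_{i,\mu}$. The sets $\mathcal{X}^\star=\arg\min_{x\in\mathbb{R}^m} f(x)$ and $\mathcal{X}^\star_\mu=\arg\min_{x\in\mathbb{R}^m} f_\mu(x)$ are assumed non-empty; $f^\star$ and $f_\mu^\star$ denote the minimum values. $\|\cdot\|$ is the Euclidean norm. Oracle. $g^i_\mu(x^i_k)=\frac{f_i(x^i_k+\mu\zeta^i_k)-f_i(x^i_k)}{\mu}\zeta^i_k$, where the $\zeta^i_k$ ($i\in\mathcal V$, $k\ge0$) are independent standard Gaussian vectors in $\mathbb{R}^m$. The initial values $x^i_0,y^i_0\in\mathbb{R}^m$ are deterministic and arbitrary. Weights. An edge $(i,j)\in\mathcal{E}$ means agent $i$ can send information to agent $j$; $(i,i)\in\mathcal E$ for all $i$; $\mathcal{N}^{\text{in}}_i=\{j:(j,i)\in\mathcal{E}\}$ and $\mathcal{N}^{\text{out}}_i=\{j:(i,j)\in\mathcal{E}\}$.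 The $n\times n$ non-negative matrix $W_r$ is row-stochastic ($\sum_{j}[W_r]_{ij}=1$ for all $i$) with $[W_r]_{ij}>0$ iff $j\in\mathcal{N}^{\text{in}}_i$; the $n\times n$ non-negative matrix $W_c$ is column-stochastic ($\sum_i[W_c]_{ij}=1$ for all $j$) with $[W_c]_{ij}>0$ iff $i\in\mathcal{N}^{\text{out}}_j$. Constants. $W=\begin{bmatrix} W_r & \epsilon I\\ I-W_r & W_c-\epsilon I\end{bmatrix}\in\mathbb{R}^{2n\times 2n}$; $\bar\epsilon=\frac{1}{(20+8n)^n}(1-|\lambda_3|)^n$, where $\lambda_3$ is the third largest eigenvalue (in modulus, with multiplicity) of the matrix $W$ with $\epsilon=0$. $\Gamma>0$ and $0<\gamma<1$ are constants such that for all $k\ge1$, $\left\|W^k-\begin{bmatrix}\frac1n\mathbf{1}_n\mathbf{1}_n^T&\frac1n\mathbf{1}_n\mathbf{1}_n^T\\ \mathbf{0}&\mathbf{0}\end{bmatrix}\right\|_\infty\le\Gamma\gamma^k$, where $\|\cdot\|_\infty$ is the matrix infinity-norm. *)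

theory Defs
  imports
    "HOL-Probability.Probability"
    "Jordan_Normal_Form.Char_Poly"
    "Graph_Theory.Graph_Theory"
begin

text \<open>
  Agents are numbered \<open>0, \<dots>, n - 1\<close>, matching the row and column indices of matrices.
  A pair \<open>(i, j)\<close> in \<^term>\<open>parcs G\<close> means that agent \<open>i\<close> can send to agent \<open>j\<close>.
\<close>

definition in_neighbours :: "'v pair_pre_digraph \<Rightarrow> 'v \<Rightarrow> 'v set" where
  "in_neighbours G i = {j. (j, i) \<in> parcs G}"

definition out_neighbours :: "'v pair_pre_digraph \<Rightarrow> 'v \<Rightarrow> 'v set" where
  "out_neighbours G i = {j. (i, j) \<in> parcs G}"

definition row_stochastic :: "nat \<Rightarrow> real mat \<Rightarrow> bool" where
  "row_stochastic n A \<longleftrightarrow> A \<in> carrier_mat n n \<and>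
     (\<forall>i<n. \<forall>j<n. 0 \<le> A $$ (i, j)) \<and> (\<forall>i<n. (\<Sum>j<n. A $$ (i, j)) = 1)"

definition column_stochastic :: "nat \<Rightarrow> real mat \<Rightarrow> bool" where
  "column_stochastic n A \<longleftrightarrow> A \<in> carrier_mat n n \<and>
     (\<forall>i<n. \<forall>j<n. 0 \<le> A $$ (i, j)) \<and> (\<forall>j<n. (\<Sum>i<n. A $$ (i, j)) = 1)"

definition augmented_matrix :: "nat \<Rightarrow> real mat \<Rightarrow> real mat \<Rightarrow> real \<Rightarrow> real mat" where
  "augmented_matrix n Wr Wc \<epsilon> =
     four_block_mat Wr (\<epsilon> \<cdot>\<^sub>m 1\<^sub>m n) (1\<^sub>m n - Wr) (Wc - \<epsilon> \<cdot>\<^sub>m 1\<^sub>m n)"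

definition limit_matrix :: "nat \<Rightarrow> real mat" where
  "limit_matrix n =
     four_block_mat (Matrix.mat n n (\<lambda>_. 1 / real n)) (Matrix.mat n n (\<lambda>_. 1 / real n))
       (0\<^sub>m n n) (0\<^sub>m n n)"

definition mat_norm_inf :: "real mat \<Rightarrow> real" where
  "mat_norm_inf A = Max ((\<lambda>i. \<Sum>j<dim_col A. \<bar>A $$ (i, j)\<bar>) ` {..<dim_row A})"

text \<open>
  The moduli of the complex eigenvalues, listed in decreasing order, each repeated
  according to its algebraic multiplicity.
\<close>

definition eigenvalue_moduli :: "real mat \<Rightarrow> real list" where
  "eigenvalue_moduli A =
     rev (sorted_list_of_multiset
       (image_mset cmod (proots (char_poly (map_mat complex_of_real A)))))"

text \<open>
  The third largest modulus has list index 2; the list has length \<open>2 * n\<close>, so the index is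
  valid as soon as \<open>n \<ge> 2\<close>.
\<close>

definition eps_bar :: "nat \<Rightarrow> real mat \<Rightarrow> real mat \<Rightarrow> real" where
  "eps_bar n Wr Wc =
     1 / (20 + 8 * real n) ^ n * (1 - eigenvalue_moduli (augmented_matrix n Wr Wc 0) ! 2) ^ n"

definition minimizers :: "('a \<Rightarrow> real) \<Rightarrow> 'a set" where
  "minimizers F = {x. is_arg_min F (\<lambda>_. True) x}"

text \<open>Only meaningful when \<^term>\<open>minimizers F \<noteq> {}\<close>.\<close>

definition min_value :: "('a \<Rightarrow> real) \<Rightarrow> real" where
  "min_value F = F (arg_min F (\<lambda>_. True))"

definition smoothed :: "real \<Rightarrow> (real ^ 'm \<Rightarrow> real) \<Rightarrow> real ^ 'm \<Rightarrow> real" where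
  "smoothed \<mu> F x =
     1 / (2 * pi) powr (real CARD('m) / 2) *
       (\<integral>z. F (x + \<mu> *\<^sub>R z) * exp (- (1 / 2) * (norm z)\<^sup>2) \<partial>lborel)"

definition std_gaussian_density :: "real ^ 'm \<Rightarrow> real" where
  "std_gaussian_density z =
     1 / (2 * pi) powr (real CARD('m) / 2) * exp (- (1 / 2) * (norm z)\<^sup>2)"

text \<open>The third argument is the sampled direction.\<close>

definition oracle_step ::
    "real \<Rightarrow> (real ^ 'm \<Rightarrow> real) \<Rightarrow> real ^ 'm \<Rightarrow> real ^ 'm \<Rightarrow> real ^ 'm" where
  "oracle_step \<mu> F z x = ((F (x + \<mu> *\<^sub>R z) - F x) / \<mu>) *\<^sub>R z"

end

theory Submission
  imports Defs
begin

text \<open>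
  Stacking states and surpluses, the matrix \<open>W\<close> has column sums \<open>1\<close>, so the average \<open>z\<close> of all
  \<open>x\<close> and \<open>y\<close> performs the centralized step \<open>z - (\<alpha> / n) \<Sum> g\<close>, and every \<open>x\<close> stays within
  a fading memory of the past steps, whose squared \<open>L\<^sup>2\<close> norms are summable.
  The mean oracle of \<open>f\<^sub>i\<close> is Lipschitz, and the sum of the mean oracles at \<open>z\<close> is a subgradient of the
  convex function \<open>f\<^sub>\<mu>\<close>. Hence \<open>\<parallel>z - p\<parallel>\<^sup>2\<close>, for a minimizer \<open>p\<close> of \<open>f\<^sub>\<mu>\<close>, decreases up to
  summable errors and the increments of an \<open>L\<^sup>2\<close>-bounded martingale. The expectations are therefore
  bounded, and almost surely \<open>z\<close> converges to a minimizer, by Kolmogorov's maximal inequality and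
  a pathwise quasi-Fejer argument. Bounded second moments turn this into convergence in mean, and
  \<open>\<bar>f\<^sub>\<mu> - f\<bar> \<le> n \<surd>m \<mu> D\<close> gives the bound on the objective.
\<close>

section \<open>Deterministic recursions\<close>

text \<open>Three obstacles shape the argument. The single \<open>fi\<close> need not be convex, so
  no subgradient inequality is available agent by agent: oracles taken at different points have to
  be moved to the common point \<open>z\<close>. This works because smoothing makes the mean oracles
  Lipschitz, with a constant of order \<open>1 / \<mu>\<close>, although \<open>fi\<close> itself is
  merely Lipschitz. The samples are unbounded, but the oracle is at most \<open>D\<close> times the
  squared norm of its sample wherever it is evaluated; the consensus error thus has a majorant in
  the samples alone, and fourth Gaussian moments control its square. Finally, the variance of the
  noise is bounded through the expected squared distance of \<open>z\<close> to \<open>p\<close>,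
  which is not known in advance: expectations are bounded before the martingale can be shown to be
  bounded in mean square. Conditional expectations never appear. The martingale property is
  expressed as orthogonality to functions of the past and obtained by Fubini's theorem from the
  product law of the past and the current sample.\<close>

lemma almost_decreasing_converges:
  fixes a w c :: "nat \<Rightarrow> real"
  assumes a: "\<And>k. 0 \<le> a k" and c: "\<And>k. 0 \<le> c k" and w: "summable w"
    and step: "\<And>k. a (Suc k) \<le> a k + w k - c k"
  shows "convergent a" and "summable c"
proof -
  have W: "convergent (\<lambda>k. \<Sum>j<k. w j)"
    using w by (simp add: summable_iff_convergent)
  then obtain B where B: "\<And>k. \<bar>\<Sum>j<k. w j\<bar> \<le> B"
    using convergent_imp_Bseq[OF W] by (auto simp: Bseq_def)
  \<comment> \<open>Compensating by the partial sums of \<open>w\<close> leaves a decreasing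
    sequence. Convergence of these sums is what enters, so \<open>w\<close> may change sign and can
    later absorb the conditionally convergent noise series.\<close>
  define u where "u k = a k - (\<Sum>j<k. w j)" for k
  have "decseq u"
    unfolding u_def using step c by (intro decseq_SucI) (smt (verit) sum.lessThan_Suc)
  moreover have "- B \<le> u k" for k
    using a[of k] B[of k] unfolding u_def by linarith
  ultimately have "convergent u"
    by (metis decseq_convergent convergentI)
  from convergent_add[OF this W] show "convergent a"
    by (simp add: u_def)
  show "summable c"
  proof (rule summableI_nonneg_bounded[OF c])
    fix k
    have "a k + (\<Sum>j<k. c j) \<le> a 0 + (\<Sum>j<k. w j)"
      by (induction k) (use step in \<open>auto, smt (verit)\<close>)
    then show "(\<Sum>j<k. c j) \<le> a 0 + B"
      using a[of k] B[of k] by linarith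
  qed
qed

text \<open>A discrete Gronwall bound: the growth factors multiply to at most the exponential of the
  sum of \<open>s\<close>. It serves the expected squared distances, whose factor exceeds 1 by a
  multiple of \<open>(\<alpha> k)\<^sup>2\<close>.\<close>

lemma almost_contracting_bounded:
  fixes v s b :: "nat \<Rightarrow> real"
  assumes v: "\<And>k. 0 \<le> v k" and s: "\<And>k. 0 \<le> s k" "summable s" and b: "\<And>k. 0 \<le> b k" "summable b"
    and step: "\<And>k. v (Suc k) \<le> (1 + s k) * v k + b k"
  obtains K where "\<And>k. v k \<le> K"
proof
  fix k
  have "v k \<le> exp (\<Sum>j<k. s j) * (v 0 + (\<Sum>j<k. b j))"
  proof (induction k)
    case (Suc k)
    have S: "0 \<le> (\<Sum>j<k. s j)" "0 \<le> (\<Sum>j<Suc k. s j)" using s by (auto intro!: sum_nonneg add_nonneg_nonneg)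
    define X where "X = v 0 + (\<Sum>j<k. b j)"
    have "v (Suc k) \<le> (1 + s k) * v k + b k" by (rule step)
    also have "(1 + s k) * v k \<le> exp (s k) * (exp (\<Sum>j<k. s j) * X)"
      using Suc v[of k] s(1)[of k] exp_ge_add_one_self[of "s k"] unfolding X_def
      by (intro mult_mono) simp_all
    also have "exp (s k) * (exp (\<Sum>j<k. s j) * X) = exp (\<Sum>j<Suc k. s j) * X"
      by (simp add: exp_add)
    also have "b k \<le> exp (\<Sum>j<Suc k. s j) * b k"
      using mult_right_mono[of 1 "exp (\<Sum>j<Suc k. s j)" "b k"] S b(1)[of k] by simp
    finally show ?case by (simp add: X_def distrib_left add.assoc)
  qed simp
  also have "\<dots> \<le> exp (suminf s) * (v 0 + suminf b)"
  proof (rule mult_mono)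
    show "exp (\<Sum>j<k. s j) \<le> exp (suminf s)" using sum_le_suminf[OF s(2), of "{..<k}"] s(1) by simp
    show "v 0 + (\<Sum>j<k. b j) \<le> v 0 + suminf b" using sum_le_suminf[OF b(2), of "{..<k}"] b(1) by simp
    show "0 \<le> v 0 + (\<Sum>j<k. b j)" using v[of 0] b(1) by (simp add: sum_nonneg)
  qed simp
  finally show "v k \<le> exp (suminf s) * (v 0 + suminf b)" .
qed

text \<open>Otherwise \<open>\<alpha>\<close> would eventually be dominated by
  \<open>1 / \<eta>\<close> times the summable products, against its divergence.\<close>

lemma frequently_small_of_weighted_summable:
  fixes \<alpha> \<delta> :: "nat \<Rightarrow> real"
  assumes \<alpha>: "\<And>k. 0 \<le> \<alpha> k" "\<not> summable \<alpha>" and \<delta>: "\<And>k. 0 \<le> \<delta> k"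
    and s: "summable (\<lambda>k. \<alpha> k * \<delta> k)" and "0 < \<eta>"
  shows "\<exists>k\<ge>N. \<delta> k < \<eta>"
proof (rule ccontr)
  assume "\<not> ?thesis"
  then have ge: "\<eta> \<le> \<delta> k" if "k \<ge> N" for k using that by (meson not_less)
  have "summable (\<lambda>k. (1/\<eta>) * (\<alpha> k * \<delta> k))"
    using s by (rule summable_mult)
  moreover have "norm (\<alpha> k) \<le> (1/\<eta>) * (\<alpha> k * \<delta> k)" if "k \<ge> N" for k
    using mult_left_mono[OF ge[OF that] \<alpha>(1)[of k]] \<alpha>(1)[of k] \<open>0 < \<eta>\<close>
    by (simp add: field_simps)
  ultimately have "summable \<alpha>" by (rule summable_comparison_test'[of _ N])
  with \<alpha>(2) show False by simp
qed

text \<open>The distances to every minimizer converge, and the value gap is small infinitely often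
  because the steps are not summable. A cluster point of such a subsequence is a minimizer, so the
  distance to it converges as well, and the subsequence forces that limit to be 0. The error
  sequence \<open>w\<close> may depend on \<open>p\<close>.\<close>

lemma quasi_fejer_converges_to_minimizer:
  fixes z :: "nat \<Rightarrow> 'a::euclidean_space" and F :: "'a \<Rightarrow> real"
  assumes F: "continuous_on UNIV F" and ne: "minimizers F \<noteq> {}"
    and \<alpha>: "\<And>k. 0 \<le> \<alpha> k" "\<not> summable \<alpha>" and "0 < c"
    and step: "\<And>p. p \<in> minimizers F \<Longrightarrow> \<exists>w. summable w \<and>
      (\<forall>k. (norm (z (Suc k) - p))\<^sup>2 \<le> (norm (z k - p))\<^sup>2 + w k - c * \<alpha> k * (F (z k) - F p))"
  shows "\<exists>p\<in>minimizers F. z \<longlonglongrightarrow> p"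
proof -
  have mini: "F p \<le> F u" if "p \<in> minimizers F" for p u
    using that by (auto simp: minimizers_def is_arg_min_def not_less)
  have conv: "convergent (\<lambda>k. (norm (z k - p))\<^sup>2) \<and> summable (\<lambda>k. c * \<alpha> k * (F (z k) - F p))"
    if p: "p \<in> minimizers F" for p
  proof -
    obtain w where w: "summable w"
      "\<And>k. (norm (z (Suc k) - p))\<^sup>2 \<le> (norm (z k - p))\<^sup>2 + w k - c * \<alpha> k * (F (z k) - F p)"
      using step[OF p] by blast
    have "0 \<le> c * \<alpha> k * (F (z k) - F p)" for k
      using \<alpha> \<open>0 < c\<close> mini[OF p] by simp
    from almost_decreasing_converges[OF _ this w] show ?thesis by simp
  qed
  obtain p0 where p0: "p0 \<in> minimizers F" using ne by blast
  have "summable (\<lambda>k. (1/c) * (c * \<alpha> k * (F (z k) - F p0)))"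
    using conv[OF p0] by (intro summable_mult) simp
  then have "summable (\<lambda>k. \<alpha> k * (F (z k) - F p0))"
    using \<open>0 < c\<close> by (simp add: mult.assoc)
  then have ex: "\<exists>k\<ge>N. F (z k) - F p0 < \<eta>" if "0 < \<eta>" for \<eta> N
    using frequently_small_of_weighted_summable[of \<alpha>] \<alpha> mini[OF p0] that by simp
  have "\<exists>k. k > j \<and> F (z k) - F p0 < 1 / real (Suc l)" for j l
    using ex[of "1 / real (Suc l)" "Suc j"] by (auto simp: Suc_le_eq)
  then obtain nt where nx: "\<And>j l. nt j l > j \<and> F (z (nt j l)) - F p0 < 1 / real (Suc l)"
    by metis
  \<comment> \<open>Each new index lies beyond the previous one, with tolerance
    \<open>1 / (l + 1)\<close> at position \<open>l\<close>; \<open>r\<close> iterates this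
    choice.\<close>
  define r where "r = rec_nat (nt 0 0) (\<lambda>l j. nt j (Suc l))"
  have rm: "strict_mono r"
    by (rule strict_mono_Suc_iff[THEN iffD2]) (simp add: r_def nx)
  have r: "F (z (r l)) - F p0 < 1 / real (Suc l)" for l
    using nx[of 0 0] nx[of "r (l - 1)" l] by (cases l) (simp_all add: r_def)
  have lim1: "(\<lambda>l. F (z (r l)) - F p0) \<longlonglongrightarrow> 0"
  proof (rule tendsto_sandwich)
    show "\<forall>\<^sub>F l in sequentially. 0 \<le> F (z (r l)) - F p0" using mini[OF p0] by simp
    show "\<forall>\<^sub>F l in sequentially. F (z (r l)) - F p0 \<le> 1 / real (Suc l)"
      using r by (simp add: less_imp_le del: of_nat_Suc)
    show "(\<lambda>l. 1 / real (Suc l)) \<longlonglongrightarrow> 0" by (rule LIMSEQ_Suc[OF lim_1_over_n])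
  qed auto
  obtain B where B: "\<And>k. (norm (z k - p0))\<^sup>2 \<le> B"
    using convergent_imp_Bseq[OF conjunct1[OF conv[OF p0]]] by (auto simp: Bseq_def)
  have "bounded (range (z \<circ> r))"
  proof (rule boundedI)
    fix u assume "u \<in> range (z \<circ> r)"
    then obtain l where u: "u = z (r l)" by auto
    have "norm (u - p0) \<le> sqrt B" using B[of "r l"] by (simp add: u real_le_rsqrt)
    then show "norm u \<le> sqrt B + norm p0" using norm_triangle_sub[of u p0] by linarith
  qed
  then obtain q s where s: "strict_mono s" "((z \<circ> r) \<circ> s) \<longlonglongrightarrow> q"
    using bounded_imp_convergent_subsequence by blast
  have "isCont F q" using F by (simp add: continuous_on_eq_continuous_at)
  then have "(\<lambda>l. F (z (r (s l)))) \<longlonglongrightarrow> F q"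
    using s(2) isCont_tendsto_compose by (fastforce simp: o_def)
  moreover have "(\<lambda>l. F (z (r (s l)))) \<longlonglongrightarrow> F p0"
    using LIMSEQ_subseq_LIMSEQ[OF lim1 s(1)] by (simp add: o_def LIM_zero_iff)
  ultimately have "F q = F p0" by (rule LIMSEQ_unique)
  then have q: "q \<in> minimizers F"
    using mini[OF p0] by (auto simp: minimizers_def is_arg_min_def not_less)
  obtain L where L: "(\<lambda>k. (norm (z k - q))\<^sup>2) \<longlonglongrightarrow> L"
    using conv[OF q] by (auto simp: convergent_def)
  have "(\<lambda>l. (norm (z (r (s l)) - q))\<^sup>2) \<longlonglongrightarrow> L"
    using LIMSEQ_subseq_LIMSEQ[OF L strict_mono_o[OF rm s(1)]] by (simp add: o_def)
  moreover have "(\<lambda>l. (norm (z (r (s l)) - q))\<^sup>2) \<longlonglongrightarrow> (norm (q - q))\<^sup>2"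
    using s(2) by (intro tendsto_intros) (simp add: o_def)
  ultimately have "L = (norm (q - q))\<^sup>2" by (rule LIMSEQ_unique)
  with L have "(\<lambda>k. sqrt ((norm (z k - q))\<^sup>2)) \<longlonglongrightarrow> sqrt 0"
    by (intro tendsto_real_sqrt) simp
  then have "z \<longlonglongrightarrow> q"
    by (simp add: tendsto_norm_zero_iff LIM_zero_iff)
  with q show ?thesis by blast
qed

text \<open>Summing the recursion bounds \<open>1 - c\<close> times every partial sum of
  \<open>u\<close> by \<open>u 0\<close> plus the total of \<open>b\<close>.\<close>

lemma contracting_summable:
  fixes u b :: "nat \<Rightarrow> real"
  assumes u: "\<And>k. 0 \<le> u k" and b: "\<And>k. 0 \<le> b k" "summable b" and c: "c < 1"
    and step: "\<And>k. u (Suc k) \<le> c * u k + b k"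
  shows "summable u"
proof (rule summableI_nonneg_bounded[OF u])
  fix k
  have "(\<Sum>j<k. u j) \<le> (\<Sum>j<Suc k. u j)" using u by simp
  also have "(\<Sum>j<Suc k. u j) = u 0 + (\<Sum>j<k. u (Suc j))" by (rule sum.lessThan_Suc_shift)
  also have "\<dots> \<le> u 0 + (\<Sum>j<k. c * u j + b j)" by (intro add_left_mono sum_mono step)
  also have "\<dots> = u 0 + c * (\<Sum>j<k. u j) + (\<Sum>j<k. b j)" by (simp add: sum.distrib sum_distrib_left)
  also have "(\<Sum>j<k. b j) \<le> suminf b" by (rule sum_le_suminf) (use b in auto)
  finally have "(1 - c) * (\<Sum>j<k. u j) \<le> u 0 + suminf b" by (simp add: algebra_simps)
  then show "(\<Sum>j<k. u j) \<le> (u 0 + suminf b) / (1 - c)" using c by (simp add: field_simps)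
qed

text \<open>The recursive form suits inductions on measurability and second moments, while the
  consensus estimate produces the closed form. One constant serves both as the initial value and as
  the gain of the input.\<close>

primrec fading_memory :: "real \<Rightarrow> real \<Rightarrow> (nat \<Rightarrow> real) \<Rightarrow> nat \<Rightarrow> real" where
  "fading_memory C \<gamma> s 0 = C"
| "fading_memory C \<gamma> s (Suc k) = \<gamma> * fading_memory C \<gamma> s k + C * s k"

lemma fading_memory_closed_form:
  "fading_memory C \<gamma> s k = C * (\<gamma> ^ k + (\<Sum>r<k. \<gamma> ^ (k - 1 - r) * s r))"
proof (induction k)
  case (Suc k)
  have "(\<Sum>r<k. \<gamma> ^ (k - r) * s r) = \<gamma> * (\<Sum>r<k. \<gamma> ^ (k - 1 - r) * s r)"
    unfolding sum_distrib_left
  proof (rule sum.cong)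
    fix r assume "r \<in> {..<k}"
    then have "\<gamma> ^ (k - r) = \<gamma> * \<gamma> ^ (k - 1 - r)"
      by (simp flip: power_Suc add: Suc_diff_Suc)
    then show "\<gamma> ^ (k - r) * s r = \<gamma> * (\<gamma> ^ (k - 1 - r) * s r)" by simp
  qed simp
  then show ?case by (simp add: Suc algebra_simps)
qed simp

lemma norm_add_sq_le: "(norm (u + v))\<^sup>2 \<le> 2 * (norm u)\<^sup>2 + 2 * (norm v)\<^sup>2"
  for u v :: "'a::real_normed_vector"
proof -
  have "(norm (u + v))\<^sup>2 \<le> (norm u + norm v)\<^sup>2"
    by (intro power_mono norm_triangle_ineq) simp
  also have "\<dots> \<le> 2 * (norm u)\<^sup>2 + 2 * (norm v)\<^sup>2"
    using sum_squares_bound[of "norm u" "norm v"] by (simp add: power2_sum)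
  finally show ?thesis .
qed

section \<open>The standard Gaussian measure\<close>

definition gaussian :: "(real ^ 'm) measure" where
  "gaussian = density lborel (\<lambda>z. ennreal (std_gaussian_density z))"

lemma std_gaussian_density_nonneg: "0 \<le> std_gaussian_density z"
  by (simp add: std_gaussian_density_def)

lemma borel_measurable_std_gaussian_density [measurable]:
  "(std_gaussian_density :: real ^ 'm \<Rightarrow> real) \<in> borel_measurable borel"
  unfolding std_gaussian_density_def by measurable

lemma sets_gaussian [simp, measurable_cong]: "sets gaussian = sets borel"
  by (simp add: gaussian_def)

lemma space_gaussian [simp]: "space gaussian = UNIV"
  by (simp add: gaussian_def)

lemma card_Basis_vec: "card (Basis :: (real ^ 'm) set) = CARD('m)"
  using DIM_cart[where 'a=real and 'b='m] by simp

lemma norm_squared_eq_sum_Basis: "(norm z)\<^sup>2 = (\<Sum>b\<in>Basis. (inner z b)\<^sup>2)"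
  unfolding power2_norm_eq_inner by (subst euclidean_inner) (simp add: power2_eq_square)

text \<open>The squared norm is the sum of the squared coordinates, so the density factors over the
  orthonormal basis and moments reduce to those of the real normal law.\<close>

lemma std_gaussian_density_prod:
  "std_gaussian_density (z :: real ^ 'm) = (\<Prod>b\<in>Basis. std_normal_density (inner z b))"
proof -
  have "(\<Prod>b\<in>(Basis :: (real ^ 'm) set). std_normal_density (inner z b))
      = (\<Prod>b\<in>(Basis :: (real ^ 'm) set). 1 / sqrt (2 * pi)) * (\<Prod>b\<in>Basis. exp (- (inner z b)\<^sup>2 / 2))"
    by (simp add: std_normal_density_def prod_dividef power_one_over)
  also have "(\<Prod>b\<in>Basis. exp (- (inner z b)\<^sup>2 / 2)) = exp (- (1 / 2) * (norm z)\<^sup>2)"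
    by (simp add: exp_sum[symmetric] norm_squared_eq_sum_Basis sum_negf sum_divide_distrib[symmetric])
  also have "(\<Prod>b\<in>(Basis :: (real ^ 'm) set). 1 / sqrt (2 * pi)) = 1 / (2 * pi) powr (real CARD('m) / 2)"
    by (simp add: card_Basis_vec power_one_over powr_half_sqrt[symmetric] powr_powr powr_realpow[symmetric] powr_minus_divide)
  finally show ?thesis by (simp add: std_gaussian_density_def)
qed

text \<open>Only the factor of coordinate \<open>b\<close> carries the power; the others integrate
  to 1. The value is the double factorial of \<open>2 * k - 1\<close>, and
  \<open>k = 0, 1, 2\<close> give the total mass, the second and the fourth moment.\<close>

lemma nn_integral_gaussian_even_moment:
  fixes b :: "real ^ 'm"
  assumes b: "b \<in> Basis"
  shows "(\<integral>\<^sup>+ z. ennreal ((inner z b) ^ (2 * k)) \<partial>gaussian) = ennreal (fact (2 * k) / (2 ^ k * fact k))"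
proof -
  define g where "g c t = std_normal_density t * (if c = b then t ^ (2 * k) else 1)" for c :: "real ^ 'm" and t
  have gm [measurable]: "g c \<in> borel_measurable borel" for c unfolding g_def by measurable
  have g0: "0 \<le> g c t" for c t by (simp add: g_def)
  have "(\<integral>\<^sup>+ z. ennreal ((inner z b) ^ (2 * k)) \<partial>gaussian)
      = (\<integral>\<^sup>+ z. ennreal (std_gaussian_density z) * ennreal ((inner z b) ^ (2 * k)) \<partial>lborel)"
    unfolding gaussian_def by (subst nn_integral_density) auto
  also have "\<dots> = (\<integral>\<^sup>+ z. (\<Prod>c\<in>Basis. ennreal (g c (inner z c))) \<partial>lborel)"
  proof (rule nn_integral_cong)
    fix z :: "real ^ 'm"
    have "(\<Prod>c\<in>Basis. g c (inner z c)) = std_gaussian_density z * (inner z b) ^ (2 * k)"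
      unfolding g_def std_gaussian_density_prod prod.distrib using b by (simp add: prod.delta)
    then show "ennreal (std_gaussian_density z) * ennreal ((inner z b) ^ (2 * k))
        = (\<Prod>c\<in>Basis. ennreal (g c (inner z c)))"
      by (simp add: prod_ennreal g0 ennreal_mult'[symmetric] std_gaussian_density_nonneg)
  qed
  also have "\<dots> = (\<Prod>c\<in>(Basis :: (real ^ 'm) set). \<integral>\<^sup>+ t. ennreal (g c t) \<partial>lborel)"
    by (rule nn_integral_lborel_prod) (auto simp: g0)
  also have "\<dots> = (\<Prod>c\<in>(Basis :: (real ^ 'm) set). if c = b then ennreal (fact (2 * k) / (2 ^ k * fact k)) else 1)"
  proof (rule prod.cong)
    fix c :: "real ^ 'm"
    have hb: "has_bochner_integral lborel (\<lambda>t. std_normal_density t * t ^ (2 * j)) (fact (2 * j) / (2 ^ j * fact j))" for j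
      by (rule std_normal_moment_even)
    have "(\<integral>\<^sup>+ t. ennreal (std_normal_density t * t ^ (2 * j)) \<partial>lborel) = ennreal (fact (2 * j) / (2 ^ j * fact j))" for j
      using hb[of j] by (subst nn_integral_eq_integral) (auto simp: has_bochner_integral_iff)
    from this[of k] this[of 0]
    show "(\<integral>\<^sup>+ t. ennreal (g c t) \<partial>lborel) = (if c = b then ennreal (fact (2 * k) / (2 ^ k * fact k)) else 1)"
      by (simp add: g_def)
  qed simp
  also have "\<dots> = ennreal (fact (2 * k) / (2 ^ k * fact k))"
    using b by (simp add: prod.delta)
  finally show ?thesis .
qed

lemma has_bochner_integral_gaussian_even_moment:
  fixes b :: "real ^ 'm"
  assumes "b \<in> Basis"
  shows "has_bochner_integral gaussian (\<lambda>z. (inner z b) ^ (2 * k)) (fact (2 * k) / (2 ^ k * fact k))"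
  by (rule has_bochner_integral_nn_integral)
     (auto simp: nn_integral_gaussian_even_moment[OF assms] intro!: borel_measurable_continuous_onI continuous_intros)

lemma prob_space_gaussian: "prob_space (gaussian :: (real ^ 'm) measure)"
proof
  obtain b :: "real ^ 'm" where b: "b \<in> Basis" using nonempty_Basis by blast
  from nn_integral_gaussian_even_moment[OF b, of 0]
  show "emeasure (gaussian :: (real ^ 'm) measure) (space gaussian) = 1" by simp
qed

lemma gaussian_second_moment:
  "has_bochner_integral gaussian (\<lambda>z :: real ^ 'm. (norm z)\<^sup>2) (real CARD('m))"
proof -
  have "has_bochner_integral gaussian (\<lambda>z :: real ^ 'm. \<Sum>b\<in>Basis. (inner z b) ^ (2 * 1)) (\<Sum>b\<in>(Basis :: (real ^ 'm) set). 1)"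
    by (rule has_bochner_integral_sum) (use has_bochner_integral_gaussian_even_moment[of _ 1] in \<open>simp add: fact_numeral\<close>)
  then show ?thesis
    by (simp add: card_Basis_vec norm_squared_eq_sum_Basis)
qed

text \<open>Cauchy-Schwarz over the coordinates bounds the fourth power of the norm by a multiple of
  the sum of their fourth powers.\<close>

lemma integrable_gaussian_fourth_moment:
  "integrable gaussian (\<lambda>z :: real ^ 'm. (norm z) ^ 4)"
proof (rule Bochner_Integration.integrable_bound)
  show "integrable gaussian (\<lambda>z :: real ^ 'm. real CARD('m) * (\<Sum>b\<in>Basis. (inner z b) ^ (2 * 2)))"
    using has_bochner_integral_gaussian_even_moment[of _ 2]
    by (intro integrable_mult_right Bochner_Integration.integrable_sum) (auto simp: has_bochner_integral_iff)
  show "AE z in gaussian. norm ((norm (z :: real ^ 'm)) ^ 4) \<le> norm (real CARD('m) * (\<Sum>b\<in>Basis. (inner z b) ^ (2 * 2)))"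
  proof (rule AE_I2)
    fix z :: "real ^ 'm"
    have "(norm z) ^ 4 = (\<Sum>b\<in>Basis. (inner z b)\<^sup>2)\<^sup>2"
      unfolding norm_squared_eq_sum_Basis[symmetric] by (simp add: power_mult[symmetric])
    also have "\<dots> \<le> real CARD('m) * (\<Sum>b\<in>Basis. ((inner z b)\<^sup>2)\<^sup>2)"
      using sum_squared_le_sum_of_squares[of "\<lambda>b. (inner z b)\<^sup>2" "Basis :: (real ^ 'm) set"]
      by (simp add: card_Basis_vec mult.commute)
    finally show "norm ((norm z) ^ 4) \<le> norm (real CARD('m) * (\<Sum>b\<in>Basis. (inner z b) ^ (2 * 2)))"
      by (simp add: power_mult abs_mult sum_nonneg)
  qed
qed (auto intro!: borel_measurable_continuous_onI continuous_intros)

text \<open>With \<open>s\<close> the root of the dimension, the bound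
  \<open>norm z \<le> (norm z)^2 / (2 * s) + s / 2\<close> is tight at \<open>norm z = s\<close>.
  Integrating it with second moment \<open>s^2\<close> gives exactly \<open>s\<close>, and
  integrability comes along.\<close>

lemma integrable_gaussian_norm: "integrable gaussian (\<lambda>z :: real ^ 'm. norm z)"
  and gaussian_first_moment_le: "(\<integral>z. norm (z :: real ^ 'm) \<partial>gaussian) \<le> sqrt (real CARD('m))"
proof -
  interpret prob_space "gaussian :: (real ^ 'm) measure" by (rule prob_space_gaussian)
  let ?s = "sqrt (real CARD('m))"
  have s: "0 < ?s" by simp
  have sq: "integrable gaussian (\<lambda>z :: real ^ 'm. (norm z)\<^sup>2)" "(\<integral>z. (norm (z :: real ^ 'm))\<^sup>2 \<partial>gaussian) = real CARD('m)"
    using gaussian_second_moment by (auto simp: has_bochner_integral_iff)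
  have bnd: "norm z \<le> (norm z)\<^sup>2 / (2 * ?s) + ?s / 2" for z :: "real ^ 'm"
  proof -
    have "0 \<le> (norm z - ?s)\<^sup>2" by simp
    then have "2 * ?s * norm z \<le> (norm z)\<^sup>2 + ?s * ?s" by (simp add: power2_diff mult_ac)
    then show ?thesis using s by (simp add: field_simps)
  qed
  have i: "integrable gaussian (\<lambda>z :: real ^ 'm. (norm z)\<^sup>2 / (2 * ?s) + ?s / 2)"
    using sq by auto
  show I: "integrable gaussian (\<lambda>z :: real ^ 'm. norm z)"
    by (rule Bochner_Integration.integrable_bound[OF i]) (use bnd in \<open>auto intro: order.trans[OF _ abs_ge_self]\<close>)
  have "(\<integral>z. norm (z :: real ^ 'm) \<partial>gaussian) \<le> (\<integral>z. (norm (z :: real ^ 'm))\<^sup>2 / (2 * ?s) + ?s / 2 \<partial>gaussian)"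
    by (rule integral_mono[OF I i bnd])
  also have "\<dots> = real CARD('m) / (2 * ?s) + ?s / 2"
    using sq prob_space by simp
  also have "\<dots> = ?s" using real_sqrt_mult_self[of "real CARD('m)"] s by (simp add: field_simps)
  finally show "(\<integral>z. norm (z :: real ^ 'm) \<partial>gaussian) \<le> ?s" .
qed

lemma integrable_gaussian_id: "integrable gaussian (\<lambda>z :: real ^ 'm. z)"
  by (rule Bochner_Integration.integrable_bound[OF integrable_gaussian_norm]) auto

lemma lborel_distr_uminus_euclidean:
  "distr lborel borel uminus = (lborel :: 'a::euclidean_space measure)"
  using lborel_affine[of "-1" "0 :: 'a"] by (simp add: density_1 fun_Compl_def)

text \<open>Reflection preserves the density and negates the integrand, so the integral equals its
  own negative.\<close>

lemma gaussian_mean: "(\<integral>z. (z :: real ^ 'm) \<partial>gaussian) = 0"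
proof -
  have "(\<integral>z. (z :: real ^ 'm) \<partial>gaussian) = (\<integral>z. std_gaussian_density z *\<^sub>R (z :: real ^ 'm) \<partial>lborel)"
    unfolding gaussian_def by (subst integral_density) (auto simp: std_gaussian_density_nonneg)
  also have "\<dots> = (\<integral>z. std_gaussian_density z *\<^sub>R (z :: real ^ 'm) \<partial>distr lborel borel uminus)"
    by (simp add: lborel_distr_uminus_euclidean)
  also have "\<dots> = (\<integral>z. std_gaussian_density (- z) *\<^sub>R (- z :: real ^ 'm) \<partial>lborel)"
    by (subst integral_distr) auto
  also have "\<dots> = - (\<integral>z. std_gaussian_density z *\<^sub>R (z :: real ^ 'm) \<partial>lborel)"
    by (simp add: std_gaussian_density_def)
  also have "\<dots> = - (\<integral>z. (z :: real ^ 'm) \<partial>gaussian)"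
    unfolding gaussian_def by (subst integral_density) (auto simp: std_gaussian_density_nonneg)
  finally show ?thesis by (simp add: eq_neg_iff_add_eq_0 scaleR_2[symmetric])
qed

text \<open>The Cameron-Martin formula in finite dimension: translating the variable amounts to an
  exponential change of density. Stated for non-negative functions, it also settles integrability of
  the tilted integrand.\<close>

lemma nn_integral_gaussian_translate:
  fixes g :: "real ^ 'm \<Rightarrow> ennreal"
  assumes [measurable]: "g \<in> borel_measurable borel"
  shows "(\<integral>\<^sup>+ z. g (z + w) \<partial>gaussian) = (\<integral>\<^sup>+ z. ennreal (exp (inner z w - (norm w)\<^sup>2 / 2)) * g z \<partial>gaussian)"
proof -
  have tilt: "std_gaussian_density (z - w) = std_gaussian_density z * exp (inner z w - (norm w)\<^sup>2 / 2)" for z :: "real ^ 'm"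
    unfolding std_gaussian_density_def mult.assoc exp_add[symmetric]
    by (simp add: power2_norm_eq_inner inner_diff inner_commute field_simps)
  have "(\<integral>\<^sup>+ z. g (z + w) \<partial>gaussian) = (\<integral>\<^sup>+ z. ennreal (std_gaussian_density z) * g (z + w) \<partial>lborel)"
    unfolding gaussian_def by (subst nn_integral_density) auto
  also have "\<dots> = (\<integral>\<^sup>+ z. ennreal (std_gaussian_density (w + z - w)) * g (w + z) \<partial>lborel)"
    by (simp add: add.commute)
  also have "\<dots> = (\<integral>\<^sup>+ z. ennreal (std_gaussian_density (z - w)) * g z \<partial>distr lborel borel ((+) w))"
    by (subst nn_integral_distr) auto
  also have "\<dots> = (\<integral>\<^sup>+ z. ennreal (std_gaussian_density (z - w)) * g z \<partial>lborel)"
    by (simp add: lborel_distr_plus)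
  also have "\<dots> = (\<integral>\<^sup>+ z. ennreal (std_gaussian_density z) * (ennreal (exp (inner z w - (norm w)\<^sup>2 / 2)) * g z) \<partial>lborel)"
    by (simp add: tilt ennreal_mult' std_gaussian_density_nonneg mult.assoc)
  also have "\<dots> = (\<integral>\<^sup>+ z. ennreal (exp (inner z w - (norm w)\<^sup>2 / 2)) * g z \<partial>gaussian)"
    unfolding gaussian_def by (subst nn_integral_density) auto
  finally show ?thesis .
qed

section \<open>Gaussian smoothing and its oracle\<close>

text \<open>The expected oracle output at a fixed point. It represents the gradient of the smoothed
  function, the term with \<open>F x\<close> having mean zero because the Gaussian is
  centred.\<close>

definition mean_oracle :: "real \<Rightarrow> (real ^ 'm \<Rightarrow> real) \<Rightarrow> real ^ 'm \<Rightarrow> real ^ 'm" where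
  "mean_oracle \<mu> F x = (\<integral>z. oracle_step \<mu> F z x \<partial>gaussian)"

lemma smoothed_eq_gaussian_integral:
  assumes [measurable]: "F \<in> borel_measurable borel"
  shows "smoothed \<mu> F x = (\<integral>z. F (x + \<mu> *\<^sub>R z) \<partial>gaussian)"
proof -
  have "(\<integral>z. F (x + \<mu> *\<^sub>R z) \<partial>gaussian) = (\<integral>z. std_gaussian_density z *\<^sub>R F (x + \<mu> *\<^sub>R z) \<partial>lborel)"
    unfolding gaussian_def by (subst integral_density) (auto simp: std_gaussian_density_nonneg)
  also have "\<dots> = smoothed \<mu> F x"
    unfolding smoothed_def std_gaussian_density_def
    by (subst Bochner_Integration.integral_mult_right_zero[symmetric]) (simp add: mult_ac)
  finally show ?thesis by simp
qed

lemma integrable_gaussian_const [simp]: "integrable (gaussian :: (real ^ 'm) measure) (\<lambda>_. c :: 'b::{banach,second_countable_topology})"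
  by (rule finite_measure.integrable_const[OF prob_space.finite_measure[OF prob_space_gaussian]])

lemma measure_gaussian_UNIV [simp]: "measure (gaussian :: (real ^ 'm) measure) UNIV = 1"
  using prob_space.prob_space[OF prob_space_gaussian[where 'm='m]] by simp

context
  fixes F :: "real ^ 'm \<Rightarrow> real" and D \<mu> :: real
  assumes lip: "\<And>u v. \<bar>F u - F v\<bar> \<le> D * norm (u - v)" and \<mu>: "0 < \<mu>"
begin

lemma lipschitz_const_nonneg: "0 \<le> D"
proof -
  obtain b :: "real ^ 'm" where "b \<in> Basis" using nonempty_Basis by blast
  then show ?thesis using lip[of b 0] by simp
qed

lemma lipschitz_continuous: "continuous_on UNIV F"
  by (rule lipschitz_on_continuous_on[of D], rule lipschitz_onI)
     (use lip lipschitz_const_nonneg in \<open>auto simp: dist_norm\<close>)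

lemma lipschitz_borel_measurable [measurable]: "F \<in> borel_measurable borel"
  by (rule borel_measurable_continuous_onI[OF lipschitz_continuous])

lemma borel_measurable_oracle_step:
  "(\<lambda>p. oracle_step \<mu> F (snd p) (fst p)) \<in> borel_measurable borel"
  unfolding oracle_step_def
  using lipschitz_continuous
  by (intro borel_measurable_continuous_onI continuous_intros continuous_on_compose2[OF lipschitz_continuous])
     (use \<mu> in auto)

lemma measurable_oracle_step [measurable]:
  assumes "u \<in> borel_measurable N" "v \<in> borel_measurable N"
  shows "(\<lambda>\<omega>. oracle_step \<mu> F (u \<omega>) (v \<omega>)) \<in> borel_measurable N"
  using measurable_compose[OF borel_measurable_Pair[OF assms(2,1)] borel_measurable_oracle_step] by simp

lemma integrable_gaussian_lipschitz: "integrable gaussian (\<lambda>z. F (x + \<mu> *\<^sub>R z))"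
proof (rule Bochner_Integration.integrable_bound)
  show "integrable gaussian (\<lambda>z :: real ^ 'm. \<bar>F x\<bar> + D * \<mu> * norm z)"
    using integrable_gaussian_norm[where 'm='m] by simp
  show "AE z in gaussian. norm (F (x + \<mu> *\<^sub>R z)) \<le> norm (\<bar>F x\<bar> + D * \<mu> * norm z)"
  proof (rule AE_I2)
    fix z :: "real ^ 'm"
    show "norm (F (x + \<mu> *\<^sub>R z)) \<le> norm (\<bar>F x\<bar> + D * \<mu> * norm z)"
      using lip[of "x + \<mu> *\<^sub>R z" x] \<mu> lipschitz_const_nonneg by simp
  qed
qed measurable

lemma smoothed_eq: "smoothed \<mu> F x = (\<integral>z. F (x + \<mu> *\<^sub>R z) \<partial>gaussian)"
  by (rule smoothed_eq_gaussian_integral) measurable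

lemma smoothed_lipschitz: "\<bar>smoothed \<mu> F u - smoothed \<mu> F v\<bar> \<le> D * norm (u - v)"
proof -
  have "smoothed \<mu> F u - smoothed \<mu> F v = (\<integral>z. F (u + \<mu> *\<^sub>R z) - F (v + \<mu> *\<^sub>R z) \<partial>gaussian)"
    by (simp add: smoothed_eq integrable_gaussian_lipschitz)
  also have "\<bar>\<dots>\<bar> \<le> (\<integral>z. D * norm (u - v) \<partial>(gaussian :: (real ^ 'm) measure))"
    by (rule order.trans[OF integral_abs_bound integral_mono])
       (use lip[of "u + \<mu> *\<^sub>R z" "v + \<mu> *\<^sub>R z" for z] in \<open>auto intro!: integrable_abs Bochner_Integration.integrable_diff integrable_gaussian_lipschitz\<close>)
  finally show ?thesis by simp
qed

text \<open>The displacement \<open>\<mu> * norm z\<close> is averaged by the first Gaussian moment.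
  For the total objective \<open>D\<close> becomes \<open>n * D\<close>, and using the estimate at
  two points produces the final factor \<open>2 * n\<close>.\<close>

lemma smoothed_close: "\<bar>smoothed \<mu> F x - F x\<bar> \<le> sqrt (real CARD('m)) * \<mu> * D"
proof -
  have pt: "\<bar>F (x + \<mu> *\<^sub>R z) - F x\<bar> \<le> D * \<mu> * norm z" for z
    using lip[of "x + \<mu> *\<^sub>R z" x] \<mu> by (simp add: mult.assoc)
  have "smoothed \<mu> F x - F x = (\<integral>z. F (x + \<mu> *\<^sub>R z) - F x \<partial>gaussian)"
    by (simp add: smoothed_eq integrable_gaussian_lipschitz)
  also have "\<bar>\<dots>\<bar> \<le> (\<integral>z. D * \<mu> * norm (z :: real ^ 'm) \<partial>gaussian)"
    by (rule order.trans[OF integral_abs_bound integral_mono])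
       (use pt in
        \<open>auto intro!: integrable_abs Bochner_Integration.integrable_diff integrable_gaussian_lipschitz integrable_gaussian_norm[where 'm='m]\<close>)
  also have "\<dots> \<le> D * \<mu> * sqrt (real CARD('m))"
    using gaussian_first_moment_le[where 'm='m] lipschitz_const_nonneg \<mu> by (simp add: mult_left_mono)
  finally show ?thesis by (simp add: mult_ac)
qed

text \<open>The division by \<open>\<mu>\<close> cancels against the length of the probe, and the
  bound does not depend on \<open>x\<close>: the oracles are controlled by the samples
  alone.\<close>

lemma norm_oracle_step_le: "norm (oracle_step \<mu> F z x) \<le> D * (norm z)\<^sup>2"
proof -
  have "\<bar>F (x + \<mu> *\<^sub>R z) - F x\<bar> / \<mu> * norm z \<le> D * norm z * norm z"
    using lip[of "x + \<mu> *\<^sub>R z" x] \<mu> by (intro mult_right_mono) (auto simp: field_simps)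
  then show ?thesis using \<mu> by (simp add: oracle_step_def power2_eq_square mult.assoc)
qed

lemma integrable_oracle_step: "integrable gaussian (\<lambda>z. oracle_step \<mu> F z x)"
proof (rule Bochner_Integration.integrable_bound)
  show "integrable gaussian (\<lambda>z :: real ^ 'm. D * (norm z)\<^sup>2)"
    using gaussian_second_moment[where 'm='m] by (auto simp: has_bochner_integral_iff)
  show "AE z in gaussian. norm (oracle_step \<mu> F z x) \<le> norm (D * (norm z)\<^sup>2)"
    by (rule AE_I2) (use norm_oracle_step_le lipschitz_const_nonneg in simp)
qed measurable

lemma norm_mean_oracle_le: "norm (mean_oracle \<mu> F x) \<le> D * real CARD('m)"
proof -
  have "norm (mean_oracle \<mu> F x) \<le> (\<integral>z. norm (oracle_step \<mu> F z x) \<partial>gaussian)"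
    unfolding mean_oracle_def by (rule integral_norm_bound)
  also have "\<dots> \<le> (\<integral>z. D * (norm (z :: real ^ 'm))\<^sup>2 \<partial>gaussian)"
    by (rule integral_mono)
       (use gaussian_second_moment[where 'm='m] integrable_oracle_step norm_oracle_step_le
        in \<open>auto simp: has_bochner_integral_iff\<close>)
  also have "\<dots> = D * real CARD('m)"
    using gaussian_second_moment[where 'm='m] by (simp add: has_bochner_integral_iff)
  finally show ?thesis .
qed

text \<open>The difference of two oracles is regrouped, probed value against probed value and base
  value against base value. Each group is at most \<open>D * norm (u - v)\<close>, whence the factor
  2; the first moment of the sample supplies the root of the dimension.\<close>

lemma mean_oracle_lipschitz:
  "norm (mean_oracle \<mu> F u - mean_oracle \<mu> F v) \<le> 2 * D * sqrt (real CARD('m)) / \<mu> * norm (u - v)"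
proof -
  let ?c = "2 * D * norm (u - v) / \<mu>"
  have c: "0 \<le> ?c" using lipschitz_const_nonneg \<mu> by simp
  have pt: "norm (oracle_step \<mu> F z u - oracle_step \<mu> F z v) \<le> ?c * norm z" for z
  proof -
    have "oracle_step \<mu> F z u - oracle_step \<mu> F z v
        = (((F (u + \<mu> *\<^sub>R z) - F (v + \<mu> *\<^sub>R z)) - (F u - F v)) / \<mu>) *\<^sub>R z"
      by (simp add: oracle_step_def scaleR_diff_left[symmetric] diff_divide_distrib)
    moreover have "\<bar>(F (u + \<mu> *\<^sub>R z) - F (v + \<mu> *\<^sub>R z)) - (F u - F v)\<bar> \<le> 2 * D * norm (u - v)"
      using lip[of "u + \<mu> *\<^sub>R z" "v + \<mu> *\<^sub>R z"] lip[of u v] by simp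
    ultimately show ?thesis using \<mu> by (simp add: divide_right_mono mult_right_mono)
  qed
  have "mean_oracle \<mu> F u - mean_oracle \<mu> F v = (\<integral>z. oracle_step \<mu> F z u - oracle_step \<mu> F z v \<partial>gaussian)"
    by (simp add: mean_oracle_def integrable_oracle_step)
  also have "norm \<dots> \<le> (\<integral>z. norm (oracle_step \<mu> F z u - oracle_step \<mu> F z v) \<partial>gaussian)"
    by (rule integral_norm_bound)
  also have "\<dots> \<le> (\<integral>z. ?c * norm (z :: real ^ 'm) \<partial>gaussian)"
    by (rule integral_mono) (use pt integrable_oracle_step integrable_gaussian_norm[where 'm='m] in auto)
  also have "\<dots> \<le> ?c * sqrt (real CARD('m))"
    unfolding Bochner_Integration.integral_mult_right_zero
    by (rule mult_left_mono[OF gaussian_first_moment_le[where 'm='m] c])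
  finally show ?thesis by (simp add: mult_ac)
qed

end

lemma le_of_le_add_scaled:
  fixes a b K :: real
  assumes "\<And>t. 0 < t \<Longrightarrow> t \<le> 1 \<Longrightarrow> a \<le> b + t * K"
  shows "a \<le> b"
proof (rule field_le_epsilon)
  fix e :: real assume e: "0 < e"
  \<comment> \<open>Chosen to make \<open>t * \<bar>K\<bar>\<close> at most \<open>e\<close>; the
    added 1 keeps the denominator positive.\<close>
  define t where "t = min 1 (e / (\<bar>K\<bar> + 1))"
  have t: "0 < t" "t \<le> 1" "t * (\<bar>K\<bar> + 1) \<le> e"
  proof -
    have "t * (\<bar>K\<bar> + 1) \<le> e / (\<bar>K\<bar> + 1) * (\<bar>K\<bar> + 1)"
      by (intro mult_right_mono) (auto simp: t_def)
    also have "\<dots> = e" using abs_ge_zero[of K] by (simp add: field_simps)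
    finally show "t * (\<bar>K\<bar> + 1) \<le> e" .
  qed (use e in \<open>auto simp: t_def\<close>)
  have "t * K \<le> t * (\<bar>K\<bar> + 1)" using t(1) by (intro mult_left_mono) auto
  with assms[OF t(1,2)] t(3) show "a \<le> b + e" by linarith
qed

text \<open>
  The smoothed function need not be differentiated: moving the base point by \<open>t v\<close> tilts the Gaussian
  density by a factor \<open>exp s \<ge> 1 + s\<close>, which bounds the increment from below since \<open>F - c \<ge> 0\<close>;
  convexity bounds it from above, and \<open>t\<close> tends to \<open>0\<close>.
\<close>

lemma mean_oracle_subgradient:
  fixes F :: "real ^ 'm \<Rightarrow> real"
  assumes lip: "\<And>u v. \<bar>F u - F v\<bar> \<le> D * norm (u - v)" and \<mu>: "0 < \<mu>"
    and conv: "convex_on UNIV F" and c: "\<And>u. c \<le> F u"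
  shows "smoothed \<mu> F x + inner (mean_oracle \<mu> F x) (y - x) \<le> smoothed \<mu> F y"
proof -
  note [measurable] = lipschitz_borel_measurable[OF lip \<mu>]
  note int = integrable_gaussian_lipschitz[OF lip \<mu>]
  note D0 = lipschitz_const_nonneg[OF lip \<mu>]
  \<comment> \<open>Measured in units of \<open>\<mu>\<close>, a move of the base point by
    \<open>t\<close> times \<open>y - x\<close> becomes a translation of the Gaussian variable by
    \<open>t *\<^sub>R w\<close>.\<close>
  define w where "w = (1 / \<mu>) *\<^sub>R (y - x)"
  have y: "y = x + \<mu> *\<^sub>R w" using \<mu> by (simp add: w_def)
  define g where "g z = F (x + \<mu> *\<^sub>R z) - c" for z
  define \<phi> where "\<phi> t = smoothed \<mu> F (x + (t * \<mu>) *\<^sub>R w)" for t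
  have g0: "0 \<le> g z" for z using c by (simp add: g_def)
  have gm [measurable]: "g \<in> borel_measurable borel" unfolding g_def by measurable
  have gint: "integrable gaussian g" unfolding g_def using int by simp
  define I1 where "I1 = (\<integral>z. inner z w * g z \<partial>gaussian)"
  have wg: "integrable gaussian (\<lambda>z. inner z w * g z)"
  proof (rule Bochner_Integration.integrable_bound)
    show "integrable gaussian (\<lambda>z :: real ^ 'm. norm w * ((\<bar>F x\<bar> + \<bar>c\<bar>) * norm z + D * \<mu> * (norm z)\<^sup>2))"
      using integrable_gaussian_norm[where 'm='m] gaussian_second_moment[where 'm='m]
      by (auto simp: has_bochner_integral_iff)
    show "AE z in gaussian. norm (inner z w * g z)
        \<le> norm (norm w * ((\<bar>F x\<bar> + \<bar>c\<bar>) * norm z + D * \<mu> * (norm z)\<^sup>2))"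
    proof (rule AE_I2)
      fix z :: "real ^ 'm"
      have "\<bar>g z\<bar> \<le> \<bar>F x\<bar> + \<bar>c\<bar> + D * \<mu> * norm z"
        using lip[of "x + \<mu> *\<^sub>R z" x] \<mu> by (simp add: g_def)
      then have "\<bar>inner z w\<bar> * \<bar>g z\<bar> \<le> (norm z * norm w) * (\<bar>F x\<bar> + \<bar>c\<bar> + D * \<mu> * norm z)"
        by (intro mult_mono Cauchy_Schwarz_ineq2) auto
      then show "norm (inner z w * g z) \<le> norm (norm w * ((\<bar>F x\<bar> + \<bar>c\<bar>) * norm z + D * \<mu> * (norm z)\<^sup>2))"
        using D0 \<mu> by (simp add: abs_mult power2_eq_square algebra_simps)
    qed
  qed measurable
  have \<phi>_eq: "\<phi> t = (\<integral>z. g (z + t *\<^sub>R w) \<partial>gaussian) + c" for t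
    unfolding \<phi>_def smoothed_eq[OF lip \<mu>] g_def
    using int[of "x + (t * \<mu>) *\<^sub>R w"] by (simp add: algebra_simps)
  have gtint: "integrable gaussian (\<lambda>z. g (z + t *\<^sub>R w))" for t
    using int[of "x + (t * \<mu>) *\<^sub>R w"] by (simp add: g_def algebra_simps)
  have lower: "\<phi> 0 + t * I1 - t\<^sup>2 * ((norm w)\<^sup>2 / 2 * (\<phi> 0 - c)) \<le> \<phi> t" for t
  proof -
    \<comment> \<open>The tilted integral is finite because it equals the integral of a translate of
      \<open>g\<close>; integrability of the product with the exponential needs no separate
      estimate.\<close>
    let ?u = "\<lambda>z. inner z (t *\<^sub>R w) - (norm (t *\<^sub>R w))\<^sup>2 / 2"
    have "(\<integral>\<^sup>+ z. ennreal (exp (?u z) * g z) \<partial>gaussian) = ennreal (\<phi> t - c)"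
      using nn_integral_gaussian_translate[of "\<lambda>z. ennreal (g z)" "t *\<^sub>R w"] gtint[of t] g0
      by (simp add: ennreal_mult' nn_integral_eq_integral \<phi>_eq)
    then have hb: "has_bochner_integral gaussian (\<lambda>z. exp (?u z) * g z) (\<phi> t - c)"
      by (intro has_bochner_integral_nn_integral) (use g0 in \<open>auto simp: \<phi>_eq\<close>)
    have eq: "(1 + ?u z) * g z = g z + t * (inner z w * g z) - t\<^sup>2 * (norm w)\<^sup>2 / 2 * g z" for z
      by (simp add: power_mult_distrib algebra_simps)
    have "integrable gaussian (\<lambda>z. (1 + ?u z) * g z)"
      unfolding eq using gint wg by simp
    then have "(\<integral>z. (1 + ?u z) * g z \<partial>gaussian) \<le> (\<integral>z. exp (?u z) * g z \<partial>gaussian)"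
      by (rule integral_mono)
         (use hb g0 in \<open>auto simp: has_bochner_integral_iff intro!: mult_right_mono exp_ge_add_one_self\<close>)
    moreover have "(\<integral>z. (1 + ?u z) * g z \<partial>gaussian) = (\<phi> 0 - c) + t * I1 - t\<^sup>2 * (norm w)\<^sup>2 / 2 * (\<phi> 0 - c)"
      unfolding eq I1_def using gint wg by (simp add: \<phi>_eq)
    ultimately show ?thesis using hb by (simp add: has_bochner_integral_iff algebra_simps)
  qed
  have upper: "\<phi> t \<le> (1 - t) * \<phi> 0 + t * \<phi> 1" if "0 \<le> t" "t \<le> 1" for t
  proof -
    have "\<phi> t \<le> (\<integral>z. (1 - t) * F (x + \<mu> *\<^sub>R z) + t * F (y + \<mu> *\<^sub>R z) \<partial>gaussian)"
      unfolding \<phi>_def smoothed_eq[OF lip \<mu>]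
    proof (rule integral_mono)
      fix z :: "real ^ 'm"
      have "(1 - t) *\<^sub>R (x + \<mu> *\<^sub>R z) + t *\<^sub>R (y + \<mu> *\<^sub>R z) = x + (t * \<mu>) *\<^sub>R w + \<mu> *\<^sub>R z"
        by (simp add: y algebra_simps)
      then show "F (x + (t * \<mu>) *\<^sub>R w + \<mu> *\<^sub>R z) \<le> (1 - t) * F (x + \<mu> *\<^sub>R z) + t * F (y + \<mu> *\<^sub>R z)"
        using convex_onD[OF conv, of t "x + \<mu> *\<^sub>R z" "y + \<mu> *\<^sub>R z"] that by simp
    qed (use int in auto)
    then show ?thesis
      using int by (simp add: \<phi>_def smoothed_eq[OF lip \<mu>] y)
  qed
  \<comment> \<open>The two bounds on \<open>\<phi> t\<close> differ by a term quadratic in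
    \<open>t\<close>; after division by \<open>t\<close> it still vanishes with
    \<open>t\<close>.\<close>
  have "I1 \<le> \<phi> 1 - \<phi> 0"
  proof (rule le_of_le_add_scaled[where K = "(norm w)\<^sup>2 / 2 * (\<phi> 0 - c)"])
    fix t :: real assume t: "0 < t" "t \<le> 1"
    let ?K = "(norm w)\<^sup>2 / 2 * (\<phi> 0 - c)"
    have "t * I1 \<le> t * (\<phi> 1 - \<phi> 0 + t * ?K)"
      using lower[of t] upper[of t] t by (simp add: power2_eq_square algebra_simps)
    with t show "I1 \<le> \<phi> 1 - \<phi> 0 + t * ?K" by (simp only: mult_le_cancel_left_pos)
  qed
  moreover have "inner (mean_oracle \<mu> F x) (y - x) = I1"
  proof -
    have "inner (mean_oracle \<mu> F x) (y - x) = (\<integral>z. inner (oracle_step \<mu> F z x) (y - x) \<partial>gaussian)"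
      unfolding mean_oracle_def by (rule integral_inner_left[symmetric]) (use integrable_oracle_step[OF lip \<mu>] in auto)
    \<comment> \<open>The increment of \<open>F\<close> in the oracle is \<open>g z\<close> less the
      constant \<open>F x - c\<close>. The constant multiplies \<open>inner z w\<close>, whose mean
      is zero.\<close>
    also have "\<dots> = (\<integral>z. inner z w * g z - (F x - c) * inner z w \<partial>gaussian)"
      using \<mu> by (intro Bochner_Integration.integral_cong) (auto simp: oracle_step_def g_def y field_simps)
    also have "\<dots> = I1 - (F x - c) * (\<integral>z. inner z w \<partial>gaussian)"
      unfolding I1_def using wg integrable_gaussian_id[where 'm='m] by (subst Bochner_Integration.integral_diff) auto
    also have "(\<integral>z. inner z w \<partial>gaussian) = 0"
      using integral_inner_left[OF integrable_gaussian_id[where 'm='m], of w] gaussian_mean[where 'm='m] by simp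
    finally show ?thesis by simp
  qed
  ultimately show ?thesis by (simp add: \<phi>_def y)
qed

lemma smoothed_sum:
  fixes fi :: "'i \<Rightarrow> real ^ 'm \<Rightarrow> real"
  assumes lip: "\<And>i u v. i \<in> I \<Longrightarrow> \<bar>fi i u - fi i v\<bar> \<le> D * norm (u - v)" and \<mu>: "0 < \<mu>"
  shows "smoothed \<mu> (\<lambda>v. \<Sum>i\<in>I. fi i v) x = (\<Sum>i\<in>I. smoothed \<mu> (fi i) x)"
proof -
  have [measurable]: "fi i \<in> borel_measurable borel" if "i \<in> I" for i
    by (rule lipschitz_borel_measurable[OF lip[OF that] \<mu>])
  have "smoothed \<mu> (\<lambda>v. \<Sum>i\<in>I. fi i v) x = (\<integral>z. (\<Sum>i\<in>I. fi i (x + \<mu> *\<^sub>R z)) \<partial>gaussian)"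
    by (rule smoothed_eq_gaussian_integral) measurable
  also have "\<dots> = (\<Sum>i\<in>I. smoothed \<mu> (fi i) x)"
    by (subst Bochner_Integration.integral_sum)
       (use smoothed_eq[OF lip \<mu>] integrable_gaussian_lipschitz[OF lip \<mu>] in auto)
  finally show ?thesis .
qed

text \<open>Additivity carries the subgradient inequality, proved for the convex sum, over to the
  sum of the oracles of the single functions.\<close>

lemma mean_oracle_sum:
  fixes fi :: "'i \<Rightarrow> real ^ 'm \<Rightarrow> real"
  assumes lip: "\<And>i u v. i \<in> I \<Longrightarrow> \<bar>fi i u - fi i v\<bar> \<le> D * norm (u - v)" and \<mu>: "0 < \<mu>"
  shows "mean_oracle \<mu> (\<lambda>v. \<Sum>i\<in>I. fi i v) x = (\<Sum>i\<in>I. mean_oracle \<mu> (fi i) x)"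
proof -
  have "oracle_step \<mu> (\<lambda>v. \<Sum>i\<in>I. fi i v) z x = (\<Sum>i\<in>I. oracle_step \<mu> (fi i) z x)" for z
    by (simp add: oracle_step_def sum_subtractf[symmetric] sum_divide_distrib scaleR_sum_left)
  then show ?thesis
    unfolding mean_oracle_def
    by (simp add: Bochner_Integration.integral_sum integrable_oracle_step[OF lip \<mu>])
qed

section \<open>Square-integrable martingales and mean convergence\<close>

lemma integrable_mult_of_squares:
  fixes u v :: "'a \<Rightarrow> real"
  assumes [measurable]: "u \<in> borel_measurable M" "v \<in> borel_measurable M"
    and u: "integrable M (\<lambda>\<omega>. (u \<omega>)\<^sup>2)" and v: "integrable M (\<lambda>\<omega>. (v \<omega>)\<^sup>2)"
  shows "integrable M (\<lambda>\<omega>. u \<omega> * v \<omega>)"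
proof (rule Bochner_Integration.integrable_bound)
  show "integrable M (\<lambda>\<omega>. (u \<omega>)\<^sup>2 + (v \<omega>)\<^sup>2)" using u v by simp
  have "\<bar>s * t\<bar> \<le> s\<^sup>2 + t\<^sup>2" for s t :: real
  proof -
    have "2 * \<bar>s * t\<bar> \<le> s\<^sup>2 + t\<^sup>2"
      using sum_squares_bound[of "\<bar>s\<bar>" "\<bar>t\<bar>"] by (simp add: abs_mult)
    then show ?thesis using abs_ge_zero[of "s * t"] by linarith
  qed
  then show "AE \<omega> in M. norm (u \<omega> * v \<omega>) \<le> norm ((u \<omega>)\<^sup>2 + (v \<omega>)\<^sup>2)"
    by (intro AE_I2) simp
qed measurable

text \<open>Monotone convergence: the series has finite integral, hence is finite almost
  everywhere.\<close>

lemma AE_summable_of_summable_integrals: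
  fixes g :: "nat \<Rightarrow> 'a \<Rightarrow> real"
  assumes int: "\<And>k. integrable M (g k)" and nn: "\<And>k \<omega>. 0 \<le> g k \<omega>"
    and sum: "summable (\<lambda>k. \<integral>\<omega>. g k \<omega> \<partial>M)"
  shows "AE \<omega> in M. summable (\<lambda>k. g k \<omega>)"
proof -
  have [measurable]: "g k \<in> borel_measurable M" for k using int by blast
  have "(\<integral>\<^sup>+ \<omega>. (\<Sum>k. ennreal (g k \<omega>)) \<partial>M) = (\<Sum>k. \<integral>\<^sup>+ \<omega>. ennreal (g k \<omega>) \<partial>M)"
    by (rule nn_integral_suminf) measurable
  also have "\<dots> = (\<Sum>k. ennreal (\<integral>\<omega>. g k \<omega> \<partial>M))"
    using int nn by (simp add: nn_integral_eq_integral)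
  also have "\<dots> < \<infinity>"
    using sum nn by (simp add: suminf_ennreal2 integral_nonneg)
  finally have "AE \<omega> in M. (\<Sum>k. ennreal (g k \<omega>)) \<noteq> \<infinity>"
    by (intro nn_integral_noteq_infinite) auto
  then show ?thesis
    by eventually_elim (use nn in \<open>auto intro: summable_suminf_not_top\<close>)
qed

text \<open>\<open>F k\<close> stands for what is known before the samples of time \<open>k\<close>
  are drawn, so an increment with index \<open>k\<close> belongs to
  \<open>F (Suc k)\<close>.\<close>

locale filtered_prob_space = prob_space M for M :: "'w measure" +
  fixes F :: "nat \<Rightarrow> 'w measure"
  assumes subalgebra_F: "\<And>k. subalgebra M (F k)"
    and subalgebra_F_Suc: "\<And>k. subalgebra (F (Suc k)) (F k)"
begin

lemma subalgebra_F_mono: "j \<le> k \<Longrightarrow> subalgebra (F k) (F j)"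
proof (induction k)
  case (Suc k)
  then show ?case
    using subalgebra_F_Suc[of k] by (cases "j = Suc k") (auto simp: subalgebra_def)
qed (simp add: subalgebra_def)

lemma measurable_F_mono: "g \<in> measurable (F j) N \<Longrightarrow> j \<le> k \<Longrightarrow> g \<in> measurable (F k) N"
  by (rule measurable_from_subalg[OF subalgebra_F_mono])

lemma measurable_F: "g \<in> measurable (F j) N \<Longrightarrow> g \<in> measurable M N"
  by (rule measurable_from_subalg[OF subalgebra_F])

text \<open>
  Kolmogorov's inequality for martingale differences, proved by stopping the partial sums
  when they first reach level \<open>l\<close>; the stopped sums still have orthogonal increments.
\<close>

lemma martingale_maximal_inequality:
  fixes d :: "nat \<Rightarrow> 'w \<Rightarrow> real"
  assumes d [measurable]: "\<And>k. d k \<in> borel_measurable (F (Suc k))"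
    and d2: "\<And>k. integrable M (\<lambda>\<omega>. (d k \<omega>)\<^sup>2)"
    and orth: "\<And>k Z. Z \<in> borel_measurable (F k) \<Longrightarrow> integrable M (\<lambda>\<omega>. (Z \<omega>)\<^sup>2) \<Longrightarrow>
      (\<integral>\<omega>. d k \<omega> * Z \<omega> \<partial>M) = 0"
    and "0 < l"
  shows "prob {\<omega> \<in> space M. \<exists>j\<le>K. l \<le> \<bar>\<Sum>k<j. d k \<omega>\<bar>} \<le> (\<Sum>k<K. \<integral>\<omega>. (d k \<omega>)\<^sup>2 \<partial>M) / l\<^sup>2"
proof -
  define S where "S j \<omega> = (\<Sum>k<j. d k \<omega>)" for j \<omega>
  \<comment> \<open>The indicator that level \<open>l\<close> has not been reached up to time
    \<open>k\<close>. It involves only sums known at \<open>F k\<close>, so it is an admissible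
    multiplier of \<open>d k\<close>.\<close>
  define Z where "Z k \<omega> = (if \<forall>j\<in>{..k}. \<bar>S j \<omega>\<bar> < l then 1 else 0 :: real)" for k \<omega>
  define T where "T j \<omega> = (\<Sum>k<j. Z k \<omega> * d k \<omega>)" for j \<omega>
  have dF: "d k \<in> borel_measurable (F j)" if "k < j" for k j
    using measurable_F_mono[OF d[of k], of j] that by simp
  have dM [measurable]: "d k \<in> borel_measurable M" for k
    by (rule measurable_F[OF d])
  have SF: "S j \<in> borel_measurable (F k)" if "j \<le> k" for j k
    unfolding S_def using dF that by (intro borel_measurable_sum) simp
  have ZF: "Z k \<in> borel_measurable (F k)" for k
  proof -
    have "Measurable.pred (F k) (\<lambda>\<omega>. \<bar>S j \<omega>\<bar> < l)" if "j \<in> {..k}" for j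
    proof -
      have [measurable]: "S j \<in> borel_measurable (F k)" using SF that by simp
      show ?thesis by measurable
    qed
    then have [measurable]: "Measurable.pred (F k) (\<lambda>\<omega>. \<forall>j\<in>{..k}. \<bar>S j \<omega>\<bar> < l)"
      by (intro pred_intros_finite) auto
    show ?thesis unfolding Z_def by measurable
  qed
  have TF: "T j \<in> borel_measurable (F j)" for j
    unfolding T_def
    using dF measurable_F_mono[OF ZF] by (intro borel_measurable_sum borel_measurable_times) auto
  have [measurable]: "T j \<in> borel_measurable M" "Z j \<in> borel_measurable M" "S j \<in> borel_measurable M" for j
    using measurable_F[OF TF] measurable_F[OF ZF] measurable_F[OF SF[of j j]] by auto
  have Z01: "Z k \<omega> = 0 \<or> Z k \<omega> = 1" for k \<omega> by (simp add: Z_def)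
  have Zsq: "(Z k \<omega> * t)\<^sup>2 \<le> t\<^sup>2" "(t * Z k \<omega>)\<^sup>2 \<le> t\<^sup>2" for k \<omega> t
    using Z01[of k \<omega>] by auto
  have Zd2: "integrable M (\<lambda>\<omega>. (Z k \<omega> * d k \<omega>)\<^sup>2)" for k
    by (rule Bochner_Integration.integrable_bound[OF d2[of k]]) (measurable, use Zsq in simp)
  have T2: "integrable M (\<lambda>\<omega>. (T j \<omega>)\<^sup>2) \<and> (\<integral>\<omega>. (T j \<omega>)\<^sup>2 \<partial>M) \<le> (\<Sum>k<j. \<integral>\<omega>. (d k \<omega>)\<^sup>2 \<partial>M)" for j
  proof (induction j)
    case (Suc j)
    have TZ: "integrable M (\<lambda>\<omega>. (T j \<omega> * Z j \<omega>)\<^sup>2)"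
      by (rule Bochner_Integration.integrable_bound[OF conjunct1[OF Suc.IH]])
         (measurable, use Zsq in simp)
    have cross: "integrable M (\<lambda>\<omega>. d j \<omega> * (T j \<omega> * Z j \<omega>))"
      by (rule integrable_mult_of_squares) (use d2 TZ in auto)
    \<comment> \<open>Relative to the increment \<open>d j\<close>, the factor
      \<open>T j * Z j\<close> is a function of the past, so the cross term vanishes.\<close>
    have cross0: "(\<integral>\<omega>. d j \<omega> * (T j \<omega> * Z j \<omega>) \<partial>M) = 0"
      by (rule orth) (use TF ZF TZ in auto)
    have eq: "(T (Suc j) \<omega>)\<^sup>2 = (T j \<omega>)\<^sup>2 + 2 * (d j \<omega> * (T j \<omega> * Z j \<omega>)) + (Z j \<omega> * d j \<omega>)\<^sup>2" for \<omega>
      by (simp add: T_def power2_eq_square algebra_simps)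
    have "(\<integral>\<omega>. (Z j \<omega> * d j \<omega>)\<^sup>2 \<partial>M) \<le> (\<integral>\<omega>. (d j \<omega>)\<^sup>2 \<partial>M)"
    proof (rule integral_mono[OF Zd2 d2])
      fix \<omega> show "(Z j \<omega> * d j \<omega>)\<^sup>2 \<le> (d j \<omega>)\<^sup>2" using Z01[of j \<omega>] by auto
    qed
    then show ?case
      unfolding eq using Suc.IH cross cross0 Zd2[of j] by simp
  qed (simp add: T_def)
  have stop: "l \<le> \<bar>T K \<omega>\<bar>" if ex: "\<exists>j\<le>K. l \<le> \<bar>S j \<omega>\<bar>" for \<omega>
  proof -
    define j where "j = (LEAST j. l \<le> \<bar>S j \<omega>\<bar>)"
    have j: "l \<le> \<bar>S j \<omega>\<bar>" "j \<le> K" "\<And>i. i < j \<Longrightarrow> \<bar>S i \<omega>\<bar> < l"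
      using ex unfolding j_def
      by (auto intro: LeastI Least_le[THEN order.trans] dest: not_less_Least simp: not_le)
    have "T K \<omega> = (\<Sum>k<K. if k < j then d k \<omega> else 0)"
      unfolding T_def
    proof (rule sum.cong)
      fix k assume "k \<in> {..<K}"
      show "Z k \<omega> * d k \<omega> = (if k < j then d k \<omega> else 0)"
      proof (cases "k < j")
        case True
        then have "\<forall>i\<in>{..k}. \<bar>S i \<omega>\<bar> < l" using j(3) by simp
        then show ?thesis using True by (simp add: Z_def)
      next
        case False
        then have "\<not> (\<forall>i\<in>{..k}. \<bar>S i \<omega>\<bar> < l)" using j(1) by (metis atMost_iff not_le)
        then have "Z k \<omega> = 0" unfolding Z_def by (rule if_not_P)
        then show ?thesis using False by simp
      qed
    qed simp
    also have "\<dots> = (\<Sum>k\<in>{..<K} \<inter> {..<j}. d k \<omega>)"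
      by (subst sum.inter_restrict) auto
    also have "{..<K} \<inter> {..<j} = {..<j}" using j(2) by auto
    finally show ?thesis using j(1) by (simp add: S_def)
  qed
  have "prob {\<omega> \<in> space M. \<exists>j\<le>K. l \<le> \<bar>S j \<omega>\<bar>} \<le> prob {\<omega> \<in> space M. l\<^sup>2 \<le> (T K \<omega>)\<^sup>2}"
    using stop \<open>0 < l\<close> by (intro finite_measure_mono) (auto simp: abs_le_square_iff[symmetric], measurable)
  also have "\<dots> \<le> (\<integral>\<omega>. (T K \<omega>)\<^sup>2 \<partial>M) / l\<^sup>2"
    by (rule integral_Markov_inequality_measure[where A = "{}"]) (use T2[of K] \<open>0 < l\<close> in auto)
  also have "\<dots> \<le> (\<Sum>k<K. \<integral>\<omega>. (d k \<omega>)\<^sup>2 \<partial>M) / l\<^sup>2"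
    using T2[of K] by (intro divide_right_mono) auto
  finally show ?thesis by (simp add: S_def)
qed

end

text \<open>The maximal inequality for the sums started at \<open>m\<close> bounds the probability
  of an oscillation of size \<open>l\<close> after \<open>m\<close> by the tail of the variances
  over \<open>l^2\<close>. The tail vanishes, so almost surely every level admits some
  \<open>m\<close> without such an oscillation, and the partial sums are Cauchy.\<close>

lemma (in filtered_prob_space) martingale_converges_AE:
  fixes d :: "nat \<Rightarrow> 'w \<Rightarrow> real"
  assumes d: "\<And>k. d k \<in> borel_measurable (F (Suc k))"
    and d2: "\<And>k. integrable M (\<lambda>\<omega>. (d k \<omega>)\<^sup>2)"
    and orth: "\<And>k Z. Z \<in> borel_measurable (F k) \<Longrightarrow> integrable M (\<lambda>\<omega>. (Z \<omega>)\<^sup>2) \<Longrightarrow>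
      (\<integral>\<omega>. d k \<omega> * Z \<omega> \<partial>M) = 0"
    and sum: "summable (\<lambda>k. \<integral>\<omega>. (d k \<omega>)\<^sup>2 \<partial>M)"
  shows "AE \<omega> in M. summable (\<lambda>k. d k \<omega>)"
proof -
  have dM [measurable]: "d k \<in> borel_measurable M" for k
    by (rule measurable_F[OF d])
  define E where "E k = (\<integral>\<omega>. (d k \<omega>)\<^sup>2 \<partial>M)" for k
  have E0: "0 \<le> E k" for k unfolding E_def by simp
  have sE: "summable E" using sum by (simp add: E_def[abs_def])
  define bad where "bad l m = {\<omega> \<in> space M. \<exists>j. l \<le> \<bar>\<Sum>k<j. d (m + k) \<omega>\<bar>}" for l :: real and m
  have [measurable]: "bad l m \<in> sets M" for l m unfolding bad_def by measurable
  have bad_le: "prob (bad l m) \<le> (\<Sum>k. E (k + m)) / l\<^sup>2" if "0 < l" for l m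
  proof -
    define A where "A K = {\<omega> \<in> space M. \<exists>j\<le>K. l \<le> \<bar>\<Sum>k<j. d (m + k) \<omega>\<bar>}" for K
    have [measurable]: "A K \<in> sets M" for K unfolding A_def by measurable
    have le: "prob (A K) \<le> (\<Sum>k. E (k + m)) / l\<^sup>2" for K
    proof -
      \<comment> \<open>Shifting time by \<open>m\<close> makes the maximal inequality speak of sums
        that start there.\<close>
      interpret sh: filtered_prob_space M "\<lambda>k. F (m + k)"
        by unfold_locales (use subalgebra_F subalgebra_F_Suc in auto)
      have "prob (A K) \<le> (\<Sum>k<K. E (m + k)) / l\<^sup>2"
        unfolding A_def E_def
        by (rule sh.martingale_maximal_inequality) (use d d2 orth that in auto)
      also have "(\<Sum>k<K. E (m + k)) \<le> (\<Sum>k. E (k + m))"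
        using sum_le_suminf[of "\<lambda>k. E (k + m)" "{..<K}"] E0 sE
        by (simp add: summable_iff_shift add.commute)
      finally show ?thesis using \<open>0 < l\<close> by (simp add: divide_right_mono)
    qed
    \<comment> \<open>Finite horizons increase to the event over all indices, and the measure is
      continuous from below.\<close>
    have "(\<lambda>K. prob (A K)) \<longlonglongrightarrow> prob (\<Union>K. A K)"
      by (rule finite_Lim_measure_incseq) (auto simp: A_def incseq_def intro: order.trans)
    moreover have "(\<Union>K. A K) = bad l m" by (auto simp: A_def bad_def)
    ultimately show ?thesis
      using le by (metis LIMSEQ_le_const2)
  qed
  have "AE \<omega> in M. \<exists>m. \<omega> \<notin> bad l m" if "0 < l" for l
  proof -
    have "prob (\<Inter>m. bad l m) \<le> (\<Sum>k. E (k + m)) / l\<^sup>2" for m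
      using bad_le[OF that, of m] finite_measure_mono[of "\<Inter>m. bad l m" "bad l m"]
      by (auto intro: order.trans)
    moreover have "(\<lambda>m. (\<Sum>k. E (k + m)) / l\<^sup>2) \<longlonglongrightarrow> 0 / l\<^sup>2"
      using suminf_exist_split2[OF sE] that by (intro tendsto_divide tendsto_const) auto
    ultimately have "prob (\<Inter>m. bad l m) \<le> 0 / l\<^sup>2"
      by (intro LIMSEQ_le_const) auto
    then have "prob (\<Inter>m. bad l m) = 0" by (simp add: measure_le_0_iff)
    then have "AE \<omega> in M. \<omega> \<notin> (\<Inter>m. bad l m)"
      by (subst (asm) prob_eq_0) auto
    then show ?thesis by simp
  qed
  \<comment> \<open>Countably many levels suffice for the Cauchy property and keep the exceptional
    set null.\<close>
  then have "AE \<omega> in M. \<forall>q. \<exists>m. \<omega> \<notin> bad (1 / real (Suc q)) m"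
    by (subst AE_all_countable) simp
  then show ?thesis
  proof (rule AE_mp, intro AE_I2 impI)
    fix \<omega> assume \<omega>: "\<omega> \<in> space M" "\<forall>q. \<exists>m. \<omega> \<notin> bad (1 / real (Suc q)) m"
    have "Cauchy (\<lambda>k. \<Sum>j<k. d j \<omega>)"
    proof (rule metric_CauchyI)
      fix e :: real assume "0 < e"
      then obtain q where q: "1 / real (Suc q) < e / 2"
        using nat_approx_posE[of "e / 2"] by auto
      obtain m where "\<omega> \<notin> bad (1 / real (Suc q)) m" using \<omega>(2) by blast
      then have "\<bar>\<Sum>k<j. d (m + k) \<omega>\<bar> < 1 / real (Suc q)" for j
        using \<omega>(1) unfolding bad_def by (simp add: not_le del: of_nat_Suc)
      then have b: "\<bar>\<Sum>k<j. d (m + k) \<omega>\<bar> < e / 2" for j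
        using q less_trans by blast
      have near: "\<bar>(\<Sum>j<k. d j \<omega>) - (\<Sum>j<m. d j \<omega>)\<bar> < e / 2" if "m \<le> k" for k
      proof -
        have "(\<Sum>j<m + i. d j \<omega>) = (\<Sum>j<m. d j \<omega>) + (\<Sum>j<i. d (m + j) \<omega>)" for i
          by (induction i) auto
        from this[of "k - m"] have "(\<Sum>j<k. d j \<omega>) - (\<Sum>j<m. d j \<omega>) = (\<Sum>j<k - m. d (m + j) \<omega>)"
          using that by simp
        then show ?thesis using b[of "k - m"] by simp
      qed
      show "\<exists>N. \<forall>k\<ge>N. \<forall>k'\<ge>N. dist (\<Sum>j<k. d j \<omega>) (\<Sum>j<k'. d j \<omega>) < e"
      proof (intro exI allI impI)
        fix k k' assume "m \<le> k" "m \<le> k'"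
        from near[OF this(1)] near[OF this(2)]
        show "dist (\<Sum>j<k. d j \<omega>) (\<Sum>j<k'. d j \<omega>) < e"
          unfolding dist_real_def by linarith
      qed
    qed
    then show "summable (\<lambda>k. d k \<omega>)"
      by (simp add: summable_iff_convergent Cauchy_convergent)
  qed
qed

text \<open>Truncation at a level \<open>R\<close>: the truncated part tends to 0 in mean by
  dominated convergence, and the excess is at most the square over \<open>R\<close>, whose mean is
  small uniformly in \<open>k\<close>.\<close>

lemma (in prob_space) L1_tendsto_zero_of_L2_bounded:
  fixes W :: "nat \<Rightarrow> 'a \<Rightarrow> real"
  assumes W [measurable]: "\<And>k. W k \<in> borel_measurable M" and nn: "\<And>k \<omega>. 0 \<le> W k \<omega>"
    and W2: "\<And>k. integrable M (\<lambda>\<omega>. (W k \<omega>)\<^sup>2)" "\<And>k. (\<integral>\<omega>. (W k \<omega>)\<^sup>2 \<partial>M) \<le> K"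
    and lim: "AE \<omega> in M. (\<lambda>k. W k \<omega>) \<longlonglongrightarrow> 0"
  shows "integrable M (W k)" and "(\<lambda>k. \<integral>\<omega>. W k \<omega> \<partial>M) \<longlonglongrightarrow> 0"
proof -
  show int: "integrable M (W k)" for k
    using square_integrable_imp_integrable[OF W W2(1)] by simp
  have K: "0 \<le> K" by (rule order.trans[OF _ W2(2)[of 0]]) simp
  show "(\<lambda>k. \<integral>\<omega>. W k \<omega> \<partial>M) \<longlonglongrightarrow> 0"
  proof (rule LIMSEQ_I)
    fix e :: real assume e: "0 < e"
    \<comment> \<open>Chosen so that \<open>K / R\<close> falls below \<open>e / 2\<close>; the
      added 1 keeps \<open>R\<close> positive when \<open>K\<close> is 0.\<close>
    define R where "R = 2 * (K + 1) / e"
    have R: "0 < R" "K / R < e / 2" using e K by (auto simp: R_def field_simps)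
    have mint: "integrable M (\<lambda>\<omega>. min (W k \<omega>) R)" for k
      using int by simp
    have "(\<lambda>k. \<integral>\<omega>. min (W k \<omega>) R \<partial>M) \<longlonglongrightarrow> (\<integral>\<omega>. 0 \<partial>M)"
    proof (rule integral_dominated_convergence[where w = "\<lambda>_. R"])
      show "AE \<omega> in M. (\<lambda>k. min (W k \<omega>) R) \<longlonglongrightarrow> 0"
        using lim
      proof eventually_elim
        case (elim \<omega>)
        from tendsto_min[OF this tendsto_const[of R]] show ?case using R by simp
      qed
    qed (use nn R in \<open>auto simp: less_imp_le\<close>)
    then have "\<forall>\<^sub>F k in sequentially. (\<integral>\<omega>. min (W k \<omega>) R \<partial>M) < e / 2"
      using e by (intro order_tendstoD(2)) auto
    then obtain N where N: "\<And>k. k \<ge> N \<Longrightarrow> (\<integral>\<omega>. min (W k \<omega>) R \<partial>M) < e / 2"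
      by (auto simp: eventually_sequentially)
    have "norm ((\<integral>\<omega>. W k \<omega> \<partial>M) - 0) < e" if "k \<ge> N" for k
    proof -
      have "(\<integral>\<omega>. W k \<omega> \<partial>M) \<le> (\<integral>\<omega>. min (W k \<omega>) R + (W k \<omega>)\<^sup>2 / R \<partial>M)"
      proof (rule integral_mono[OF int])
        show "integrable M (\<lambda>\<omega>. min (W k \<omega>) R + (W k \<omega>)\<^sup>2 / R)"
          using mint W2 by simp
        fix \<omega>
        show "W k \<omega> \<le> min (W k \<omega>) R + (W k \<omega>)\<^sup>2 / R"
        proof (cases "W k \<omega> \<le> R")
          case False
          then have "W k \<omega> * R \<le> (W k \<omega>)\<^sup>2"
            unfolding power2_eq_square by (intro mult_left_mono nn) simp
          then have "W k \<omega> \<le> (W k \<omega>)\<^sup>2 / R" using R by (simp add: field_simps)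
          then show ?thesis using R(1) False by (simp add: min_def)
        qed (use R in simp)
      qed
      also have "\<dots> = (\<integral>\<omega>. min (W k \<omega>) R \<partial>M) + (\<integral>\<omega>. (W k \<omega>)\<^sup>2 \<partial>M) / R"
        using mint W2 by simp
      also have "\<dots> < e / 2 + K / R"
        by (intro add_less_le_mono N that divide_right_mono W2(2)) (use R in auto)
      finally have "(\<integral>\<omega>. W k \<omega> \<partial>M) < e" using R(2) by linarith
      moreover have "0 \<le> (\<integral>\<omega>. W k \<omega> \<partial>M)" using nn by simp
      ultimately show ?thesis by simp
    qed
    then show "\<exists>N. \<forall>k\<ge>N. norm ((\<integral>\<omega>. W k \<omega> \<partial>M) - 0) < e" by blast
  qed
qed

text \<open>Fatou's lemma: the second moment of the limit is at most the common bound
  \<open>K\<close>.\<close>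

lemma integrable_square_norm_limit:
  fixes z :: "nat \<Rightarrow> 'a \<Rightarrow> 'b::euclidean_space"
  assumes z [measurable]: "\<And>k. z k \<in> borel_measurable M" and l [measurable]: "l \<in> borel_measurable M"
    and z2: "\<And>k. integrable M (\<lambda>\<omega>. (norm (z k \<omega>))\<^sup>2)" "\<And>k. (\<integral>\<omega>. (norm (z k \<omega>))\<^sup>2 \<partial>M) \<le> K"
    and lim: "AE \<omega> in M. (\<lambda>k. z k \<omega>) \<longlonglongrightarrow> l \<omega>"
  shows "integrable M (\<lambda>\<omega>. (norm (l \<omega>))\<^sup>2)"
proof (rule integrableI_bounded)
  have "(\<integral>\<^sup>+ \<omega>. ennreal (norm ((norm (l \<omega>))\<^sup>2)) \<partial>M) = (\<integral>\<^sup>+ \<omega>. liminf (\<lambda>k. ennreal ((norm (z k \<omega>))\<^sup>2)) \<partial>M)"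
  proof (rule nn_integral_cong_AE)
    show "AE \<omega> in M. ennreal (norm ((norm (l \<omega>))\<^sup>2)) = liminf (\<lambda>k. ennreal ((norm (z k \<omega>))\<^sup>2))"
      using lim
    proof eventually_elim
      case (elim \<omega>)
      then have "(\<lambda>k. ennreal ((norm (z k \<omega>))\<^sup>2)) \<longlonglongrightarrow> ennreal ((norm (l \<omega>))\<^sup>2)"
        by (intro tendsto_ennrealI tendsto_intros)
      from lim_imp_Liminf[OF _ this] show ?case by simp
    qed
  qed
  also have "\<dots> \<le> liminf (\<lambda>k. \<integral>\<^sup>+ \<omega>. ennreal ((norm (z k \<omega>))\<^sup>2) \<partial>M)"
    by (rule nn_integral_liminf) measurable
  also have "\<dots> \<le> limsup (\<lambda>k. \<integral>\<^sup>+ \<omega>. ennreal ((norm (z k \<omega>))\<^sup>2) \<partial>M)"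
    by (rule Liminf_le_Limsup) simp
  also have "\<dots> \<le> ennreal K"
    by (rule Limsup_bounded) (use z2 in \<open>auto simp: nn_integral_eq_integral ennreal_leI\<close>)
  also have "\<dots> < \<infinity>" by simp
  finally show "(\<integral>\<^sup>+ \<omega>. ennreal (norm ((norm (l \<omega>))\<^sup>2)) \<partial>M) < \<infinity>" .
qed measurable

section \<open>Surplus-based consensus\<close>

lemma abs_entry_le_mat_norm_inf:
  assumes "i < dim_row A" "j < dim_col A"
  shows "\<bar>A $$ (i, j)\<bar> \<le> mat_norm_inf A"
proof -
  have "\<bar>A $$ (i, j)\<bar> \<le> (\<Sum>j<dim_col A. \<bar>A $$ (i, j)\<bar>)"
    by (rule member_le_sum) (use assms in auto)
  also have "\<dots> \<le> mat_norm_inf A"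
    unfolding mat_norm_inf_def by (rule Max_ge) (use assms in auto)
  finally show ?thesis .
qed

text \<open>Matrix powers unfold with the new factor on the right, whereas the recursion applies
  \<open>W\<close> on the left.\<close>

lemma pow_mat_Suc_left:
  assumes A: "(A :: 'a::semiring_1 mat) \<in> carrier_mat n n"
  shows "A ^\<^sub>m Suc k = A * A ^\<^sub>m k"
proof (induction k)
  case (Suc k)
  have "A ^\<^sub>m Suc (Suc k) = (A * A ^\<^sub>m k) * A" using Suc by simp
  also have "\<dots> = A * (A ^\<^sub>m k * A)" by (rule assoc_mult_mat) (use A in auto)
  finally show ?case by simp
qed (use A in simp)

text \<open>Variation of constants: the input \<open>u r\<close> enters at time
  \<open>r + 1\<close>, so by time \<open>k\<close> it has been multiplied by \<open>W\<close>
  another \<open>k - 1 - r\<close> times.\<close>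

lemma linear_recursion_solution:
  fixes v u :: "nat \<Rightarrow> nat \<Rightarrow> 'v::real_vector"
  assumes W: "W \<in> carrier_mat N N"
    and step: "\<And>k a. a < N \<Longrightarrow> v (Suc k) a = (\<Sum>b<N. W $$ (a, b) *\<^sub>R v k b) - u k a"
    and "a < N"
  shows "v k a = (\<Sum>b<N. (W ^\<^sub>m k) $$ (a, b) *\<^sub>R v 0 b)
    - (\<Sum>r<k. \<Sum>b<N. (W ^\<^sub>m (k - 1 - r)) $$ (a, b) *\<^sub>R u r b)"
  using \<open>a < N\<close>
proof (induction k arbitrary: a)
  case 0
  have "(\<Sum>b<N. (W ^\<^sub>m 0) $$ (a, b) *\<^sub>R v 0 b) = (\<Sum>b<N. if b = a then v 0 b else 0)"
    by (rule sum.cong) (use W 0 in auto)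
  then show ?case using 0 by simp
next
  case (Suc k)
  have pw: "W ^\<^sub>m j \<in> carrier_mat N N" for j using W by simp
  have entry: "(\<Sum>c<N. W $$ (a, c) * (W ^\<^sub>m j) $$ (c, b)) = (W ^\<^sub>m Suc j) $$ (a, b)" if "b < N" for b j
  proof -
    have "W ^\<^sub>m Suc j = W * W ^\<^sub>m j"
      by (rule pow_mat_Suc_left[OF W])
    then have "(W ^\<^sub>m Suc j) $$ (a, b) = (W * W ^\<^sub>m j) $$ (a, b)" by simp
    also have "\<dots> = (\<Sum>c<N. W $$ (a, c) * (W ^\<^sub>m j) $$ (c, b))"
      using W pw[of j] Suc.prems that by (simp add: scalar_prod_def atLeast0LessThan)
    finally show ?thesis by simp
  qed
  have push: "(\<Sum>c<N. W $$ (a, c) *\<^sub>R (\<Sum>b<N. (W ^\<^sub>m j) $$ (c, b) *\<^sub>R y b))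
      = (\<Sum>b<N. (W ^\<^sub>m Suc j) $$ (a, b) *\<^sub>R y b)" for j and y :: "nat \<Rightarrow> 'v"
  proof -
    have "(\<Sum>c<N. W $$ (a, c) *\<^sub>R (\<Sum>b<N. (W ^\<^sub>m j) $$ (c, b) *\<^sub>R y b))
        = (\<Sum>b<N. \<Sum>c<N. (W $$ (a, c) * (W ^\<^sub>m j) $$ (c, b)) *\<^sub>R y b)"
      by (subst sum.swap) (simp add: scaleR_sum_right)
    also have "\<dots> = (\<Sum>b<N. (W ^\<^sub>m Suc j) $$ (a, b) *\<^sub>R y b)"
      by (rule sum.cong) (simp_all add: scaleR_sum_left[symmetric] entry del: pow_mat.simps)
    finally show ?thesis .
  qed
  have swap: "(\<Sum>c<N. W $$ (a, c) *\<^sub>R (\<Sum>r<k. g r c)) = (\<Sum>r<k. \<Sum>c<N. W $$ (a, c) *\<^sub>R g r c)"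
    for g :: "nat \<Rightarrow> nat \<Rightarrow> 'v"
    unfolding scaleR_sum_right by (rule sum.swap)
  have diag: "(\<Sum>b<N. (W ^\<^sub>m 0) $$ (a, b) *\<^sub>R u k b) = u k a"
  proof -
    have "(\<Sum>b<N. (W ^\<^sub>m 0) $$ (a, b) *\<^sub>R u k b) = (\<Sum>b<N. if b = a then u k b else 0)"
      by (rule sum.cong) (use W Suc.prems in auto)
    then show ?thesis using Suc.prems by simp
  qed
  have "v (Suc k) a = (\<Sum>c<N. W $$ (a, c) *\<^sub>R ((\<Sum>b<N. (W ^\<^sub>m k) $$ (c, b) *\<^sub>R v 0 b)
      - (\<Sum>r<k. \<Sum>b<N. (W ^\<^sub>m (k - 1 - r)) $$ (c, b) *\<^sub>R u r b))) - u k a"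
    unfolding step[OF Suc.prems]
    by (rule arg_cong[where f = "\<lambda>s. s - u k a"], rule sum.cong) (simp_all add: Suc.IH)
  also have "\<dots> = (\<Sum>b<N. (W ^\<^sub>m Suc k) $$ (a, b) *\<^sub>R v 0 b)
      - (\<Sum>r<k. \<Sum>c<N. W $$ (a, c) *\<^sub>R (\<Sum>b<N. (W ^\<^sub>m (k - 1 - r)) $$ (c, b) *\<^sub>R u r b)) - u k a"
    by (simp only: scaleR_diff_right sum_subtractf swap push)
  also have "(\<Sum>r<k. \<Sum>c<N. W $$ (a, c) *\<^sub>R (\<Sum>b<N. (W ^\<^sub>m (k - 1 - r)) $$ (c, b) *\<^sub>R u r b))
      = (\<Sum>r<k. \<Sum>b<N. (W ^\<^sub>m (Suc k - 1 - r)) $$ (a, b) *\<^sub>R u r b)"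
    unfolding push
  proof (rule sum.cong)
    fix r assume "r \<in> {..<k}"
    then have "Suc (k - 1 - r) = Suc k - 1 - r" by simp
    then show "(\<Sum>b<N. (W ^\<^sub>m Suc (k - 1 - r)) $$ (a, b) *\<^sub>R u r b)
      = (\<Sum>b<N. (W ^\<^sub>m (Suc k - 1 - r)) $$ (a, b) *\<^sub>R u r b)" by (simp only:)
  qed simp
  finally show ?case
    using diag by (simp add: del: pow_mat.simps)
qed

text \<open>
  Since the columns of \<open>W\<close> sum to \<open>1\<close>, the average over all coordinates moves only through \<open>u\<close>,
  so subtracting it replaces \<open>W ^ k\<close> by its deviation from the averaging matrix.
\<close>

lemma deviation_from_average_le:
  fixes v u :: "nat \<Rightarrow> nat \<Rightarrow> 'v::real_normed_vector"
  assumes W: "W \<in> carrier_mat N N"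
    and step: "\<And>k a. a < N \<Longrightarrow> v (Suc k) a = (\<Sum>b<N. W $$ (a, b) *\<^sub>R v k b) - u k a"
    and col: "\<And>b. b < N \<Longrightarrow> (\<Sum>a<N. W $$ (a, b)) = 1"
    and dev: "\<And>k b. b < N \<Longrightarrow> \<bar>(W ^\<^sub>m k) $$ (a, b) - q\<bar> \<le> C * \<gamma> ^ k"
    and a: "a < N"
  shows "norm (v k a - q *\<^sub>R (\<Sum>b<N. v k b))
    \<le> C * (\<gamma> ^ k * (\<Sum>b<N. norm (v 0 b)) + (\<Sum>r<k. \<gamma> ^ (k - 1 - r) * (\<Sum>b<N. norm (u r b))))"
proof -
  have sum_step: "(\<Sum>a<N. v (Suc k) a) = (\<Sum>b<N. v k b) - (\<Sum>b<N. u k b)" for k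
  proof -
    have "(\<Sum>a<N. v (Suc k) a) = (\<Sum>a<N. \<Sum>b<N. W $$ (a, b) *\<^sub>R v k b) - (\<Sum>b<N. u k b)"
      by (simp add: step sum_subtractf)
    also have "(\<Sum>a<N. \<Sum>b<N. W $$ (a, b) *\<^sub>R v k b) = (\<Sum>b<N. v k b)"
      by (subst sum.swap) (simp add: scaleR_sum_left[symmetric] col)
    finally show ?thesis .
  qed
  have sum_sol: "(\<Sum>b<N. v k b) = (\<Sum>b<N. v 0 b) - (\<Sum>r<k. \<Sum>b<N. u r b)" for k
    by (induction k) (simp_all add: sum_step)
  have sol: "v k a = (\<Sum>b<N. (W ^\<^sub>m k) $$ (a, b) *\<^sub>R v 0 b)
      - (\<Sum>r<k. \<Sum>b<N. (W ^\<^sub>m (k - 1 - r)) $$ (a, b) *\<^sub>R u r b)"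
    by (rule linear_recursion_solution[OF W _ a]) (rule step)
  define P where "P j b = (W ^\<^sub>m j) $$ (a, b) - q" for j b
  have P_le: "norm (P j b *\<^sub>R y) \<le> (C * \<gamma> ^ j) * norm y" if "b < N" for j b and y :: 'v
    unfolding norm_scaleR P_def real_norm_def by (rule mult_right_mono[OF dev[OF that] norm_ge_zero])
  have eq: "v k a - q *\<^sub>R (\<Sum>b<N. v k b) = (\<Sum>b<N. P k b *\<^sub>R v 0 b) - (\<Sum>r<k. \<Sum>b<N. P (k - 1 - r) b *\<^sub>R u r b)"
    unfolding sum_sol[of k] P_def
    by (subst sol, simp add: scaleR_diff_left scaleR_diff_right sum_subtractf scaleR_sum_right)
  have "norm (v k a - q *\<^sub>R (\<Sum>b<N. v k b)) \<le> (\<Sum>b<N. norm (P k b *\<^sub>R v 0 b)) + (\<Sum>r<k. \<Sum>b<N. norm (P (k - 1 - r) b *\<^sub>R u r b))"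
    unfolding eq by (rule order.trans[OF norm_triangle_ineq4 add_mono[OF norm_sum order.trans[OF norm_sum sum_mono[OF norm_sum]]]])
  also have "\<dots> \<le> (\<Sum>b<N. (C * \<gamma> ^ k) * norm (v 0 b)) + (\<Sum>r<k. \<Sum>b<N. (C * \<gamma> ^ (k - 1 - r)) * norm (u r b))"
  proof (rule add_mono)
    show "(\<Sum>b<N. norm (P k b *\<^sub>R v 0 b)) \<le> (\<Sum>b<N. (C * \<gamma> ^ k) * norm (v 0 b))"
      by (rule sum_mono) (simp only: P_le lessThan_iff)
    show "(\<Sum>r<k. \<Sum>b<N. norm (P (k - 1 - r) b *\<^sub>R u r b)) \<le> (\<Sum>r<k. \<Sum>b<N. (C * \<gamma> ^ (k - 1 - r)) * norm (u r b))"
      by (rule sum_mono, rule sum_mono) (simp only: P_le lessThan_iff)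
  qed
  also have "\<dots> = C * (\<gamma> ^ k * (\<Sum>b<N. norm (v 0 b)) + (\<Sum>r<k. \<gamma> ^ (k - 1 - r) * (\<Sum>b<N. norm (u r b))))"
    by (simp only: sum_distrib_left distrib_left mult.assoc)
  finally show ?thesis .
qed

section \<open>The augmented matrix of the surplus algorithm\<close>

lemma sum_lessThan_double: "(\<Sum>b<2 * (n::nat). g b) = (\<Sum>b<n. g b) + (\<Sum>b<n. g (n + b))"
  for g :: "nat \<Rightarrow> 'v::comm_monoid_add"
proof -
  have "(\<Sum>b<n + m. g b) = (\<Sum>b<n. g b) + (\<Sum>b<m. g (n + b))" for m
    by (induction m) (auto simp: add.assoc)
  from this[of n] show ?thesis by (simp add: mult_2)
qed

lemma augmented_matrix_carrier:
  "Wr \<in> carrier_mat n n \<Longrightarrow> Wc \<in> carrier_mat n n \<Longrightarrow> augmented_matrix n Wr Wc \<epsilon> \<in> carrier_mat (2 * n) (2 * n)"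
  by (auto simp: augmented_matrix_def mult_2)

lemma augmented_matrix_entries:
  assumes "Wr \<in> carrier_mat n n" "Wc \<in> carrier_mat n n" "i < n" "j < n"
  shows "augmented_matrix n Wr Wc \<epsilon> $$ (i, j) = Wr $$ (i, j)"
    "augmented_matrix n Wr Wc \<epsilon> $$ (i, n + j) = (if i = j then \<epsilon> else 0)"
    "augmented_matrix n Wr Wc \<epsilon> $$ (n + i, j) = (if i = j then 1 else 0) - Wr $$ (i, j)"
    "augmented_matrix n Wr Wc \<epsilon> $$ (n + i, n + j) = Wc $$ (i, j) - (if i = j then \<epsilon> else 0)"
  using assms by (auto simp: augmented_matrix_def)

text \<open>Both upper blocks have the same entry, so in the limit every \<open>x\<close> coordinate
  receives the total of all \<open>x\<close> and \<open>y\<close> divided by \<open>n\<close>, and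
  not by the number \<open>2 * n\<close> of coordinates.\<close>

lemma limit_matrix_entry:
  assumes "i < n" "b < 2 * n"
  shows "limit_matrix n $$ (i, b) = 1 / real n"
  using assms by (auto simp: limit_matrix_def)

text \<open>In the left columns \<open>Wr\<close> cancels against the block \<open>I - Wr\<close>
  below it; in the right columns \<open>\<epsilon>\<close> cancels and the column sums of
  \<open>Wc\<close> remain. The surplus \<open>y\<close> thus stores what the \<open>x\<close>
  update would lose.\<close>

lemma augmented_matrix_column_sum:
  assumes Wr: "Wr \<in> carrier_mat n n" and Wc: "column_stochastic n Wc" and b: "b < 2 * n"
  shows "(\<Sum>a<2 * n. augmented_matrix n Wr Wc \<epsilon> $$ (a, b)) = 1"
proof -
  have Wc': "Wc \<in> carrier_mat n n" "\<And>j. j < n \<Longrightarrow> (\<Sum>i<n. Wc $$ (i, j)) = 1"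
    using Wc by (auto simp: column_stochastic_def)
  note ent = augmented_matrix_entries[OF Wr Wc'(1)]
  show ?thesis
  proof (cases "b < n")
    case True
    then show ?thesis by (simp add: sum_lessThan_double ent sum_subtractf)
  next
    case False
    then obtain j where j: "b = n + j" "j < n" using b by (metis add_less_cancel_left le_Suc_ex mult_2 not_less)
    then show ?thesis by (simp add: sum_lessThan_double ent sum_subtractf Wc'(2))
  qed
qed

text \<open>The hypothesis on the powers excludes \<open>k = 0\<close>, whence the enlarged constant.\<close>

lemma augmented_matrix_power_deviation:
  assumes Wr: "Wr \<in> carrier_mat n n" and Wc: "Wc \<in> carrier_mat n n"
    and bound: "\<forall>k\<ge>1. mat_norm_inf (augmented_matrix n Wr Wc \<epsilon> ^\<^sub>m k - limit_matrix n) \<le> \<Gamma> * \<gamma> ^ k"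
    and \<gamma>: "0 < \<gamma>" and i: "i < n" and b: "b < 2 * n"
  shows "\<bar>(augmented_matrix n Wr Wc \<epsilon> ^\<^sub>m k) $$ (i, b) - 1 / real n\<bar> \<le> max \<Gamma> 1 * \<gamma> ^ k"
proof -
  let ?W = "augmented_matrix n Wr Wc \<epsilon>"
  have W: "?W \<in> carrier_mat (2 * n) (2 * n)" by (rule augmented_matrix_carrier[OF Wr Wc])
  have pw: "?W ^\<^sub>m k \<in> carrier_mat (2 * n) (2 * n)" using W by simp
  have L: "limit_matrix n \<in> carrier_mat (2 * n) (2 * n)" by (auto simp: limit_matrix_def mult_2)
  show ?thesis
  proof (cases "k = 0")
    case True
    then have "(?W ^\<^sub>m k) $$ (i, b) = (if i = b then 1 else 0)" using W i b by simp
    moreover have "0 \<le> 1 / real n" "1 / real n \<le> 1" using i by auto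
    ultimately have "\<bar>(?W ^\<^sub>m k) $$ (i, b) - 1 / real n\<bar> \<le> 1" by simp
    then show ?thesis using True by simp
  next
    case False
    have "(?W ^\<^sub>m k) $$ (i, b) - 1 / real n = (?W ^\<^sub>m k - limit_matrix n) $$ (i, b)"
      using pw L i b by (simp add: limit_matrix_entry)
    also have "\<bar>\<dots>\<bar> \<le> mat_norm_inf (?W ^\<^sub>m k - limit_matrix n)"
      by (rule abs_entry_le_mat_norm_inf) (use pw L i b in auto)
    also have "\<dots> \<le> \<Gamma> * \<gamma> ^ k" using bound False by simp
    also have "\<dots> \<le> max \<Gamma> 1 * \<gamma> ^ k" using \<gamma> by (intro mult_right_mono) auto
    finally show ?thesis .
  qed
qed

text \<open>The stacked vector has the oracle terms as input in its \<open>x\<close> half and no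
  input in its \<open>y\<close> half. The general deviation estimate is read off for the
  \<open>x\<close> rows with weight \<open>1 / n\<close>.\<close>

lemma surplus_consensus:
  fixes x y g :: "nat \<Rightarrow> nat \<Rightarrow> 'v::real_normed_vector"
  assumes Wr: "Wr \<in> carrier_mat n n" and Wc: "column_stochastic n Wc"
    and bound: "\<forall>k\<ge>1. mat_norm_inf (augmented_matrix n Wr Wc \<epsilon> ^\<^sub>m k - limit_matrix n) \<le> \<Gamma> * \<gamma> ^ k"
    and \<gamma>: "0 < \<gamma>"
    and x: "\<And>i k. i < n \<Longrightarrow> x i (Suc k) = (\<Sum>j<n. Wr $$ (i, j) *\<^sub>R x j k) + \<epsilon> *\<^sub>R y i k - g i k"
    and y: "\<And>i k. i < n \<Longrightarrow> y i (Suc k) = x i k - (\<Sum>j<n. Wr $$ (i, j) *\<^sub>R x j k)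
      + (\<Sum>j<n. Wc $$ (i, j) *\<^sub>R y j k) - \<epsilon> *\<^sub>R y i k"
  shows "i < n \<Longrightarrow> norm (x i k - (1 / real n) *\<^sub>R (\<Sum>j<n. x j k + y j k))
      \<le> max \<Gamma> 1 * (\<gamma> ^ k * (\<Sum>j<n. norm (x j 0) + norm (y j 0)) + (\<Sum>r<k. \<gamma> ^ (k - 1 - r) * (\<Sum>j<n. norm (g j r))))"
    and "(\<Sum>j<n. x j (Suc k) + y j (Suc k)) = (\<Sum>j<n. x j k + y j k) - (\<Sum>j<n. g j k)"
proof -
  have Wc': "Wc \<in> carrier_mat n n" "\<And>j. j < n \<Longrightarrow> (\<Sum>i<n. Wc $$ (i, j)) = 1"
    using Wc by (auto simp: column_stochastic_def)
  let ?W = "augmented_matrix n Wr Wc \<epsilon>"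
  note ent = augmented_matrix_entries[OF Wr Wc'(1)]
  define v where "v k a = (if a < n then x a k else y (a - n) k)" for k a
  define u where "u k a = (if a < n then g a k else 0)" for k a
  have delta: "(\<Sum>j<n. (if i = j then c else 0) *\<^sub>R w j) = c *\<^sub>R w i" if "i < n" for i c and w :: "nat \<Rightarrow> 'v"
  proof -
    have "(\<Sum>j<n. (if i = j then c else 0) *\<^sub>R w j) = (\<Sum>j<n. if i = j then c *\<^sub>R w j else 0)"
      by (rule sum.cong) auto
    then show ?thesis using that by simp
  qed
  have step: "v (Suc k) a = (\<Sum>b<2 * n. ?W $$ (a, b) *\<^sub>R v k b) - u k a" if a: "a < 2 * n" for k a
  proof (cases "a < n")
    case True
    have "(\<Sum>b<2 * n. ?W $$ (a, b) *\<^sub>R v k b)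
        = (\<Sum>j<n. Wr $$ (a, j) *\<^sub>R x j k) + (\<Sum>j<n. (if a = j then \<epsilon> else 0) *\<^sub>R y j k)"
      unfolding sum_lessThan_double by (intro arg_cong2[where f = "(+)"] sum.cong refl) (simp_all add: ent True v_def)
    then show ?thesis using True by (simp add: delta v_def u_def x)
  next
    case False
    then obtain i where i: "a = n + i" "i < n" using a by (metis add_less_cancel_left le_Suc_ex mult_2 not_less)
    have "(\<Sum>b<2 * n. ?W $$ (a, b) *\<^sub>R v k b)
        = (\<Sum>j<n. ((if i = j then 1 else 0) - Wr $$ (i, j)) *\<^sub>R x j k)
          + (\<Sum>j<n. (Wc $$ (i, j) - (if i = j then \<epsilon> else 0)) *\<^sub>R y j k)"
      unfolding sum_lessThan_double by (intro arg_cong2[where f = "(+)"] sum.cong refl) (simp_all add: ent i v_def)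
    then show ?thesis using i by (simp only: scaleR_diff_left sum_subtractf delta) (simp add: v_def u_def y)
  qed
  have sumv: "(\<Sum>b<2 * n. v k b) = (\<Sum>j<n. x j k + y j k)" for k
    by (simp add: sum_lessThan_double v_def sum.distrib)
  have "norm (v k i - (1 / real n) *\<^sub>R (\<Sum>b<2 * n. v k b))
    \<le> max \<Gamma> 1 * (\<gamma> ^ k * (\<Sum>b<2 * n. norm (v 0 b)) + (\<Sum>r<k. \<gamma> ^ (k - 1 - r) * (\<Sum>b<2 * n. norm (u r b))))"
    if i: "i < n" for i k
  proof (rule deviation_from_average_le[where W = ?W])
    show "?W \<in> carrier_mat (2 * n) (2 * n)" by (rule augmented_matrix_carrier[OF Wr Wc'(1)])
    show "(\<Sum>a<2 * n. ?W $$ (a, b)) = 1" if "b < 2 * n" for b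
      by (rule augmented_matrix_column_sum[OF Wr Wc that])
    show "\<bar>(?W ^\<^sub>m k) $$ (i, b) - 1 / real n\<bar> \<le> max \<Gamma> 1 * \<gamma> ^ k" if "b < 2 * n" for k b
      by (rule augmented_matrix_power_deviation[OF Wr Wc'(1) bound \<gamma> i that])
  qed (use step i in auto)
  then show "i < n \<Longrightarrow> norm (x i k - (1 / real n) *\<^sub>R (\<Sum>j<n. x j k + y j k))
      \<le> max \<Gamma> 1 * (\<gamma> ^ k * (\<Sum>j<n. norm (x j 0) + norm (y j 0)) + (\<Sum>r<k. \<gamma> ^ (k - 1 - r) * (\<Sum>j<n. norm (g j r))))"
    unfolding sumv by (simp add: sum_lessThan_double v_def u_def sum.distrib)
  have "(\<Sum>i<n. \<Sum>j<n. Wc $$ (i, j) *\<^sub>R y j k) = (\<Sum>j<n. y j k)"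
    by (subst sum.swap) (simp add: scaleR_sum_left[symmetric] Wc'(2))
  then show "(\<Sum>j<n. x j (Suc k) + y j (Suc k)) = (\<Sum>j<n. x j k + y j k) - (\<Sum>j<n. g j k)"
    by (simp add: x y sum.distrib sum_subtractf)
qed

section \<open>Stochastic descent of the average\<close>

text \<open>The interface between network and probability: of the matrices there remain the step of
  the average and the bound on the distance to it. The iterates of time \<open>k\<close> are known
  at \<open>F k\<close>; each sample of time \<open>k\<close> is independent of \<open>F k\<close>
  and known at \<open>F (Suc k)\<close>.\<close>

locale smoothed_descent = filtered_prob_space M F
  for M :: "'w measure" and F :: "nat \<Rightarrow> 'w measure" +
  fixes n :: nat and fi :: "nat \<Rightarrow> real ^ 'm \<Rightarrow> real" and D \<mu> C \<gamma> :: real and \<alpha> :: "nat \<Rightarrow> real"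
    and \<zeta> :: "nat \<Rightarrow> nat \<Rightarrow> 'w \<Rightarrow> real ^ 'm"
    and x :: "nat \<Rightarrow> nat \<Rightarrow> 'w \<Rightarrow> real ^ 'm"
    and z :: "nat \<Rightarrow> 'w \<Rightarrow> real ^ 'm" and z0 :: "real ^ 'm"
  assumes n: "0 < n"
    and lip: "\<And>i u v. i < n \<Longrightarrow> \<bar>fi i u - fi i v\<bar> \<le> D * norm (u - v)"
    and \<mu>: "0 < \<mu>" and \<gamma>: "0 < \<gamma>" "\<gamma> < 1" and C: "0 \<le> C"
    and conv: "convex_on UNIV (\<lambda>v. \<Sum>i<n. fi i v)"
    and min_ne: "minimizers (\<lambda>v. \<Sum>i<n. fi i v) \<noteq> {}"
    and smoothed_min_ne: "minimizers (\<lambda>v. \<Sum>i<n. smoothed \<mu> (fi i) v) \<noteq> {}"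
    and \<alpha>0: "\<And>k. 0 \<le> \<alpha> k" and \<alpha>_div: "\<not> summable \<alpha>" and \<alpha>_sq: "summable (\<lambda>k. (\<alpha> k)\<^sup>2)"
    and \<zeta>_meas: "\<And>i k. i < n \<Longrightarrow> \<zeta> i k \<in> borel_measurable (F (Suc k))"
    and \<zeta>_distr: "\<And>i k. i < n \<Longrightarrow> distr M borel (\<zeta> i k) = gaussian"
    and \<zeta>_indep: "\<And>i k. i < n \<Longrightarrow> indep_set (sets (F k)) {\<zeta> i k -` A \<inter> space M | A. A \<in> sets borel}"
    and x_meas: "\<And>i k. i < n \<Longrightarrow> x i k \<in> borel_measurable (F k)"
    and z_meas: "\<And>k. z k \<in> borel_measurable (F k)"
    and z_0: "\<And>\<omega>. \<omega> \<in> space M \<Longrightarrow> z 0 \<omega> = z0"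
    and z_Suc: "\<And>k \<omega>. \<omega> \<in> space M \<Longrightarrow>
      z (Suc k) \<omega> = z k \<omega> - (\<alpha> k / real n) *\<^sub>R (\<Sum>i<n. oracle_step \<mu> (fi i) (\<zeta> i k \<omega>) (x i k \<omega>))"
    and consensus: "\<And>i k \<omega>. i < n \<Longrightarrow> \<omega> \<in> space M \<Longrightarrow>
      norm (x i k \<omega> - z k \<omega>) \<le> fading_memory C \<gamma> (\<lambda>r. \<alpha> r * (\<Sum>j<n. (norm (\<zeta> j r \<omega>))\<^sup>2)) k"
begin

definition objective :: "real ^ 'm \<Rightarrow> real" where "objective v = (\<Sum>i<n. fi i v)"
definition smoothed_objective :: "real ^ 'm \<Rightarrow> real" where
  "smoothed_objective v = (\<Sum>i<n. smoothed \<mu> (fi i) v)"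

text \<open>The oracle minus its conditional mean given the past, hence a martingale
  difference.\<close>

definition noise :: "nat \<Rightarrow> nat \<Rightarrow> 'w \<Rightarrow> real ^ 'm" where
  "noise i k \<omega> = oracle_step \<mu> (fi i) (\<zeta> i k \<omega>) (x i k \<omega>) - mean_oracle \<mu> (fi i) (x i k \<omega>)"
definition sample_energy :: "nat \<Rightarrow> 'w \<Rightarrow> real" where
  "sample_energy k \<omega> = (\<Sum>j<n. (norm (\<zeta> j k \<omega>))\<^sup>2)"
text \<open>A majorant of the distances to the average that is built from the samples and not from
  the iterates, so its moments can be estimated before anything is known about
  \<open>x\<close>.\<close>

definition disagreement :: "nat \<Rightarrow> 'w \<Rightarrow> real" where
  "disagreement k \<omega> = fading_memory C \<gamma> (\<lambda>r. \<alpha> r * sample_energy r \<omega>) k"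
definition oracle_lip :: real where "oracle_lip = 2 * D * sqrt (real CARD('m)) / \<mu>"

lemma D0: "0 \<le> D" using lipschitz_const_nonneg[OF lip \<mu>] n by blast
lemma oracle_lip_nonneg: "0 \<le> oracle_lip" using D0 \<mu> by (simp add: oracle_lip_def)

lemma \<zeta>_M [measurable]: "i < n \<Longrightarrow> \<zeta> i k \<in> borel_measurable M"
  by (rule measurable_F[OF \<zeta>_meas])
lemma x_M [measurable]: "i < n \<Longrightarrow> x i k \<in> borel_measurable M"
  by (rule measurable_F[OF x_meas])
lemma z_M [measurable]: "z k \<in> borel_measurable M"
  by (rule measurable_F[OF z_meas])

section \<open>Independence of the current sample from the past, and moments of the noise\<close>

lemma integrable_\<zeta>:
  fixes g :: "real ^ 'm \<Rightarrow> real"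
  assumes "i < n" and [measurable]: "g \<in> borel_measurable borel"
  shows "integrable M (\<lambda>\<omega>. g (\<zeta> i k \<omega>)) \<longleftrightarrow> integrable gaussian g"
    and "(\<integral>\<omega>. g (\<zeta> i k \<omega>) \<partial>M) = (\<integral>v. g v \<partial>gaussian)"
  using assms integrable_distr_eq[of "\<zeta> i k" M borel g] integral_distr[of "\<zeta> i k" M borel g]
  by (simp_all add: \<zeta>_distr)

lemma prob_past_\<zeta>:
  assumes i: "i < n" and Y: "Y \<in> measurable (F k) N" and A: "A \<in> sets N" and B: "B \<in> sets borel"
  shows "prob ((Y -` A \<inter> space M) \<inter> (\<zeta> i k -` B \<inter> space M))
    = prob (Y -` A \<inter> space M) * prob (\<zeta> i k -` B \<inter> space M)"
proof (rule indep_setD[OF \<zeta>_indep[OF i]])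
  show "Y -` A \<inter> space M \<in> sets (F k)"
    using measurable_sets[OF Y A] subalgebra_F[of k] by (simp add: subalgebra_def)
qed (use B in auto)

text \<open>Independence gives the product law on rectangles, which determine it. Conditioning on
  the past is thereby replaced by Fubini's theorem.\<close>

lemma distr_past_\<zeta>:
  assumes i: "i < n" and Y: "Y \<in> measurable (F k) N"
  shows "distr M (N \<Otimes>\<^sub>M borel) (\<lambda>\<omega>. (Y \<omega>, \<zeta> i k \<omega>)) = distr M N Y \<Otimes>\<^sub>M gaussian"
proof -
  have YM [measurable]: "Y \<in> measurable M N" by (rule measurable_F[OF Y])
  note [measurable] = \<zeta>_M[OF i]
  interpret X: prob_space "distr M N Y" by (rule prob_space_distr[OF YM])
  interpret Q: prob_space "gaussian :: (real ^ 'm) measure" by (rule prob_space_gaussian)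
  show ?thesis
  proof (rule pair_measure_eqI[symmetric])
    fix A and B :: "(real ^ 'm) set" assume AB: "A \<in> sets (distr M N Y)" "B \<in> sets gaussian"
    then have A [measurable]: "A \<in> sets N" and B [measurable]: "B \<in> sets borel" by auto
    have "emeasure (distr M (N \<Otimes>\<^sub>M borel) (\<lambda>\<omega>. (Y \<omega>, \<zeta> i k \<omega>))) (A \<times> B)
        = emeasure M ((Y -` A \<inter> space M) \<inter> (\<zeta> i k -` B \<inter> space M))"
      by (subst emeasure_distr) (auto intro!: arg_cong[where f = "emeasure M"])
    also have "\<dots> = emeasure M (Y -` A \<inter> space M) * emeasure M (\<zeta> i k -` B \<inter> space M)"
      using prob_past_\<zeta>[OF i Y A B] by (simp add: emeasure_eq_measure ennreal_mult)
    also have "\<dots> = emeasure (distr M N Y) A * emeasure (distr M borel (\<zeta> i k)) B"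
      by (simp add: emeasure_distr)
    finally show "emeasure (distr M N Y) A * emeasure gaussian B
        = emeasure (distr M (N \<Otimes>\<^sub>M borel) (\<lambda>\<omega>. (Y \<omega>, \<zeta> i k \<omega>))) (A \<times> B)"
      by (simp add: \<zeta>_distr[OF i])
  qed (unfold_locales, auto intro!: sets_pair_measure_cong)
qed

text \<open>Independence of preimages extends to the sigma algebras they generate because such
  preimages are closed under intersection.\<close>

lemma indep_var_past_\<zeta>:
  assumes i: "i < n" and Y: "Y \<in> measurable (F k) N" and g: "g \<in> measurable borel N'"
  shows "indep_var N Y N' (\<lambda>\<omega>. g (\<zeta> i k \<omega>))"
proof -
  have YM: "Y \<in> measurable M N" by (rule measurable_F[OF Y])
  have gM: "(\<lambda>\<omega>. g (\<zeta> i k \<omega>)) \<in> measurable M N'"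
    by (rule measurable_compose[OF \<zeta>_M[OF i] g])
  have Int_stable: "Int_stable {X -` A \<inter> space M | A. A \<in> sets S}" for X :: "'w \<Rightarrow> 'b" and S
  proof (safe intro!: Int_stableI)
    fix A B assume "A \<in> sets S" "B \<in> sets S"
    then show "\<exists>C. (X -` A \<inter> space M) \<inter> (X -` B \<inter> space M) = (X -` C \<inter> space M) \<and> C \<in> sets S"
      by (intro exI[of _ "A \<inter> B"]) auto
  qed
  have "indep_set {Y -` A \<inter> space M | A. A \<in> sets N} {(\<lambda>\<omega>. g (\<zeta> i k \<omega>)) -` A \<inter> space M | A. A \<in> sets N'}"
  proof (rule indep_setI)
    show "{Y -` A \<inter> space M | A. A \<in> sets N} \<subseteq> events" using measurable_sets[OF YM] by auto
    show "{(\<lambda>\<omega>. g (\<zeta> i k \<omega>)) -` A \<inter> space M | A. A \<in> sets N'} \<subseteq> events" using measurable_sets[OF gM] by auto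
    fix a b assume "a \<in> {Y -` A \<inter> space M | A. A \<in> sets N}" "b \<in> {(\<lambda>\<omega>. g (\<zeta> i k \<omega>)) -` A \<inter> space M | A. A \<in> sets N'}"
    then obtain A B where AB: "a = Y -` A \<inter> space M" "A \<in> sets N"
      "b = (\<lambda>\<omega>. g (\<zeta> i k \<omega>)) -` B \<inter> space M" "B \<in> sets N'" by auto
    have "g -` B \<in> sets borel" using measurable_sets[OF g AB(4)] by simp
    moreover have "b = \<zeta> i k -` (g -` B) \<inter> space M" using AB(3) by auto
    ultimately show "prob (a \<inter> b) = prob a * prob b"
      using prob_past_\<zeta>[OF i Y AB(2)] AB(1) by simp
  qed
  then show ?thesis
    unfolding indep_var_eq using YM gM by (intro conjI indep_set_sigma_sets Int_stable)
qed

lemma mean_oracle_measurable [measurable]: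
  assumes "i < n" shows "mean_oracle \<mu> (fi i) \<in> borel_measurable borel"
proof (rule borel_measurable_continuous_onI, rule lipschitz_on_continuous_on[of oracle_lip], rule lipschitz_onI)
  show "dist (mean_oracle \<mu> (fi i) u) (mean_oracle \<mu> (fi i) v) \<le> oracle_lip * dist u v" for u v
    using mean_oracle_lipschitz[OF lip[OF assms] \<mu>] by (simp add: dist_norm oracle_lip_def)
qed (rule oracle_lip_nonneg)

lemma noise_measurable: "i < n \<Longrightarrow> noise i k \<in> borel_measurable (F (Suc k))"
  unfolding noise_def
  using measurable_F_mono[OF x_meas, of i k "Suc k"] \<zeta>_meas[of i k]
  by (intro borel_measurable_diff measurable_oracle_step[OF lip \<mu>]
      measurable_compose[OF _ mean_oracle_measurable]) auto

lemma noise_M [measurable]: "i < n \<Longrightarrow> noise i k \<in> borel_measurable M"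
  by (rule measurable_F[OF noise_measurable])

text \<open>With \<open>x\<close> and \<open>U\<close> frozen, the integral over the sample is the
  mean oracle minus itself; Fubini's theorem for the product law then gives 0. This stands in for a
  vanishing conditional expectation.\<close>

lemma noise_mean_zero:
  assumes i: "i < n" and U: "U \<in> borel_measurable (F k)"
    and int: "integrable M (\<lambda>\<omega>. inner (noise i k \<omega>) (U \<omega>))"
  shows "(\<integral>\<omega>. inner (noise i k \<omega>) (U \<omega>) \<partial>M) = 0"
proof -
  let ?N = "borel \<Otimes>\<^sub>M borel :: ((real ^ 'm) \<times> (real ^ 'm)) measure"
  let ?Y = "\<lambda>\<omega>. (x i k \<omega>, U \<omega>)"
  have Y: "?Y \<in> measurable (F k) ?N" using x_meas[OF i] U by measurable
  have YM [measurable]: "?Y \<in> measurable M ?N" by (rule measurable_F[OF Y])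
  let ?P = "distr M ?N ?Y"
  interpret P: prob_space ?P by (rule prob_space_distr[OF YM])
  interpret Q: prob_space "gaussian :: (real ^ 'm) measure" by (rule prob_space_gaussian)
  interpret PQ: pair_prob_space ?P "gaussian :: (real ^ 'm) measure" ..
  define \<psi> where "\<psi> p = inner (oracle_step \<mu> (fi i) (snd p) (fst (fst p))
    - mean_oracle \<mu> (fi i) (fst (fst p))) (snd (fst p))" for p
  note [measurable] = measurable_oracle_step[OF lip[OF i] \<mu>] mean_oracle_measurable[OF i]
  have \<psi> [measurable]: "\<psi> \<in> borel_measurable (?N \<Otimes>\<^sub>M borel)" unfolding \<psi>_def by measurable
  have jm [measurable]: "(\<lambda>\<omega>. (?Y \<omega>, \<zeta> i k \<omega>)) \<in> measurable M (?N \<Otimes>\<^sub>M borel)"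
    using i by measurable
  have joint: "distr M (?N \<Otimes>\<^sub>M borel) (\<lambda>\<omega>. (?Y \<omega>, \<zeta> i k \<omega>)) = ?P \<Otimes>\<^sub>M gaussian"
    by (rule distr_past_\<zeta>[OF i Y])
  have eq: "inner (noise i k \<omega>) (U \<omega>) = \<psi> (?Y \<omega>, \<zeta> i k \<omega>)" for \<omega>
    by (simp add: \<psi>_def noise_def)
  have "integrable (?P \<Otimes>\<^sub>M gaussian) \<psi>"
    unfolding joint[symmetric] by (subst integrable_distr_eq) (use int in \<open>auto simp: eq\<close>)
  then have "(\<integral>p. \<psi> p \<partial>(?P \<Otimes>\<^sub>M gaussian)) = (\<integral>y. \<integral>s. \<psi> (y, s) \<partial>gaussian \<partial>?P)"
    using PQ.integral_fst'[of \<psi>] by simp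
  also have "\<dots> = (\<integral>y. 0 \<partial>?P)"
  proof (rule Bochner_Integration.integral_cong[OF refl])
    fix y :: "(real ^ 'm) \<times> (real ^ 'm)"
    obtain v u where y: "y = (v, u)" by force
    have "(\<integral>s. \<psi> (y, s) \<partial>gaussian) = inner (\<integral>s. oracle_step \<mu> (fi i) s v - mean_oracle \<mu> (fi i) v \<partial>gaussian) u"
      unfolding \<psi>_def y fst_conv snd_conv
      by (rule integral_inner_left) (use integrable_oracle_step[OF lip[OF i] \<mu>] in auto)
    also have "\<dots> = 0"
      using integrable_oracle_step[OF lip[OF i] \<mu>] by (simp add: mean_oracle_def)
    finally show "(\<integral>s. \<psi> (y, s) \<partial>gaussian) = 0" .
  qed
  finally have "(\<integral>p. \<psi> p \<partial>(?P \<Otimes>\<^sub>M gaussian)) = 0" by simp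
  then show ?thesis
    unfolding joint[symmetric] by (subst (asm) integral_distr) (auto simp: eq)
qed

text \<open>The second moment of a majorant of the noise, whose two terms bound the oracle and its
  mean.\<close>

definition noise_bound :: real where
  "noise_bound = (\<integral>v. (D * ((norm (v :: real ^ 'm))\<^sup>2 + real CARD('m)))\<^sup>2 \<partial>gaussian)"

text \<open>The noise is bounded by a function of the sample alone, and the sample is independent of
  the past direction \<open>U\<close>; the expectation of the product of the two bounds therefore
  factors.\<close>

lemma noise_second_moment:
  assumes i: "i < n" and U: "U \<in> borel_measurable (F k)" and U2: "integrable M (\<lambda>\<omega>. (norm (U \<omega>))\<^sup>2)"
  shows "integrable M (\<lambda>\<omega>. (inner (noise i k \<omega>) (U \<omega>))\<^sup>2)"
    and "(\<integral>\<omega>. (inner (noise i k \<omega>) (U \<omega>))\<^sup>2 \<partial>M) \<le> noise_bound * (\<integral>\<omega>. (norm (U \<omega>))\<^sup>2 \<partial>M)"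
proof -
  define g where "g v = (D * ((norm v)\<^sup>2 + real CARD('m)))\<^sup>2" for v :: "real ^ 'm"
  have [measurable]: "g \<in> borel_measurable borel" unfolding g_def by measurable
  note [measurable] = measurable_F[OF U]
  \<comment> \<open>Expanded, the majorant is a polynomial of degree 4 in the norm, so the Gaussian
    moments make it integrable.\<close>
  have g_eq: "g v = D\<^sup>2 * (norm v ^ 4 + 2 * real CARD('m) * (norm v)\<^sup>2 + (real CARD('m))\<^sup>2)" for v
    by (simp add: g_def power_mult_distrib power2_sum power_mult[symmetric])
  have gint: "integrable gaussian g"
    unfolding g_eq using integrable_gaussian_fourth_moment[where 'm='m] gaussian_second_moment[where 'm='m]
    by (simp add: has_bochner_integral_iff)
  have gM: "integrable M (\<lambda>\<omega>. g (\<zeta> i k \<omega>))" "(\<integral>\<omega>. g (\<zeta> i k \<omega>) \<partial>M) = noise_bound"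
    using integrable_\<zeta>[OF i, of g k] gint by (simp_all add: noise_bound_def g_def)
  have ind: "indep_var borel (\<lambda>\<omega>. (norm (U \<omega>))\<^sup>2) borel (\<lambda>\<omega>. g (\<zeta> i k \<omega>))"
    using U by (intro indep_var_past_\<zeta>[OF i]) auto
  have pint: "integrable M (\<lambda>\<omega>. (norm (U \<omega>))\<^sup>2 * g (\<zeta> i k \<omega>))"
    by (rule indep_var_integrable[OF ind U2 gM(1)])
  have peq: "(\<integral>\<omega>. (norm (U \<omega>))\<^sup>2 * g (\<zeta> i k \<omega>) \<partial>M) = (\<integral>\<omega>. (norm (U \<omega>))\<^sup>2 \<partial>M) * noise_bound"
    using indep_var_lebesgue_integral[OF ind U2 gM(1)] gM(2) by simp
  have le: "(inner (noise i k \<omega>) (U \<omega>))\<^sup>2 \<le> (norm (U \<omega>))\<^sup>2 * g (\<zeta> i k \<omega>)" for \<omega>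
  proof -
    have "norm (noise i k \<omega>) \<le> D * ((norm (\<zeta> i k \<omega>))\<^sup>2 + real CARD('m))"
      unfolding noise_def
      using norm_triangle_ineq4[of "oracle_step \<mu> (fi i) (\<zeta> i k \<omega>) (x i k \<omega>)" "mean_oracle \<mu> (fi i) (x i k \<omega>)"]
        norm_oracle_step_le[OF lip[OF i] \<mu>, of "\<zeta> i k \<omega>" "x i k \<omega>"] norm_mean_oracle_le[OF lip[OF i] \<mu>, of "x i k \<omega>"]
      by (simp add: distrib_left)
    then have "\<bar>inner (noise i k \<omega>) (U \<omega>)\<bar> \<le> (D * ((norm (\<zeta> i k \<omega>))\<^sup>2 + real CARD('m))) * norm (U \<omega>)"
      by (intro order.trans[OF Cauchy_Schwarz_ineq2] mult_right_mono) auto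
    then have "\<bar>inner (noise i k \<omega>) (U \<omega>)\<bar>\<^sup>2 \<le> ((D * ((norm (\<zeta> i k \<omega>))\<^sup>2 + real CARD('m))) * norm (U \<omega>))\<^sup>2"
      by (rule power_mono) simp
    then show ?thesis by (simp add: g_def power_mult_distrib mult_ac)
  qed
  show int: "integrable M (\<lambda>\<omega>. (inner (noise i k \<omega>) (U \<omega>))\<^sup>2)"
    by (rule Bochner_Integration.integrable_bound[OF pint])
       (use i le in \<open>auto intro: order.trans[OF _ abs_ge_self]\<close>)
  have "(\<integral>\<omega>. (inner (noise i k \<omega>) (U \<omega>))\<^sup>2 \<partial>M) \<le> (\<integral>\<omega>. (norm (U \<omega>))\<^sup>2 * g (\<zeta> i k \<omega>) \<partial>M)"
    by (rule integral_mono[OF int pint le])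
  then show "(\<integral>\<omega>. (inner (noise i k \<omega>) (U \<omega>))\<^sup>2 \<partial>M) \<le> noise_bound * (\<integral>\<omega>. (norm (U \<omega>))\<^sup>2 \<partial>M)"
    by (simp only: peq mult.commute[of noise_bound])
qed

lemma noise_inner_integrable:
  assumes "i < n" "U \<in> borel_measurable (F k)" "integrable M (\<lambda>\<omega>. (norm (U \<omega>))\<^sup>2)"
  shows "integrable M (\<lambda>\<omega>. inner (noise i k \<omega>) (U \<omega>))"
  by (rule square_integrable_imp_integrable[OF _ noise_second_moment(1)[OF assms]])
     (use assms(1) measurable_F[OF assms(2)] in measurable)

text \<open>A martingale with increments of variance at most
  \<open>(\<alpha> k)\<^sup>2 * (noise_bound * K)\<close>, summable by the step-size
  condition.\<close>

lemma noise_series_summable_AE: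
  assumes i: "i < n" and U: "\<And>k. U k \<in> borel_measurable (F k)"
    and U2: "\<And>k. integrable M (\<lambda>\<omega>. (norm (U k \<omega>))\<^sup>2)" "\<And>k. (\<integral>\<omega>. (norm (U k \<omega>))\<^sup>2 \<partial>M) \<le> K"
  shows "AE \<omega> in M. summable (\<lambda>k. \<alpha> k * inner (noise i k \<omega>) (U k \<omega>))"
proof (rule martingale_converges_AE)
  note [measurable] = measurable_F[OF U] 
  have nb0: "0 \<le> noise_bound" by (simp add: noise_bound_def)
  have sq: "(\<alpha> k * inner (noise i k \<omega>) (U k \<omega>))\<^sup>2 = (\<alpha> k)\<^sup>2 * (inner (noise i k \<omega>) (U k \<omega>))\<^sup>2" for k \<omega>
    by (simp add: power_mult_distrib)
  show d: "(\<lambda>\<omega>. \<alpha> k * inner (noise i k \<omega>) (U k \<omega>)) \<in> borel_measurable (F (Suc k))" for k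
    using noise_measurable[OF i] measurable_F_mono[OF U, of k "Suc k"] by simp
  show d2: "integrable M (\<lambda>\<omega>. (\<alpha> k * inner (noise i k \<omega>) (U k \<omega>))\<^sup>2)" for k
    unfolding sq using noise_second_moment(1)[OF i U U2(1)] by simp
  show "summable (\<lambda>k. \<integral>\<omega>. (\<alpha> k * inner (noise i k \<omega>) (U k \<omega>))\<^sup>2 \<partial>M)"
  proof (rule summable_comparison_test')
    show "summable (\<lambda>k. (\<alpha> k)\<^sup>2 * (noise_bound * K))" using \<alpha>_sq by (rule summable_mult2)
    fix k :: nat
    have "(\<integral>\<omega>. (inner (noise i k \<omega>) (U k \<omega>))\<^sup>2 \<partial>M) \<le> noise_bound * K"
      by (rule order.trans[OF noise_second_moment(2)[OF i U U2(1)]]) (intro mult_left_mono U2(2) nb0)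
    then show "norm (\<integral>\<omega>. (\<alpha> k * inner (noise i k \<omega>) (U k \<omega>))\<^sup>2 \<partial>M) \<le> (\<alpha> k)\<^sup>2 * (noise_bound * K)"
      unfolding sq by (simp add: mult_left_mono)
  qed
  fix k Z assume Z: "Z \<in> borel_measurable (F k)" "integrable M (\<lambda>\<omega>. (Z \<omega> :: real)\<^sup>2)"
  have "integrable M (\<lambda>\<omega>. (inner (noise i k \<omega>) (U k \<omega>)) * Z \<omega>)"
    by (rule integrable_mult_of_squares)
       (use i Z(2) noise_second_moment(1)[OF i U U2(1)] measurable_F[OF Z(1)] in auto)
  \<comment> \<open>The scalar \<open>Z\<close> is absorbed into the direction. The product
    \<open>Z *\<^sub>R U k\<close> may lack a second moment, which is why the mean-zero property is
    stated for integrable inner products.\<close>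
  then have "(\<integral>\<omega>. inner (noise i k \<omega>) (Z \<omega> *\<^sub>R U k \<omega>) \<partial>M) = 0"
    using Z(1) U by (intro noise_mean_zero[OF i]) (auto simp: mult.commute)
  then have "\<alpha> k * (\<integral>\<omega>. Z \<omega> * inner (noise i k \<omega>) (U k \<omega>) \<partial>M) = 0" by simp
  then show "(\<integral>\<omega>. \<alpha> k * inner (noise i k \<omega>) (U k \<omega>) * Z \<omega> \<partial>M) = 0"
    unfolding Bochner_Integration.integral_mult_right_zero[symmetric] by (simp only: mult_ac)
qed

section \<open>Second moments of the samples and of the disagreement\<close>

lemma sample_energy_M [measurable]: "sample_energy k \<in> borel_measurable M"
  unfolding sample_energy_def by (intro borel_measurable_sum) measurable

lemma sample_energy_nonneg: "0 \<le> sample_energy k \<omega>"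
  unfolding sample_energy_def by (simp add: sum_nonneg)

text \<open>One factor \<open>n\<close> comes from Cauchy-Schwarz over the agents, the other from
  adding their equal fourth moments.\<close>

definition energy_bound :: real where
  "energy_bound = real n * (real n * (\<integral>v. (norm (v :: real ^ 'm)) ^ 4 \<partial>gaussian))"

lemma sample_energy_second_moment:
  shows "integrable M (\<lambda>\<omega>. (sample_energy k \<omega>)\<^sup>2)" and "(\<integral>\<omega>. (sample_energy k \<omega>)\<^sup>2 \<partial>M) \<le> energy_bound"
proof -
  have le: "(sample_energy k \<omega>)\<^sup>2 \<le> real n * (\<Sum>j<n. norm (\<zeta> j k \<omega>) ^ 4)" for \<omega>
    using sum_squared_le_sum_of_squares[of "\<lambda>j. (norm (\<zeta> j k \<omega>))\<^sup>2" "{..<n}"]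
    by (simp add: sample_energy_def power_mult[symmetric] mult.commute)
  have i4: "integrable M (\<lambda>\<omega>. norm (\<zeta> j k \<omega>) ^ 4)" if "j < n" for j
    using integrable_\<zeta>(1)[OF that, of "\<lambda>v. norm v ^ 4" k] integrable_gaussian_fourth_moment[where 'm='m] by simp
  have int4: "integrable M (\<lambda>\<omega>. real n * (\<Sum>j<n. norm (\<zeta> j k \<omega>) ^ 4))"
    using i4 by (intro integrable_mult_right Bochner_Integration.integrable_sum) auto
  show int: "integrable M (\<lambda>\<omega>. (sample_energy k \<omega>)\<^sup>2)"
    by (rule Bochner_Integration.integrable_bound[OF int4]) (use le in \<open>auto intro: order.trans[OF _ abs_ge_self]\<close>)
  have "(\<integral>\<omega>. (sample_energy k \<omega>)\<^sup>2 \<partial>M) \<le> (\<integral>\<omega>. real n * (\<Sum>j<n. norm (\<zeta> j k \<omega>) ^ 4) \<partial>M)"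
    by (rule integral_mono[OF int int4 le])
  also have "\<dots> = real n * (\<Sum>j<n. \<integral>\<omega>. norm (\<zeta> j k \<omega>) ^ 4 \<partial>M)"
    using i4 by (simp add: Bochner_Integration.integral_sum)
  also have "\<dots> = energy_bound"
    using integrable_\<zeta>(2)[of _ "\<lambda>v. norm v ^ 4" k] by (simp add: energy_bound_def)
  finally show "(\<integral>\<omega>. (sample_energy k \<omega>)\<^sup>2 \<partial>M) \<le> energy_bound" .
qed

lemma disagreement_0: "disagreement 0 \<omega> = C"
  by (simp add: disagreement_def)

lemma disagreement_Suc: "disagreement (Suc k) \<omega> = \<gamma> * disagreement k \<omega> + C * (\<alpha> k * sample_energy k \<omega>)"
  by (simp add: disagreement_def)

lemma disagreement_nonneg: "0 \<le> disagreement k \<omega>"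
  by (induction k) (use C \<gamma> \<alpha>0 sample_energy_nonneg in \<open>auto simp: disagreement_0 disagreement_Suc\<close>)

lemma disagreement_M [measurable]: "disagreement k \<in> borel_measurable M"
proof (induction k)
  case (Suc k)
  then show ?case unfolding disagreement_Suc[abs_def] by measurable
qed (simp add: disagreement_0[abs_def])

lemma norm_consensus: "i < n \<Longrightarrow> \<omega> \<in> space M \<Longrightarrow> norm (x i k \<omega> - z k \<omega>) \<le> disagreement k \<omega>"
  using consensus by (simp add: disagreement_def sample_energy_def)

text \<open>The square is split by convexity with weights \<open>\<gamma>\<close> and \<open>1 - \<gamma>\<close>, so the factor \<open>\<gamma> < 1\<close> survives.\<close>

lemma disagreement_Suc_sq:
  "(disagreement (Suc k) \<omega>)\<^sup>2 \<le> \<gamma> * (disagreement k \<omega>)\<^sup>2 + C\<^sup>2 / (1 - \<gamma>) * ((\<alpha> k)\<^sup>2 * (sample_energy k \<omega>)\<^sup>2)"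
proof -
  define a where "a = disagreement k \<omega>"
  define b where "b = C * (\<alpha> k * sample_energy k \<omega>)"
  have "(\<gamma> * a + b)\<^sup>2 + (\<gamma> / (1 - \<gamma>)) * ((1 - \<gamma>) * a - b)\<^sup>2 = \<gamma> * a\<^sup>2 + b\<^sup>2 / (1 - \<gamma>)"
    using \<gamma> by (simp add: field_simps power2_eq_square)
  moreover have "0 \<le> (\<gamma> / (1 - \<gamma>)) * ((1 - \<gamma>) * a - b)\<^sup>2" using \<gamma> by simp
  ultimately have "(\<gamma> * a + b)\<^sup>2 \<le> \<gamma> * a\<^sup>2 + b\<^sup>2 / (1 - \<gamma>)" by linarith
  then show ?thesis by (simp add: disagreement_Suc a_def b_def power_mult_distrib)
qed

lemma disagreement_square_integrable: "integrable M (\<lambda>\<omega>. (disagreement k \<omega>)\<^sup>2)"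
proof (induction k)
  case (Suc k)
  have i: "integrable M (\<lambda>\<omega>. \<gamma> * (disagreement k \<omega>)\<^sup>2 + C\<^sup>2 / (1 - \<gamma>) * ((\<alpha> k)\<^sup>2 * (sample_energy k \<omega>)\<^sup>2))"
    using Suc sample_energy_second_moment(1) by simp
  show ?case
    by (rule Bochner_Integration.integrable_bound[OF i])
       (use disagreement_Suc_sq in \<open>auto intro: order.trans[OF _ abs_ge_self]\<close>)
qed (simp add: disagreement_0)

text \<open>The expected squares contract by \<open>\<gamma>\<close> up to an input of order
  \<open>(\<alpha> k)\<^sup>2\<close>. Summability, rather than mere convergence to 0, is what the
  descent inequality consumes.\<close>

lemma disagreement_square_summable: "summable (\<lambda>k. \<integral>\<omega>. (disagreement k \<omega>)\<^sup>2 \<partial>M)"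
proof (rule contracting_summable[OF _ _ _ \<gamma>(2)])
  have C1: "0 \<le> C\<^sup>2 / (1 - \<gamma>)" using \<gamma> by simp
  have "0 \<le> energy_bound" by (simp add: energy_bound_def)
  then show "0 \<le> C\<^sup>2 / (1 - \<gamma>) * ((\<alpha> k)\<^sup>2 * energy_bound)" for k
    using C1 by (intro mult_nonneg_nonneg) auto
  show "summable (\<lambda>k. C\<^sup>2 / (1 - \<gamma>) * ((\<alpha> k)\<^sup>2 * energy_bound))"
    using \<alpha>_sq by (intro summable_mult summable_mult2)
  fix k
  have "(\<integral>\<omega>. (disagreement (Suc k) \<omega>)\<^sup>2 \<partial>M)
      \<le> (\<integral>\<omega>. \<gamma> * (disagreement k \<omega>)\<^sup>2 + C\<^sup>2 / (1 - \<gamma>) * ((\<alpha> k)\<^sup>2 * (sample_energy k \<omega>)\<^sup>2) \<partial>M)"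
    by (rule integral_mono[OF disagreement_square_integrable _ disagreement_Suc_sq])
       (use disagreement_square_integrable sample_energy_second_moment(1) in simp)
  also have "\<dots> = \<gamma> * (\<integral>\<omega>. (disagreement k \<omega>)\<^sup>2 \<partial>M)
      + C\<^sup>2 / (1 - \<gamma>) * ((\<alpha> k)\<^sup>2 * (\<integral>\<omega>. (sample_energy k \<omega>)\<^sup>2 \<partial>M))"
    using disagreement_square_integrable sample_energy_second_moment(1) by simp
  also have "\<dots> \<le> \<gamma> * (\<integral>\<omega>. (disagreement k \<omega>)\<^sup>2 \<partial>M) + C\<^sup>2 / (1 - \<gamma>) * ((\<alpha> k)\<^sup>2 * energy_bound)"
    by (intro add_left_mono mult_left_mono sample_energy_second_moment(2) C1) auto
  finally show "(\<integral>\<omega>. (disagreement (Suc k) \<omega>)\<^sup>2 \<partial>M)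
      \<le> \<gamma> * (\<integral>\<omega>. (disagreement k \<omega>)\<^sup>2 \<partial>M) + C\<^sup>2 / (1 - \<gamma>) * ((\<alpha> k)\<^sup>2 * energy_bound)" .
qed simp

section \<open>Descent inequality and bounded second moments\<close>

lemma norm_oracle_sum_le:
  "norm (\<Sum>i<n. oracle_step \<mu> (fi i) (\<zeta> i k \<omega>) (x i k \<omega>)) \<le> D * sample_energy k \<omega>"
proof -
  have "norm (\<Sum>i<n. oracle_step \<mu> (fi i) (\<zeta> i k \<omega>) (x i k \<omega>)) \<le> (\<Sum>i<n. D * (norm (\<zeta> i k \<omega>))\<^sup>2)"
    by (rule order.trans[OF norm_sum sum_mono]) (use norm_oracle_step_le[OF lip \<mu>] in auto)
  then show ?thesis by (simp add: sample_energy_def sum_distrib_left)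
qed

lemma smoothed_objective_eq: "smoothed_objective = smoothed \<mu> objective"
  using smoothed_sum[of "{..<n}" fi D \<mu>] lip \<mu> by (auto simp: smoothed_objective_def objective_def[abs_def])

lemma objective_lipschitz: "\<bar>objective u - objective v\<bar> \<le> (real n * D) * norm (u - v)"
proof -
  have "\<bar>objective u - objective v\<bar> \<le> (\<Sum>i<n. \<bar>fi i u - fi i v\<bar>)"
    unfolding objective_def sum_subtractf[symmetric] by (rule sum_abs)
  also have "\<dots> \<le> (\<Sum>i<n. D * norm (u - v))" by (rule sum_mono) (use lip in auto)
  finally show ?thesis by simp
qed

text \<open>The mean oracles of the summands add up to that of the convex total, and a minimizer of
  the total supplies the lower bound \<open>c\<close> of the general inequality.\<close>

lemma smoothed_objective_subgradient:
  "smoothed_objective v + inner (\<Sum>i<n. mean_oracle \<mu> (fi i) v) (u - v) \<le> smoothed_objective u"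
proof -
  obtain q where q: "q \<in> minimizers objective" using min_ne by (auto simp: objective_def[abs_def])
  have "smoothed \<mu> objective v + inner (mean_oracle \<mu> objective v) (u - v) \<le> smoothed \<mu> objective u"
  proof (rule mean_oracle_subgradient[OF objective_lipschitz \<mu>])
    show "convex_on UNIV objective" using conv by (simp add: objective_def[abs_def])
    show "objective q \<le> objective w" for w
      using q by (auto simp: minimizers_def is_arg_min_def not_less)
  qed
  moreover have "mean_oracle \<mu> objective v = (\<Sum>i<n. mean_oracle \<mu> (fi i) v)"
    using mean_oracle_sum[of "{..<n}" fi D \<mu> v] lip \<mu> by (auto simp: objective_def[abs_def])
  ultimately show ?thesis by (simp add: smoothed_objective_eq)
qed

text \<open>The squared distance is expanded and the oracle sum split into noise, the error of
  evaluating at \<open>x i k\<close> in place of \<open>z k\<close>, and the mean oracles at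
  \<open>z k\<close>. The bracketed group collects what will be summable along almost every path;
  the last line is the gain in the objective.\<close>

lemma descent:
  assumes \<omega>: "\<omega> \<in> space M"
  shows "(norm (z (Suc k) \<omega> - p))\<^sup>2 \<le> (norm (z k \<omega> - p))\<^sup>2
    + (oracle_lip * ((disagreement k \<omega>)\<^sup>2 + (\<alpha> k)\<^sup>2 * (norm (z k \<omega> - p))\<^sup>2)
      + (D / real n)\<^sup>2 * ((\<alpha> k)\<^sup>2 * (sample_energy k \<omega>)\<^sup>2)
      - 2 / real n * (\<Sum>i<n. \<alpha> k * inner (noise i k \<omega>) (z k \<omega> - p)))
    - 2 / real n * \<alpha> k * (smoothed_objective (z k \<omega>) - smoothed_objective p)"
proof -
  define u where "u = z k \<omega> - p"
  define e where "e = disagreement k \<omega>"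
  define a where "a = \<alpha> k / real n"
  define G where "G = (\<Sum>i<n. oracle_step \<mu> (fi i) (\<zeta> i k \<omega>) (x i k \<omega>))"
  define H where "H v = (\<Sum>i<n. mean_oracle \<mu> (fi i) v)" for v
  define R where "R = (\<Sum>i<n. mean_oracle \<mu> (fi i) (x i k \<omega>) - mean_oracle \<mu> (fi i) (z k \<omega>))"
  have a0: "0 \<le> a" using \<alpha>0 by (simp add: a_def)
  have e0: "0 \<le> e" by (simp add: e_def disagreement_nonneg)
  have G: "G = (\<Sum>i<n. noise i k \<omega>) + R + H (z k \<omega>)"
    by (simp add: G_def R_def H_def noise_def sum_subtractf)
  have "norm R \<le> (\<Sum>i<n. oracle_lip * e)"
    unfolding R_def
  proof (rule order.trans[OF norm_sum sum_mono])
    fix i assume "i \<in> {..<n}"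
    then have "norm (mean_oracle \<mu> (fi i) (x i k \<omega>) - mean_oracle \<mu> (fi i) (z k \<omega>)) \<le> oracle_lip * norm (x i k \<omega> - z k \<omega>)"
      using mean_oracle_lipschitz[OF lip \<mu>, of i] by (simp add: oracle_lip_def)
    also have "\<dots> \<le> oracle_lip * e"
      using norm_consensus[OF _ \<omega>] \<open>i \<in> {..<n}\<close> by (intro mult_left_mono oracle_lip_nonneg) (simp add: e_def)
    finally show "norm (mean_oracle \<mu> (fi i) (x i k \<omega>) - mean_oracle \<mu> (fi i) (z k \<omega>)) \<le> oracle_lip * e" .
  qed
  then have R: "norm R \<le> real n * (oracle_lip * e)" by simp
  have "- inner R u \<le> norm R * norm u"
    using Cauchy_Schwarz_ineq2[of R u] by linarith
  also have "\<dots> \<le> real n * (oracle_lip * e) * norm u"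
    by (intro mult_right_mono R) simp
  finally have "2 * a * (- inner R u) \<le> 2 * a * (real n * (oracle_lip * e) * norm u)"
    using a0 by (intro mult_left_mono) auto
  also have "\<dots> = oracle_lip * (2 * e * (\<alpha> k * norm u))"
    using n by (simp add: a_def)
  \<comment> \<open>The step size is paired with \<open>norm u\<close>, not with the disagreement.
    This leaves \<open>(\<alpha> k)\<^sup>2 * (norm u)\<^sup>2\<close>, which is summable in mean
    once second moments are bounded.\<close>
  also have "\<dots> \<le> oracle_lip * (e\<^sup>2 + (\<alpha> k * norm u)\<^sup>2)"
    by (intro mult_left_mono oracle_lip_nonneg sum_squares_bound)
  finally have t1: "2 * a * (- inner R u) \<le> oracle_lip * (e\<^sup>2 + (\<alpha> k)\<^sup>2 * (norm u)\<^sup>2)"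
    by (simp add: power_mult_distrib)
  have "smoothed_objective (z k \<omega>) - smoothed_objective p \<le> inner (H (z k \<omega>)) u"
    using smoothed_objective_subgradient[of "z k \<omega>" p]
    by (simp add: H_def u_def inner_diff_right)
  then have t2: "2 * a * (- inner (H (z k \<omega>)) u) \<le> 2 * a * (- (smoothed_objective (z k \<omega>) - smoothed_objective p))"
    using a0 by (intro mult_left_mono) auto
  have "(norm G)\<^sup>2 \<le> (D * sample_energy k \<omega>)\<^sup>2"
    using norm_oracle_sum_le by (intro power_mono) (auto simp: G_def)
  then have t3: "a\<^sup>2 * (norm G)\<^sup>2 \<le> a\<^sup>2 * (D * sample_energy k \<omega>)\<^sup>2"
    by (intro mult_left_mono) auto
  have "z (Suc k) \<omega> - p = u - a *\<^sub>R G"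
    using z_Suc[OF \<omega>, of k] by (simp add: u_def a_def G_def)
  then have "(norm (z (Suc k) \<omega> - p))\<^sup>2 = (norm (u - a *\<^sub>R G))\<^sup>2" by (rule arg_cong)
  also have "\<dots> = (norm u)\<^sup>2 - 2 * a * inner G u + a\<^sup>2 * (norm G)\<^sup>2"
    unfolding power2_norm_eq_inner by (simp add: inner_diff inner_commute power2_eq_square algebra_simps)
  also have "inner G u = inner (\<Sum>i<n. noise i k \<omega>) u + inner R u + inner (H (z k \<omega>)) u"
    by (simp add: G inner_add_left)
  finally have "(norm (z (Suc k) \<omega> - p))\<^sup>2 \<le> (norm u)\<^sup>2 - 2 * a * inner (\<Sum>i<n. noise i k \<omega>) u
      + oracle_lip * (e\<^sup>2 + (\<alpha> k)\<^sup>2 * (norm u)\<^sup>2)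
      + 2 * a * (- (smoothed_objective (z k \<omega>) - smoothed_objective p)) + a\<^sup>2 * (D * sample_energy k \<omega>)\<^sup>2"
    using t1 t2 t3 by (simp add: algebra_simps)
  moreover have "2 * a * inner (\<Sum>i<n. noise i k \<omega>) u = 2 / real n * (\<Sum>i<n. \<alpha> k * inner (noise i k \<omega>) u)"
    by (simp add: a_def inner_sum_left sum_distrib_left[symmetric])
  moreover have "a\<^sup>2 * (D * sample_energy k \<omega>)\<^sup>2 = (D / real n)\<^sup>2 * ((\<alpha> k)\<^sup>2 * (sample_energy k \<omega>)\<^sup>2)"
    by (simp add: a_def power_mult_distrib power_divide)
  moreover have "2 * a * (- (smoothed_objective (z k \<omega>) - smoothed_objective p))
      = - (2 / real n * \<alpha> k * (smoothed_objective (z k \<omega>) - smoothed_objective p))"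
    using n by (simp add: a_def field_simps)
  ultimately show ?thesis by (simp add: u_def e_def)
qed

lemma z_square_integrable: "integrable M (\<lambda>\<omega>. (norm (z k \<omega> - p))\<^sup>2)"
proof (induction k)
  case 0
  have "integrable M (\<lambda>\<omega>. (norm (z0 - p))\<^sup>2)" by simp
  moreover have "integrable M (\<lambda>\<omega>. (norm (z 0 \<omega> - p))\<^sup>2) \<longleftrightarrow> integrable M (\<lambda>\<omega>. (norm (z0 - p))\<^sup>2)"
    by (rule Bochner_Integration.integrable_cong) (simp_all add: z_0)
  ultimately show ?case by blast
next
  case (Suc k)
  define G where "G \<omega> = (\<alpha> k / real n) *\<^sub>R (\<Sum>i<n. oracle_step \<mu> (fi i) (\<zeta> i k \<omega>) (x i k \<omega>))" for \<omega>
  have i: "integrable M (\<lambda>\<omega>. 2 * (norm (z k \<omega> - p))\<^sup>2 + 2 * ((\<alpha> k / real n)\<^sup>2 * (D\<^sup>2 * (sample_energy k \<omega>)\<^sup>2)))"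
    using Suc sample_energy_second_moment(1) by simp
  show ?case
  proof (rule Bochner_Integration.integrable_bound[OF i], measurable, rule AE_I2)
    fix \<omega> assume \<omega>: "\<omega> \<in> space M"
    have "(norm (G \<omega>))\<^sup>2 = (\<alpha> k / real n)\<^sup>2 * (norm (\<Sum>i<n. oracle_step \<mu> (fi i) (\<zeta> i k \<omega>) (x i k \<omega>)))\<^sup>2"
      by (simp add: G_def power_mult_distrib power_divide)
    also have "\<dots> \<le> (\<alpha> k / real n)\<^sup>2 * (D * sample_energy k \<omega>)\<^sup>2"
      by (intro mult_left_mono power_mono norm_oracle_sum_le) auto
    finally have G: "(norm (G \<omega>))\<^sup>2 \<le> (\<alpha> k / real n)\<^sup>2 * (D\<^sup>2 * (sample_energy k \<omega>)\<^sup>2)"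
      by (simp add: power_mult_distrib)
    have "z (Suc k) \<omega> - p = (z k \<omega> - p) + (- G \<omega>)"
      by (simp add: z_Suc[OF \<omega>] G_def)
    then have "(norm (z (Suc k) \<omega> - p))\<^sup>2 \<le> 2 * (norm (z k \<omega> - p))\<^sup>2 + 2 * (norm (G \<omega>))\<^sup>2"
      using norm_add_sq_le[of "z k \<omega> - p" "- G \<omega>"] by (simp only: norm_minus_cancel)
    with G show "norm ((norm (z (Suc k) \<omega> - p))\<^sup>2)
        \<le> norm (2 * (norm (z k \<omega> - p))\<^sup>2 + 2 * ((\<alpha> k / real n)\<^sup>2 * (D\<^sup>2 * (sample_energy k \<omega>)\<^sup>2)))"
      by simp
  qed
qed

lemma z_diff_meas: "(\<lambda>\<omega>. z k \<omega> - p) \<in> borel_measurable (F k)"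
  using z_meas by simp

lemma smoothed_minimizerD: "p \<in> minimizers smoothed_objective \<Longrightarrow> smoothed_objective p \<le> smoothed_objective u"
  by (auto simp: minimizers_def is_arg_min_def not_less)

lemma smoothed_minimizers_nonempty: "minimizers smoothed_objective \<noteq> {}"
  using smoothed_min_ne by (simp add: smoothed_objective_def[abs_def])

lemma expected_descent:
  assumes p: "p \<in> minimizers smoothed_objective"
  shows "(\<integral>\<omega>. (norm (z (Suc k) \<omega> - p))\<^sup>2 \<partial>M)
    \<le> (1 + oracle_lip * (\<alpha> k)\<^sup>2) * (\<integral>\<omega>. (norm (z k \<omega> - p))\<^sup>2 \<partial>M)
      + (oracle_lip * (\<integral>\<omega>. (disagreement k \<omega>)\<^sup>2 \<partial>M) + (D / real n)\<^sup>2 * ((\<alpha> k)\<^sup>2 * energy_bound))"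
proof -
  let ?N = "\<lambda>\<omega>. \<Sum>i<n. \<alpha> k * inner (noise i k \<omega>) (z k \<omega> - p)"
  have ni: "integrable M (\<lambda>\<omega>. inner (noise i k \<omega>) (z k \<omega> - p))" if "i < n" for i
    by (rule noise_inner_integrable[OF that z_diff_meas z_square_integrable])
  have n0: "(\<integral>\<omega>. inner (noise i k \<omega>) (z k \<omega> - p) \<partial>M) = 0" if "i < n" for i
    by (rule noise_mean_zero[OF that z_diff_meas ni[OF that]])
  have Ni: "integrable M ?N" using ni by (intro Bochner_Integration.integrable_sum) auto
  have N0: "(\<integral>\<omega>. ?N \<omega> \<partial>M) = 0"
    by (subst Bochner_Integration.integral_sum) (use ni n0 in auto)
  let ?R = "\<lambda>\<omega>. (norm (z k \<omega> - p))\<^sup>2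
    + (oracle_lip * ((disagreement k \<omega>)\<^sup>2 + (\<alpha> k)\<^sup>2 * (norm (z k \<omega> - p))\<^sup>2)
      + (D / real n)\<^sup>2 * ((\<alpha> k)\<^sup>2 * (sample_energy k \<omega>)\<^sup>2) - 2 / real n * ?N \<omega>)"
  let ?I = "(\<integral>\<omega>. (norm (z k \<omega> - p))\<^sup>2 \<partial>M)
    + (oracle_lip * ((\<integral>\<omega>. (disagreement k \<omega>)\<^sup>2 \<partial>M) + (\<alpha> k)\<^sup>2 * (\<integral>\<omega>. (norm (z k \<omega> - p))\<^sup>2 \<partial>M))
      + (D / real n)\<^sup>2 * ((\<alpha> k)\<^sup>2 * (\<integral>\<omega>. (sample_energy k \<omega>)\<^sup>2 \<partial>M)) - 2 / real n * (\<integral>\<omega>. ?N \<omega> \<partial>M))"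
  have R: "has_bochner_integral M ?R ?I"
    by (intro has_bochner_integral_add has_bochner_integral_diff has_bochner_integral_mult_right
        has_bochner_integral_integrable Ni z_square_integrable disagreement_square_integrable
        sample_energy_second_moment(1))
  then have Ri: "integrable M ?R" by (simp only: has_bochner_integral_iff)
  have "(\<integral>\<omega>. (norm (z (Suc k) \<omega> - p))\<^sup>2 \<partial>M) \<le> (\<integral>\<omega>. ?R \<omega> \<partial>M)"
  proof (rule integral_mono_AE[OF z_square_integrable Ri], rule AE_I2)
    fix \<omega> assume \<omega>: "\<omega> \<in> space M"
    have "0 \<le> 2 / real n * \<alpha> k * (smoothed_objective (z k \<omega>) - smoothed_objective p)"
      using \<alpha>0 smoothed_minimizerD[OF p, of "z k \<omega>"] by simp
    with descent[OF \<omega>, of k p] show "(norm (z (Suc k) \<omega> - p))\<^sup>2 \<le> ?R \<omega>" by linarith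
  qed
  also have "(\<integral>\<omega>. ?R \<omega> \<partial>M) = ?I" using R by (rule has_bochner_integral_integral_eq)
  also have "\<dots> \<le> (\<integral>\<omega>. (norm (z k \<omega> - p))\<^sup>2 \<partial>M)
    + (oracle_lip * ((\<integral>\<omega>. (disagreement k \<omega>)\<^sup>2 \<partial>M) + (\<alpha> k)\<^sup>2 * (\<integral>\<omega>. (norm (z k \<omega> - p))\<^sup>2 \<partial>M))
      + (D / real n)\<^sup>2 * ((\<alpha> k)\<^sup>2 * energy_bound))"
    unfolding N0 using sample_energy_second_moment(2)[of k] by (simp add: mult_left_mono)
  finally show ?thesis by (simp add: algebra_simps)
qed

text \<open>The Gronwall bound is applied with one minimizer as centre; any other centre
  \<open>p\<close> differs from it by a fixed vector.\<close>

lemma z_second_moment_bounded: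
  obtains K where "\<And>k. (\<integral>\<omega>. (norm (z k \<omega> - p))\<^sup>2 \<partial>M) \<le> K"
proof -
  obtain q where q: "q \<in> minimizers smoothed_objective" using smoothed_minimizers_nonempty by blast
  have e0: "0 \<le> energy_bound" by (simp add: energy_bound_def)
  obtain K where K: "\<And>k. (\<integral>\<omega>. (norm (z k \<omega> - q))\<^sup>2 \<partial>M) \<le> K"
  proof (rule almost_contracting_bounded[where v = "\<lambda>k. \<integral>\<omega>. (norm (z k \<omega> - q))\<^sup>2 \<partial>M"
        and s = "\<lambda>k. oracle_lip * (\<alpha> k)\<^sup>2"
        and b = "\<lambda>k. oracle_lip * (\<integral>\<omega>. (disagreement k \<omega>)\<^sup>2 \<partial>M) + (D / real n)\<^sup>2 * ((\<alpha> k)\<^sup>2 * energy_bound)"])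
    show "summable (\<lambda>k. oracle_lip * (\<alpha> k)\<^sup>2)" using \<alpha>_sq by (rule summable_mult)
    show "summable (\<lambda>k. oracle_lip * (\<integral>\<omega>. (disagreement k \<omega>)\<^sup>2 \<partial>M) + (D / real n)\<^sup>2 * ((\<alpha> k)\<^sup>2 * energy_bound))"
      using \<alpha>_sq disagreement_square_summable by (intro summable_add summable_mult summable_mult2)
  qed (use oracle_lip_nonneg e0 expected_descent[OF q] in auto)
  have "(\<integral>\<omega>. (norm (z k \<omega> - p))\<^sup>2 \<partial>M) \<le> 2 * K + 2 * (norm (q - p))\<^sup>2" for k
  proof -
    have i: "integrable M (\<lambda>\<omega>. 2 * (norm (z k \<omega> - q))\<^sup>2 + 2 * (norm (q - p))\<^sup>2)"
      using z_square_integrable by simp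
    have "(\<integral>\<omega>. (norm (z k \<omega> - p))\<^sup>2 \<partial>M) \<le> (\<integral>\<omega>. 2 * (norm (z k \<omega> - q))\<^sup>2 + 2 * (norm (q - p))\<^sup>2 \<partial>M)"
    proof (rule integral_mono[OF z_square_integrable i])
      fix \<omega> show "(norm (z k \<omega> - p))\<^sup>2 \<le> 2 * (norm (z k \<omega> - q))\<^sup>2 + 2 * (norm (q - p))\<^sup>2"
        using norm_add_sq_le[of "z k \<omega> - q" "q - p"] by simp
    qed
    also have "\<dots> = 2 * (\<integral>\<omega>. (norm (z k \<omega> - q))\<^sup>2 \<partial>M) + 2 * (norm (q - p))\<^sup>2"
      using z_square_integrable by (simp add: prob_space)
    finally show ?thesis using K[of k] by simp
  qed
  then show ?thesis by (rule that)
qed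

section \<open>Almost sure limit and convergence in mean\<close>

lemma smoothed_objective_continuous: "continuous_on UNIV smoothed_objective"
proof -
  have "continuous_on UNIV (smoothed \<mu> (fi i))" if "i < n" for i
    by (rule lipschitz_continuous[OF smoothed_lipschitz[OF lip[OF that] \<mu>] \<mu>])
  then show ?thesis
    unfolding smoothed_objective_def[abs_def] by (intro continuous_on_sum) auto
qed

lemma disagreement_tendsto_AE: "AE \<omega> in M. (\<lambda>k. disagreement k \<omega>) \<longlonglongrightarrow> 0"
proof -
  have "AE \<omega> in M. summable (\<lambda>k. (disagreement k \<omega>)\<^sup>2)"
    by (rule AE_summable_of_summable_integrals[OF disagreement_square_integrable _ disagreement_square_summable]) simp
  then show ?thesis
  proof eventually_elim
    case (elim \<omega>)
    then have "(\<lambda>k. sqrt ((disagreement k \<omega>)\<^sup>2)) \<longlonglongrightarrow> sqrt 0"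
      by (intro tendsto_real_sqrt summable_LIMSEQ_zero)
    then show ?case by (simp add: disagreement_nonneg)
  qed
qed

text \<open>
  One null set has to serve all minimizers \<open>p\<close> at once; as the noise term is affine in \<open>p\<close>, it is enough
  to control it at one minimizer and along the coordinate directions.
\<close>

lemma average_converges_AE: "AE \<omega> in M. \<exists>p\<in>minimizers smoothed_objective. (\<lambda>k. z k \<omega>) \<longlonglongrightarrow> p"
proof -
  obtain q where q: "q \<in> minimizers smoothed_objective" using smoothed_minimizers_nonempty by blast
  obtain K where K: "\<And>k. (\<integral>\<omega>. (norm (z k \<omega> - q))\<^sup>2 \<partial>M) \<le> K"
    using z_second_moment_bounded[where p = q] by blast
  have a1: "AE \<omega> in M. summable (\<lambda>k. (disagreement k \<omega>)\<^sup>2)"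
    by (rule AE_summable_of_summable_integrals[OF disagreement_square_integrable _ disagreement_square_summable]) simp
  have a2: "AE \<omega> in M. summable (\<lambda>k. (\<alpha> k)\<^sup>2 * (norm (z k \<omega> - q))\<^sup>2)"
  proof (rule AE_summable_of_summable_integrals)
    show "summable (\<lambda>k. \<integral>\<omega>. (\<alpha> k)\<^sup>2 * (norm (z k \<omega> - q))\<^sup>2 \<partial>M)"
      by (rule summable_comparison_test'[OF summable_mult2[OF \<alpha>_sq, of K], of 0]) (use K in \<open>auto simp: mult_left_mono\<close>)
  qed (use z_square_integrable in auto)
  have a3: "AE \<omega> in M. summable (\<lambda>k. (\<alpha> k)\<^sup>2 * (sample_energy k \<omega>)\<^sup>2)"
  proof (rule AE_summable_of_summable_integrals)
    show "summable (\<lambda>k. \<integral>\<omega>. (\<alpha> k)\<^sup>2 * (sample_energy k \<omega>)\<^sup>2 \<partial>M)"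
      by (rule summable_comparison_test'[OF summable_mult2[OF \<alpha>_sq, of energy_bound], of 0])
         (use sample_energy_second_moment(2) in \<open>auto simp: mult_left_mono\<close>)
  qed (use sample_energy_second_moment(1) in auto)
  have a4: "AE \<omega> in M. \<forall>i\<in>{..<n}. summable (\<lambda>k. \<alpha> k * inner (noise i k \<omega>) (z k \<omega> - q))"
    by (rule AE_finite_allI[OF finite_lessThan])
       (use noise_series_summable_AE[OF _ z_diff_meas z_square_integrable K] in auto)
  have a5: "AE \<omega> in M. \<forall>i\<in>{..<n}. \<forall>b\<in>Basis. summable (\<lambda>k. \<alpha> k * inner (noise i k \<omega>) b)"
  proof (intro AE_finite_allI finite_lessThan finite_Basis)
    fix i and b :: "real ^ 'm" assume "i \<in> {..<n}" "b \<in> Basis"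
    then show "AE \<omega> in M. summable (\<lambda>k. \<alpha> k * inner (noise i k \<omega>) b)"
      by (intro noise_series_summable_AE[where U = "\<lambda>_ _. b" and K = 1]) (auto simp: prob_space)
  qed
  show ?thesis
    using a1 a2 a3 a4 a5 AE_space
  proof eventually_elim
    case (elim \<omega>)
    have "\<exists>w. summable w \<and> (\<forall>k. (norm (z (Suc k) \<omega> - p))\<^sup>2 \<le> (norm (z k \<omega> - p))\<^sup>2 + w k
        - 2 / real n * \<alpha> k * (smoothed_objective (z k \<omega>) - smoothed_objective p))" for p
    proof -
      \<comment> \<open>Changing the centre from \<open>q\<close> to \<open>p\<close> costs a term
        of order \<open>(\<alpha> k)\<^sup>2\<close>, summable by itself.\<close>
      have "summable (\<lambda>k. (\<alpha> k)\<^sup>2 * (norm (z k \<omega> - p))\<^sup>2)"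
      proof (rule summable_comparison_test')
        show "summable (\<lambda>k. 2 * ((\<alpha> k)\<^sup>2 * (norm (z k \<omega> - q))\<^sup>2) + (\<alpha> k)\<^sup>2 * (2 * (norm (q - p))\<^sup>2))"
          using elim(2) \<alpha>_sq by (intro summable_add summable_mult summable_mult2)
        fix k :: nat
        have "(norm (z k \<omega> - p))\<^sup>2 \<le> 2 * (norm (z k \<omega> - q))\<^sup>2 + 2 * (norm (q - p))\<^sup>2"
          using norm_add_sq_le[of "z k \<omega> - q" "q - p"] by simp
        from mult_left_mono[OF this, of "(\<alpha> k)\<^sup>2"]
        show "norm ((\<alpha> k)\<^sup>2 * (norm (z k \<omega> - p))\<^sup>2)
            \<le> 2 * ((\<alpha> k)\<^sup>2 * (norm (z k \<omega> - q))\<^sup>2) + (\<alpha> k)\<^sup>2 * (2 * (norm (q - p))\<^sup>2)"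
          by (simp add: algebra_simps)
      qed
      moreover have "summable (\<lambda>k. \<Sum>i<n. \<alpha> k * inner (noise i k \<omega>) (z k \<omega> - p))"
      proof (rule summable_sum)
        fix i assume i: "i \<in> {..<n}"
        have eq: "\<alpha> k * inner (noise i k \<omega>) (z k \<omega> - p) = \<alpha> k * inner (noise i k \<omega>) (z k \<omega> - q)
            + (\<Sum>b\<in>Basis. \<alpha> k * inner (noise i k \<omega>) b * inner (q - p) b)" for k
        proof -
          have "inner (noise i k \<omega>) (q - p) = (\<Sum>b\<in>Basis. inner (noise i k \<omega>) b * inner (q - p) b)"
            by (rule euclidean_inner)
          then have "\<alpha> k * inner (noise i k \<omega>) (q - p) = (\<Sum>b\<in>Basis. \<alpha> k * inner (noise i k \<omega>) b * inner (q - p) b)"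
            by (simp only: sum_distrib_left mult.assoc)
          moreover have "z k \<omega> - p = (z k \<omega> - q) + (q - p)" by simp
          ultimately show ?thesis by (simp only: inner_add_right distrib_left)
        qed
        show "summable (\<lambda>k. \<alpha> k * inner (noise i k \<omega>) (z k \<omega> - p))"
          unfolding eq using elim(4,5) i by (intro summable_add summable_sum summable_mult2) auto
      qed
      ultimately have "summable (\<lambda>k. oracle_lip * ((disagreement k \<omega>)\<^sup>2 + (\<alpha> k)\<^sup>2 * (norm (z k \<omega> - p))\<^sup>2)
          + (D / real n)\<^sup>2 * ((\<alpha> k)\<^sup>2 * (sample_energy k \<omega>)\<^sup>2)
          - 2 / real n * (\<Sum>i<n. \<alpha> k * inner (noise i k \<omega>) (z k \<omega> - p)))"
        using elim(1,3) by (intro summable_add summable_diff summable_mult)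
      then show ?thesis using descent[OF elim(6), of _ p] by blast
    qed
    then show ?case
      using n by (intro quasi_fejer_converges_to_minimizer[OF smoothed_objective_continuous
        smoothed_minimizers_nonempty \<alpha>0 \<alpha>_div, of "2 / real n"]) auto
  qed
qed

text \<open>Defined through \<open>lim\<close>, the random minimizer is measurable as it stands, and
  no measurable selection from the set of minimizers has to be made. Its value where
  \<open>z\<close> diverges is immaterial, since this happens on a null set.\<close>

definition limit :: "'w \<Rightarrow> real ^ 'm" where "limit \<omega> = lim (\<lambda>k. z k \<omega>)"

lemma limit_M [measurable]: "limit \<in> borel_measurable M"
  unfolding limit_def[abs_def] by (rule borel_measurable_lim_metric) measurable

lemma limit_AE: "AE \<omega> in M. limit \<omega> \<in> minimizers smoothed_objective \<and> (\<lambda>k. z k \<omega>) \<longlonglongrightarrow> limit \<omega>"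
  using average_converges_AE by eventually_elim (auto simp: limit_def dest: limI)

lemma x_tendsto_limit_AE:
  assumes "i < n"
  shows "AE \<omega> in M. (\<lambda>k. x i k \<omega>) \<longlonglongrightarrow> limit \<omega>"
  using limit_AE disagreement_tendsto_AE AE_space
proof eventually_elim
  case (elim \<omega>)
  have "(\<lambda>k. x i k \<omega> - z k \<omega>) \<longlonglongrightarrow> 0"
    by (rule Lim_null_comparison[OF _ elim(2)]) (use norm_consensus[OF assms elim(3)] in simp)
  from tendsto_add[OF this conjunct2[OF elim(1)]] show ?case by simp
qed

text \<open>Almost sure convergence is upgraded by a uniform second moment. The distance to the
  limit is split through \<open>z k\<close>, and the limit is square integrable by Fatou's
  lemma.\<close>

lemma x_L1_convergence:
  assumes i: "i < n"
  shows "integrable M (\<lambda>\<omega>. norm (x i k \<omega> - limit \<omega>))"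
    and "(\<lambda>k. \<integral>\<omega>. norm (x i k \<omega> - limit \<omega>) \<partial>M) \<longlonglongrightarrow> 0"
proof -
  note [measurable] = x_M[OF i]
  obtain K where K: "\<And>k. (\<integral>\<omega>. (norm (z k \<omega> - 0))\<^sup>2 \<partial>M) \<le> K"
    using z_second_moment_bounded[where p = 0] by blast
  have z2: "integrable M (\<lambda>\<omega>. (norm (z k \<omega>))\<^sup>2)" for k using z_square_integrable[of k 0] by simp
  have l2: "integrable M (\<lambda>\<omega>. (norm (limit \<omega>))\<^sup>2)"
    by (rule integrable_square_norm_limit[OF z_M limit_M z2, where K = K]) (use K limit_AE in \<open>auto elim: AE_mp\<close>)
  define B where "B k \<omega> = 2 * (disagreement k \<omega>)\<^sup>2 + (4 * (norm (z k \<omega>))\<^sup>2 + 4 * (norm (limit \<omega>))\<^sup>2)" for k \<omega>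
  have Bi: "integrable M (B k)" for k
    unfolding B_def using disagreement_square_integrable z2 l2 by simp
  have le: "(norm (x i k \<omega> - limit \<omega>))\<^sup>2 \<le> B k \<omega>" if "\<omega> \<in> space M" for k \<omega>
  proof -
    have "(norm (x i k \<omega> - limit \<omega>))\<^sup>2 \<le> 2 * (norm (x i k \<omega> - z k \<omega>))\<^sup>2 + 2 * (norm (z k \<omega> - limit \<omega>))\<^sup>2"
      using norm_add_sq_le[of "x i k \<omega> - z k \<omega>" "z k \<omega> - limit \<omega>"] by simp
    moreover have "(norm (x i k \<omega> - z k \<omega>))\<^sup>2 \<le> (disagreement k \<omega>)\<^sup>2"
      by (intro power_mono norm_consensus[OF i that]) simp
    moreover have "(norm (z k \<omega> - limit \<omega>))\<^sup>2 \<le> 2 * (norm (z k \<omega>))\<^sup>2 + 2 * (norm (limit \<omega>))\<^sup>2"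
      using norm_add_sq_le[of "z k \<omega>" "- limit \<omega>"] by simp
    ultimately show ?thesis by (simp add: B_def)
  qed
  have W2: "integrable M (\<lambda>\<omega>. (norm (x i k \<omega> - limit \<omega>))\<^sup>2)" for k
    by (rule Bochner_Integration.integrable_bound[OF Bi[of k]])
       (measurable, use le in \<open>auto intro!: AE_I2 intro: order.trans[OF _ abs_ge_self]\<close>)
  \<comment> \<open>Summable expectations tend to 0 and are in particular bounded.\<close>
  obtain J where J: "\<And>k. \<bar>\<integral>\<omega>. (disagreement k \<omega>)\<^sup>2 \<partial>M\<bar> \<le> J"
    using convergent_imp_Bseq[OF convergentI[OF summable_LIMSEQ_zero[OF disagreement_square_summable]]]
    by (auto simp: Bseq_def)
  have "(\<integral>\<omega>. (norm (x i k \<omega> - limit \<omega>))\<^sup>2 \<partial>M) \<le> 2 * J + (4 * K + 4 * (\<integral>\<omega>. (norm (limit \<omega>))\<^sup>2 \<partial>M))" for k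
  proof -
    have "(\<integral>\<omega>. (norm (x i k \<omega> - limit \<omega>))\<^sup>2 \<partial>M) \<le> (\<integral>\<omega>. B k \<omega> \<partial>M)"
      by (rule integral_mono_AE[OF W2 Bi]) (use le in auto)
    also have "\<dots> = 2 * (\<integral>\<omega>. (disagreement k \<omega>)\<^sup>2 \<partial>M)
        + (4 * (\<integral>\<omega>. (norm (z k \<omega>))\<^sup>2 \<partial>M) + 4 * (\<integral>\<omega>. (norm (limit \<omega>))\<^sup>2 \<partial>M))"
      unfolding B_def using disagreement_square_integrable z2 l2 by simp
    finally show ?thesis using J[of k] K[of k] by simp
  qed
  note L1 = L1_tendsto_zero_of_L2_bounded[of "\<lambda>k \<omega>. norm (x i k \<omega> - limit \<omega>)", OF _ _ W2 this]
  have lim: "AE \<omega> in M. (\<lambda>k. norm (x i k \<omega> - limit \<omega>)) \<longlonglongrightarrow> 0"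
    using x_tendsto_limit_AE[OF i] by eventually_elim (simp add: tendsto_norm_zero_iff LIM_zero_iff)
  show "integrable M (\<lambda>\<omega>. norm (x i k \<omega> - limit \<omega>))"
    by (rule L1(1)) (use lim in auto)
  show "(\<lambda>k. \<integral>\<omega>. norm (x i k \<omega> - limit \<omega>) \<partial>M) \<longlonglongrightarrow> 0"
    by (rule L1(2)) (use lim in auto)
qed

section \<open>Objective values at the limit\<close>

lemma smoothed_objective_close:
  "\<bar>smoothed_objective v - objective v\<bar> \<le> real n * sqrt (real CARD('m)) * \<mu> * D"
  using smoothed_close[OF objective_lipschitz \<mu>, of v] by (simp add: smoothed_objective_eq mult_ac)

text \<open>Passing from \<open>objective\<close> to its smoothing at \<open>q\<close>, then to a
  true minimizer by optimality of \<open>q\<close>, and back again costs the approximation error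
  twice.\<close>

lemma min_value_objective:
  shows "min_value objective \<le> objective v"
    and "q \<in> minimizers smoothed_objective \<Longrightarrow>
      objective q \<le> min_value objective + 2 * real n * sqrt (real CARD('m)) * \<mu> * D"
proof -
  have ne: "\<exists>v. is_arg_min objective (\<lambda>_. True) v"
    using min_ne by (auto simp: minimizers_def objective_def[abs_def])
  have "is_arg_min objective (\<lambda>_. True) (arg_min objective (\<lambda>_. True))"
    unfolding arg_min_def using ne by (rule someI_ex)
  then show "min_value objective \<le> objective v" by (auto simp: min_value_def is_arg_min_def not_less)
  assume "q \<in> minimizers smoothed_objective"
  from smoothed_minimizerD[OF this, of "arg_min objective (\<lambda>_. True)"]
  show "objective q \<le> min_value objective + 2 * real n * sqrt (real CARD('m)) * \<mu> * D"
    using smoothed_objective_close[of q] smoothed_objective_close[of "arg_min objective (\<lambda>_. True)"]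
    by (simp add: min_value_def algebra_simps)
qed

lemma objective_M [measurable]: "objective \<in> borel_measurable borel"
  by (rule lipschitz_borel_measurable[OF objective_lipschitz \<mu>])

text \<open>Almost surely the value lies between the minimum and the minimum plus twice the
  approximation error, so it is bounded.\<close>

lemma integrable_objective_limit: "integrable M (\<lambda>\<omega>. objective (limit \<omega>))"
proof (rule Bochner_Integration.integrable_bound)
  let ?b = "real n * sqrt (real CARD('m)) * \<mu> * D"
  show "integrable M (\<lambda>_. \<bar>min_value objective\<bar> + 2 * ?b)" by simp
  show "AE \<omega> in M. norm (objective (limit \<omega>)) \<le> norm (\<bar>min_value objective\<bar> + 2 * ?b)"
    using limit_AE
  proof eventually_elim
    case (elim \<omega>)
    have "0 \<le> ?b" using D0 \<mu> by simp
    then show ?case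
      using min_value_objective(1)[of "limit \<omega>"] min_value_objective(2)[OF conjunct1[OF elim]]
      by (simp add: abs_le_iff) linarith
  qed
qed measurable

text \<open>The objective is Lipschitz with constant \<open>n * D\<close>, so convergence in mean of
  the iterates passes to the expected values; the final bound is the integrated form of the one at
  minimizers of the smoothed objective.\<close>

lemma objective_convergence:
  assumes i: "i < n"
  shows "integrable M (\<lambda>\<omega>. objective (x i k \<omega>))"
    and "(\<lambda>k. \<integral>\<omega>. objective (x i k \<omega>) \<partial>M) \<longlonglongrightarrow> (\<integral>\<omega>. objective (limit \<omega>) \<partial>M)"
    and "(\<integral>\<omega>. objective (limit \<omega>) \<partial>M) - min_value objective \<le> 2 * real n * sqrt (real CARD('m)) * \<mu> * D"
proof -
  note [measurable] = x_M[OF i]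
  have di: "integrable M (\<lambda>\<omega>. objective (x i k \<omega>) - objective (limit \<omega>))" for k
    by (rule Bochner_Integration.integrable_bound[OF integrable_mult_right[OF x_L1_convergence(1)[OF i, of k], of "real n * D"]])
       (measurable, use objective_lipschitz in \<open>auto intro!: AE_I2 intro: order.trans[OF _ abs_ge_self]\<close>)
  show xi: "integrable M (\<lambda>\<omega>. objective (x i k \<omega>))" for k
    using Bochner_Integration.integrable_add[OF di[of k] integrable_objective_limit] by simp
  have "(\<lambda>k. (\<integral>\<omega>. objective (x i k \<omega>) \<partial>M) - (\<integral>\<omega>. objective (limit \<omega>) \<partial>M)) \<longlonglongrightarrow> 0"
  proof (rule Lim_null_comparison)
    have "norm ((\<integral>\<omega>. objective (x i k \<omega>) \<partial>M) - (\<integral>\<omega>. objective (limit \<omega>) \<partial>M))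
        \<le> real n * D * (\<integral>\<omega>. norm (x i k \<omega> - limit \<omega>) \<partial>M)" for k
    proof -
      have "(\<integral>\<omega>. objective (x i k \<omega>) \<partial>M) - (\<integral>\<omega>. objective (limit \<omega>) \<partial>M)
          = (\<integral>\<omega>. objective (x i k \<omega>) - objective (limit \<omega>) \<partial>M)"
        using xi integrable_objective_limit by simp
      also have "norm \<dots> \<le> (\<integral>\<omega>. norm (objective (x i k \<omega>) - objective (limit \<omega>)) \<partial>M)"
        by (rule integral_norm_bound)
      also have "\<dots> \<le> (\<integral>\<omega>. real n * D * norm (x i k \<omega> - limit \<omega>) \<partial>M)"
        by (rule integral_mono) (use di x_L1_convergence(1)[OF i] objective_lipschitz in auto)
      finally show ?thesis by simp
    qed
    then show "\<forall>\<^sub>F k in sequentially. norm ((\<integral>\<omega>. objective (x i k \<omega>) \<partial>M) - (\<integral>\<omega>. objective (limit \<omega>) \<partial>M))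
        \<le> real n * D * (\<integral>\<omega>. norm (x i k \<omega> - limit \<omega>) \<partial>M)" by simp
    show "(\<lambda>k. real n * D * (\<integral>\<omega>. norm (x i k \<omega> - limit \<omega>) \<partial>M)) \<longlonglongrightarrow> 0"
      using tendsto_mult_left[OF x_L1_convergence(2)[OF i], of "real n * D"] by simp
  qed
  then show "(\<lambda>k. \<integral>\<omega>. objective (x i k \<omega>) \<partial>M) \<longlonglongrightarrow> (\<integral>\<omega>. objective (limit \<omega>) \<partial>M)"
    by (rule LIM_zero_cancel)
  let ?b = "2 * real n * sqrt (real CARD('m)) * \<mu> * D"
  have "(\<integral>\<omega>. objective (limit \<omega>) \<partial>M) \<le> (\<integral>\<omega>. min_value objective + ?b \<partial>M)"
  proof (rule integral_mono_AE[OF integrable_objective_limit])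
    show "AE \<omega> in M. objective (limit \<omega>) \<le> min_value objective + ?b"
      using limit_AE by eventually_elim (use min_value_objective(2) in blast)
  qed simp
  then show "(\<integral>\<omega>. objective (limit \<omega>) \<partial>M) - min_value objective \<le> ?b"
    by (simp add: prob_space)
qed

end

section \<open>The filtration generated by the samples\<close>

lemma summable_of_suminf_ennreal_finite:
  fixes a :: "nat \<Rightarrow> real"
  assumes "\<And>k. 0 \<le> a k" "(\<Sum>k. ennreal (a k)) < \<infinity>"
  shows "summable a"
  using assms by (intro summable_suminf_not_top) simp_all

lemma not_summable_of_suminf_ennreal_infinite:
  fixes a :: "nat \<Rightarrow> real"
  assumes "\<And>k. 0 \<le> a k" "(\<Sum>k. ennreal (a k)) = \<infinity>"
  shows "\<not> summable a"
proof
  assume "summable a"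
  from suminf_ennreal2[OF assms(1) this] assms(2) show False by simp
qed

text \<open>The sigma algebra of all samples at times before \<open>k\<close>, pulled back along a
  single map into a finite product so that it is a block of the independent family. For
  \<open>k = 0\<close> the index set is empty and the algebra trivial, in keeping with deterministic
  initial values.\<close>

definition history_filtration ::
    "'w measure \<Rightarrow> nat \<Rightarrow> (nat \<Rightarrow> nat \<Rightarrow> 'w \<Rightarrow> 'v::topological_space) \<Rightarrow> nat \<Rightarrow> 'w measure" where
  "history_filtration M n \<zeta> k = vimage_algebra (space M)
     (\<lambda>\<omega>. \<lambda>p\<in>{..<n} \<times> {..<k}. \<zeta> (fst p) (snd p) \<omega>) (Pi\<^sub>M ({..<n} \<times> {..<k}) (\<lambda>_. borel))"

lemma space_history_filtration: "space (history_filtration M n \<zeta> k) = space M"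
  by (simp add: history_filtration_def)

lemma sets_history_filtration:
  "sets (history_filtration M n \<zeta> k) = {(\<lambda>\<omega>. \<lambda>p\<in>{..<n} \<times> {..<k}. \<zeta> (fst p) (snd p) \<omega>) -` A \<inter> space M | A.
    A \<in> sets (Pi\<^sub>M ({..<n} \<times> {..<k}) (\<lambda>_. borel))}"
  unfolding history_filtration_def by (rule sets_vimage_algebra2) (simp add: space_PiM)

lemma measurable_history_filtration:
  assumes "i < n" "l < k"
  shows "\<zeta> i l \<in> borel_measurable (history_filtration M n \<zeta> k)"
proof -
  let ?I = "{..<n} \<times> {..<k}"
  let ?H = "\<lambda>\<omega>. \<lambda>p\<in>?I. \<zeta> (fst p) (snd p) \<omega>"
  have "?H \<in> measurable (history_filtration M n \<zeta> k) (Pi\<^sub>M ?I (\<lambda>_. borel))"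
    unfolding history_filtration_def by (rule measurable_vimage_algebra1) (simp add: space_PiM)
  moreover have "(\<lambda>f. f (i, l)) \<in> measurable (Pi\<^sub>M ?I (\<lambda>_. borel)) borel"
    using assms by (intro measurable_component_singleton) simp
  ultimately have "(\<lambda>\<omega>. ?H \<omega> (i, l)) \<in> borel_measurable (history_filtration M n \<zeta> k)"
    by (rule measurable_compose)
  then show ?thesis using assms by simp
qed

text \<open>Minimality of the generated sigma algebra; it yields both the inclusion in
  \<open>M\<close> and the growth in \<open>k\<close>.\<close>

lemma subalgebra_history_filtrationI:
  assumes "space N = space M" and "\<And>i l. i < n \<Longrightarrow> l < k \<Longrightarrow> \<zeta> i l \<in> borel_measurable N"
  shows "subalgebra N (history_filtration M n \<zeta> k)"
proof -
  have "(\<lambda>\<omega>. \<lambda>p\<in>{..<n} \<times> {..<k}. \<zeta> (fst p) (snd p) \<omega>) \<in> measurable N (Pi\<^sub>M ({..<n} \<times> {..<k}) (\<lambda>_. borel))"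
    by (rule measurable_restrict) (use assms(2) in \<open>simp add: mem_Times_iff\<close>)
  from measurable_sets[OF this] show ?thesis
    unfolding subalgebra_def sets_history_filtration space_history_filtration assms(1) by blast
qed

lemma subalgebra_history_filtration:
  "(\<And>i k. i < n \<Longrightarrow> \<zeta> i k \<in> borel_measurable M) \<Longrightarrow> subalgebra M (history_filtration M n \<zeta> k)"
  by (rule subalgebra_history_filtrationI) simp_all

lemma subalgebra_history_filtration_Suc:
  "subalgebra (history_filtration M n \<zeta> (Suc k)) (history_filtration M n \<zeta> k)"
  by (rule subalgebra_history_filtrationI)
     (simp_all add: space_history_filtration measurable_history_filtration)

text \<open>The indices before time \<open>k\<close> and the single index \<open>(i, k)\<close> are
  disjoint blocks of an independent family, and disjoint blocks are independent.\<close>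

lemma (in prob_space) indep_history_filtration:
  assumes ind: "indep_vars (\<lambda>_. borel) (\<lambda>(i, k). \<zeta> i k) ({..<n} \<times> UNIV)" and i: "i < n"
  shows "indep_set (sets (history_filtration M n \<zeta> k)) {\<zeta> i k -` A \<inter> space M | A. A \<in> sets borel}"
proof -
  let ?X = "\<lambda>(i, k). \<zeta> i k"
  let ?I = "{..<n} \<times> {..<k}"
  let ?r = "\<lambda>J \<omega>. restrict (\<lambda>p. ?X p \<omega>) J"
  have \<zeta>M: "\<zeta> j l \<in> borel_measurable M" if "j < n" for j l
    using ind that unfolding indep_vars_def by force
  have iv: "indep_var (Pi\<^sub>M ?I (\<lambda>_. borel)) (?r ?I) (Pi\<^sub>M {(i, k)} (\<lambda>_. borel)) (?r {(i, k)})"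
    by (rule indep_var_restrict[OF ind]) (use i in auto)
  show ?thesis
  proof (rule indep_setI)
    show "sets (history_filtration M n \<zeta> k) \<subseteq> events"
      using subalgebra_history_filtration[of n \<zeta> M k] \<zeta>M by (simp add: subalgebra_def)
    show "{\<zeta> i k -` A \<inter> space M | A. A \<in> sets borel} \<subseteq> events"
      using measurable_sets[OF \<zeta>M[OF i]] by auto
    fix a b assume "a \<in> sets (history_filtration M n \<zeta> k)" "b \<in> {\<zeta> i k -` A \<inter> space M | A. A \<in> sets borel}"
    then obtain A B where A: "A \<in> sets (Pi\<^sub>M ?I (\<lambda>_. borel))" "a = ?r ?I -` A \<inter> space M"
      and B: "B \<in> sets borel" "b = \<zeta> i k -` B \<inter> space M"
      unfolding sets_history_filtration split_beta by blast
    \<comment> \<open>A Borel set for \<open>\<zeta> i k\<close> is viewed as a set of functions on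
      a one-point index set, the form in which independence of blocks is available.\<close>
    let ?B = "(\<lambda>f. f (i, k)) -` B \<inter> space (Pi\<^sub>M {(i, k)} (\<lambda>_. borel))"
    have B': "?B \<in> sets (Pi\<^sub>M {(i, k)} (\<lambda>_. borel))"
      by (rule measurable_sets[OF measurable_component_singleton[of "(i, k)" "{(i, k)}" "\<lambda>_. borel"] B(1)]) simp
    have b: "b = ?r {(i, k)} -` ?B \<inter> space M"
      using B(2) by (auto simp: space_PiM)
    have "a \<inter> b = (\<lambda>\<omega>. (?r ?I \<omega>, ?r {(i, k)} \<omega>)) -` (A \<times> ?B) \<inter> space M"
      unfolding A(2) b by blast
    then show "prob (a \<inter> b) = prob a * prob b"
      using indep_varD[OF iv A(1) B'] unfolding A(2) b by (simp only:)
  qed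
qed

theorem theorem2:
  fixes n :: nat
    and G :: "nat pair_pre_digraph"
    and Wr Wc :: "real mat"
    and fi :: "nat \<Rightarrow> real ^ 'm \<Rightarrow> real"
    and f f\<mu> :: "real ^ 'm \<Rightarrow> real"
    and D \<mu> \<epsilon> \<Gamma> \<gamma> :: real
    and \<alpha> :: "nat \<Rightarrow> real"
    and M :: "'w measure"
    and \<zeta> :: "nat \<Rightarrow> nat \<Rightarrow> 'w \<Rightarrow> real ^ 'm"
    and x0 y0 :: "nat \<Rightarrow> real ^ 'm"
    and x y :: "nat \<Rightarrow> nat \<Rightarrow> 'w \<Rightarrow> real ^ 'm"
  defines "f \<equiv> (\<lambda>v. \<Sum>i<n. fi i v)"
    and "f\<mu> \<equiv> (\<lambda>v. \<Sum>i<n. smoothed \<mu> (fi i) v)"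
  assumes "n \<ge> 2"
    and "pair_fin_digraph G" and "pverts G = {..<n}"
    and "strongly_connected (with_proj G)"
    and "\<forall>i<n. (i, i) \<in> parcs G"
    and "row_stochastic n Wr"
    and "\<forall>i<n. \<forall>j<n. Wr $$ (i, j) > 0 \<longleftrightarrow> j \<in> in_neighbours G i"
    and "column_stochastic n Wc"
    and "\<forall>i<n. \<forall>j<n. Wc $$ (i, j) > 0 \<longleftrightarrow> i \<in> out_neighbours G j"
    and "convex_on UNIV f"
    and "D > 0"
    and "\<forall>i<n. \<forall>u v. \<bar>fi i u - fi i v\<bar> \<le> D * norm (u - v)"
    and "\<mu> > 0"
    and "minimizers f \<noteq> {}" and "minimizers f\<mu> \<noteq> {}"
    and "\<Gamma> > 0" and "0 < \<gamma>" and "\<gamma> < 1"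
    and "\<forall>k\<ge>1. mat_norm_inf (augmented_matrix n Wr Wc \<epsilon> ^\<^sub>m k - limit_matrix n) \<le> \<Gamma> * \<gamma> ^ k"
    and "0 < \<epsilon>" and "\<epsilon> \<le> min (eps_bar n Wr Wc) ((1 - \<gamma>) / (2 * real n * \<Gamma> * \<gamma>))"
    and "\<forall>k. \<alpha> k \<ge> 0"
    and "(\<Sum>k. ennreal (\<alpha> k)) = \<infinity>"
    and "(\<Sum>k. ennreal ((\<alpha> k)\<^sup>2)) < \<infinity>"
    and "prob_space M"
    and "prob_space.indep_vars M (\<lambda>_. borel) (\<lambda>(i, k). \<zeta> i k) ({..<n} \<times> UNIV)"
    and "\<forall>i<n. \<forall>k. distributed M lborel (\<zeta> i k) (\<lambda>z. ennreal (std_gaussian_density z))"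
    and "\<forall>i<n. \<forall>\<omega>\<in>space M. x i 0 \<omega> = x0 i"
    and "\<forall>i<n. \<forall>\<omega>\<in>space M. y i 0 \<omega> = y0 i"
    and "\<forall>i<n. \<forall>k. \<forall>\<omega>\<in>space M.
           x i (Suc k) \<omega> = (\<Sum>j<n. Wr $$ (i, j) *\<^sub>R x j k \<omega>) + \<epsilon> *\<^sub>R y i k \<omega>
             - \<alpha> k *\<^sub>R oracle_step \<mu> (fi i) (\<zeta> i k \<omega>) (x i k \<omega>)"
    and "\<forall>i<n. \<forall>k. \<forall>\<omega>\<in>space M.
           y i (Suc k) \<omega> = x i k \<omega> - (\<Sum>j<n. Wr $$ (i, j) *\<^sub>R x j k \<omega>)
             + (\<Sum>j<n. Wc $$ (i, j) *\<^sub>R y j k \<omega>) - \<epsilon> *\<^sub>R y i k \<omega>"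
  shows "(\<exists>xs \<in> borel_measurable M.
            (AE \<omega> in M. xs \<omega> \<in> minimizers f\<mu>) \<and>
            (\<forall>i<n.
               (AE \<omega> in M. (\<lambda>k. x i k \<omega>) \<longlonglongrightarrow> xs \<omega>) \<and>
               (\<forall>k. integrable M (\<lambda>\<omega>. norm (x i k \<omega> - xs \<omega>))) \<and>
               (\<lambda>k. \<integral>\<omega>. norm (x i k \<omega> - xs \<omega>) \<partial>M) \<longlonglongrightarrow> 0)) \<and>
         (\<forall>i<n.
            (\<forall>k. integrable M (\<lambda>\<omega>. f (x i k \<omega>))) \<and>
            convergent (\<lambda>k. \<integral>\<omega>. f (x i k \<omega>) \<partial>M) \<and>
            lim (\<lambda>k. \<integral>\<omega>. f (x i k \<omega>) \<partial>M) - min_value f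
              \<le> 2 * real n * sqrt (real CARD('m)) * \<mu> * D)"
proof -
  interpret prob_space M by (rule \<open>prob_space M\<close>)
  have n: "0 < n" using \<open>n \<ge> 2\<close> by simp
  have Wr: "Wr \<in> carrier_mat n n" using \<open>row_stochastic n Wr\<close> by (simp add: row_stochastic_def)
  have lip: "\<bar>fi i u - fi i v\<bar> \<le> D * norm (u - v)" if "i < n" for i u v
    using \<open>\<forall>i<n. \<forall>u v. \<bar>fi i u - fi i v\<bar> \<le> D * norm (u - v)\<close> that by blast
  note \<mu> = \<open>\<mu> > 0\<close>
  have \<alpha>0: "0 \<le> \<alpha> k" for k using \<open>\<forall>k. \<alpha> k \<ge> 0\<close> by simp
  have x0: "x i 0 \<omega> = x0 i" if "i < n" "\<omega> \<in> space M" for i \<omega>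
    using \<open>\<forall>i<n. \<forall>\<omega>\<in>space M. x i 0 \<omega> = x0 i\<close> that by blast
  have y0: "y i 0 \<omega> = y0 i" if "i < n" "\<omega> \<in> space M" for i \<omega>
    using \<open>\<forall>i<n. \<forall>\<omega>\<in>space M. y i 0 \<omega> = y0 i\<close> that by blast
  \<comment> \<open>The scaled oracle is the input that the linear recursion subtracts.\<close>
  define g where "g i k \<omega> = \<alpha> k *\<^sub>R oracle_step \<mu> (fi i) (\<zeta> i k \<omega>) (x i k \<omega>)" for i k \<omega>
  have xS: "x i (Suc k) \<omega> = (\<Sum>j<n. Wr $$ (i, j) *\<^sub>R x j k \<omega>) + \<epsilon> *\<^sub>R y i k \<omega> - g i k \<omega>"
    if "i < n" "\<omega> \<in> space M" for i k \<omega>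
    unfolding g_def using assms(32) that by blast
  have yS: "y i (Suc k) \<omega> = x i k \<omega> - (\<Sum>j<n. Wr $$ (i, j) *\<^sub>R x j k \<omega>)
      + (\<Sum>j<n. Wc $$ (i, j) *\<^sub>R y j k \<omega>) - \<epsilon> *\<^sub>R y i k \<omega>" if "i < n" "\<omega> \<in> space M" for i k \<omega>
    using assms(33) that by blast
  have \<zeta>M: "\<zeta> i k \<in> borel_measurable M" if "i < n" for i k
    using \<open>\<forall>i<n. \<forall>k. distributed M lborel (\<zeta> i k) (\<lambda>z. ennreal (std_gaussian_density z))\<close> that
    by (auto simp: distributed_def)
  have \<zeta>_distr: "distr M borel (\<zeta> i k) = gaussian" if "i < n" for i k
  proof -
    have "distr M borel (\<zeta> i k) = distr M lborel (\<zeta> i k)" by (rule distr_cong) simp_all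
    also have "\<dots> = gaussian"
      unfolding gaussian_def
      using \<open>\<forall>i<n. \<forall>k. distributed M lborel (\<zeta> i k) (\<lambda>z. ennreal (std_gaussian_density z))\<close> that
      by (auto simp: distributed_def)
    finally show ?thesis .
  qed
  define F where "F = history_filtration M n \<zeta>"
  interpret filtered_prob_space M F
    by unfold_locales
       (simp_all add: F_def subalgebra_history_filtration subalgebra_history_filtration_Suc \<zeta>M)
  have \<zeta>F: "\<zeta> i k \<in> borel_measurable (F (Suc k))" if "i < n" for i k
    unfolding F_def using that by (rule measurable_history_filtration) simp
  have spF: "space (F k) = space M" for k by (simp add: F_def space_history_filtration)
  \<comment> \<open>The two families are treated in one induction because each update uses
    both.\<close>
  have xyF: "\<forall>i<n. x i k \<in> borel_measurable (F k) \<and> y i k \<in> borel_measurable (F k)" for k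
  proof (induction k)
    case 0
    show ?case
    proof (intro allI impI)
      fix i assume i: "i < n"
      \<comment> \<open>The initial values are constant on \<open>space M\<close>, so they are
        measurable even for the trivial \<open>F 0\<close>.\<close>
      have "x i 0 \<in> borel_measurable (F 0) \<longleftrightarrow> (\<lambda>_. x0 i) \<in> borel_measurable (F 0)"
        by (rule measurable_cong) (simp add: spF x0 i)
      moreover have "y i 0 \<in> borel_measurable (F 0) \<longleftrightarrow> (\<lambda>_. y0 i) \<in> borel_measurable (F 0)"
        by (rule measurable_cong) (simp add: spF y0 i)
      ultimately show "x i 0 \<in> borel_measurable (F 0) \<and> y i 0 \<in> borel_measurable (F 0)" by simp
    qed
  next
    case (Suc k)
    have xm: "x j k \<in> borel_measurable (F (Suc k))" and ym: "y j k \<in> borel_measurable (F (Suc k))" if "j < n" for j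
      using Suc that measurable_F_mono[of _ k _ "Suc k"] by auto
    show ?case
    proof (intro allI impI)
      fix i assume i: "i < n"
      have gm: "g i k \<in> borel_measurable (F (Suc k))"
        unfolding g_def using i
        by (intro borel_measurable_scaleR borel_measurable_const measurable_oracle_step[OF lip \<mu>] \<zeta>F xm) simp_all
      have "(\<lambda>\<omega>. (\<Sum>j<n. Wr $$ (i, j) *\<^sub>R x j k \<omega>) + \<epsilon> *\<^sub>R y i k \<omega> - g i k \<omega>) \<in> borel_measurable (F (Suc k))"
        using i by (intro borel_measurable_diff borel_measurable_add borel_measurable_sum borel_measurable_scaleR
            borel_measurable_const gm xm ym) simp_all
      moreover have "x i (Suc k) \<in> borel_measurable (F (Suc k)) \<longleftrightarrow>
          (\<lambda>\<omega>. (\<Sum>j<n. Wr $$ (i, j) *\<^sub>R x j k \<omega>) + \<epsilon> *\<^sub>R y i k \<omega> - g i k \<omega>) \<in> borel_measurable (F (Suc k))"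
        by (rule measurable_cong) (simp add: spF xS i)
      moreover have "(\<lambda>\<omega>. x i k \<omega> - (\<Sum>j<n. Wr $$ (i, j) *\<^sub>R x j k \<omega>)
          + (\<Sum>j<n. Wc $$ (i, j) *\<^sub>R y j k \<omega>) - \<epsilon> *\<^sub>R y i k \<omega>) \<in> borel_measurable (F (Suc k))"
        using i by (intro borel_measurable_diff borel_measurable_add borel_measurable_sum borel_measurable_scaleR
            borel_measurable_const xm ym) simp_all
      moreover have "y i (Suc k) \<in> borel_measurable (F (Suc k)) \<longleftrightarrow>
          (\<lambda>\<omega>. x i k \<omega> - (\<Sum>j<n. Wr $$ (i, j) *\<^sub>R x j k \<omega>)
          + (\<Sum>j<n. Wc $$ (i, j) *\<^sub>R y j k \<omega>) - \<epsilon> *\<^sub>R y i k \<omega>) \<in> borel_measurable (F (Suc k))"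
        by (rule measurable_cong) (simp add: spF yS i)
      ultimately show "x i (Suc k) \<in> borel_measurable (F (Suc k)) \<and> y i (Suc k) \<in> borel_measurable (F (Suc k))"
        by blast
    qed
  qed
  \<comment> \<open>The divisor is \<open>n\<close> although there are \<open>2 * n\<close>
    summands: \<open>1 / n\<close> is the common entry of the upper rows of the limit
    matrix.\<close>
  define z where "z k \<omega> = (1 / real n) *\<^sub>R (\<Sum>j<n. x j k \<omega> + y j k \<omega>)" for k \<omega>
  define K where "K = (\<Sum>j<n. norm (x0 j) + norm (y0 j))"
  \<comment> \<open>The factor \<open>max \<Gamma> 1\<close> comes from the powers of the augmented
    matrix; \<open>max K D\<close> covers at once the initial data, of size \<open>K\<close>, and
    the oracle bound, with factor \<open>D\<close>.\<close>
  define C where "C = max \<Gamma> 1 * max K D"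
  have C: "0 \<le> C" using \<open>D > 0\<close> by (auto simp: C_def intro!: mult_nonneg_nonneg)
  note surplus = surplus_consensus[OF Wr \<open>column_stochastic n Wc\<close>
      \<open>\<forall>k\<ge>1. mat_norm_inf (augmented_matrix n Wr Wc \<epsilon> ^\<^sub>m k - limit_matrix n) \<le> \<Gamma> * \<gamma> ^ k\<close> \<open>0 < \<gamma>\<close>]
  interpret smoothed_descent M F n fi D \<mu> C \<gamma> \<alpha> \<zeta> x z "(1 / real n) *\<^sub>R (\<Sum>j<n. x0 j + y0 j)"
  proof
    show "convex_on UNIV (\<lambda>v. \<Sum>i<n. fi i v)" "minimizers (\<lambda>v. \<Sum>i<n. fi i v) \<noteq> {}"
      "minimizers (\<lambda>v. \<Sum>i<n. smoothed \<mu> (fi i) v) \<noteq> {}"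
      using \<open>convex_on UNIV f\<close> \<open>minimizers f \<noteq> {}\<close> \<open>minimizers f\<mu> \<noteq> {}\<close> by (simp_all add: f_def f\<mu>_def)
    show "\<not> summable \<alpha>"
      by (rule not_summable_of_suminf_ennreal_infinite[OF \<alpha>0]) fact
    show "summable (\<lambda>k. (\<alpha> k)\<^sup>2)"
      by (rule summable_of_suminf_ennreal_finite[OF zero_le_power2]) fact
    show "indep_set (sets (F k)) {\<zeta> i k -` A \<inter> space M | A. A \<in> sets borel}" if "i < n" for i k
      unfolding F_def by (rule indep_history_filtration[OF _ that]) fact
    show "z k \<in> borel_measurable (F k)" for k
      unfolding z_def using xyF
      by (intro borel_measurable_scaleR borel_measurable_const borel_measurable_sum borel_measurable_add) simp_all
    show "z 0 \<omega> = (1 / real n) *\<^sub>R (\<Sum>j<n. x0 j + y0 j)" if "\<omega> \<in> space M" for \<omega>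
      unfolding z_def using that by (simp add: x0 y0)
    show "z (Suc k) \<omega> = z k \<omega> - (\<alpha> k / real n) *\<^sub>R (\<Sum>i<n. oracle_step \<mu> (fi i) (\<zeta> i k \<omega>) (x i k \<omega>))"
      if "\<omega> \<in> space M" for k \<omega>
      unfolding z_def
      using surplus(2)[where x = "\<lambda>i k. x i k \<omega>" and y = "\<lambda>i k. y i k \<omega>"
          and g = "\<lambda>i k. g i k \<omega>" and k = k] xS[OF _ that] yS[OF _ that]
      by (simp add: scaleR_diff_right g_def scaleR_sum_right[symmetric])
    show "norm (x i k \<omega> - z k \<omega>) \<le> fading_memory C \<gamma> (\<lambda>r. \<alpha> r * (\<Sum>j<n. (norm (\<zeta> j r \<omega>))\<^sup>2)) k"
      if i: "i < n" and \<omega>: "\<omega> \<in> space M" for i k \<omega>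
    proof -
      define s where "s r = (\<Sum>j<n. (norm (\<zeta> j r \<omega>))\<^sup>2)" for r
      have s0: "0 \<le> s r" for r by (simp add: s_def sum_nonneg)
      have g_le: "(\<Sum>j<n. norm (g j r \<omega>)) \<le> max K D * (\<alpha> r * s r)" for r
      proof -
        have "(\<Sum>j<n. norm (g j r \<omega>)) \<le> (\<Sum>j<n. \<alpha> r * (D * (norm (\<zeta> j r \<omega>))\<^sup>2))"
          unfolding g_def norm_scaleR using \<alpha>0 norm_oracle_step_le[OF lip \<mu>]
          by (intro sum_mono) (simp add: mult_left_mono)
        also have "\<dots> = D * (\<alpha> r * s r)"
          by (simp add: s_def sum_distrib_left mult.left_commute)
        also have "\<dots> \<le> max K D * (\<alpha> r * s r)"
          using \<alpha>0 s0 by (intro mult_right_mono) simp_all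
        finally show ?thesis .
      qed
      have K_eq: "(\<Sum>j<n. norm (x j 0 \<omega>) + norm (y j 0 \<omega>)) = K"
        unfolding K_def by (rule sum.cong) (simp_all add: x0 y0 \<omega>)
      have "norm (x i k \<omega> - z k \<omega>) \<le> max \<Gamma> 1 * (\<gamma> ^ k * K
          + (\<Sum>r<k. \<gamma> ^ (k - 1 - r) * (\<Sum>j<n. norm (g j r \<omega>))))"
        using surplus(1)[where x = "\<lambda>i k. x i k \<omega>" and y = "\<lambda>i k. y i k \<omega>"
          and g = "\<lambda>i k. g i k \<omega>" and k = k and i = i] xS[OF _ \<omega>] yS[OF _ \<omega>] i
        by (simp add: z_def K_eq)
      also have "\<dots> \<le> max \<Gamma> 1 * (\<gamma> ^ k * max K D
          + (\<Sum>r<k. \<gamma> ^ (k - 1 - r) * (max K D * (\<alpha> r * s r))))"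
        using \<open>0 < \<gamma>\<close> by (intro mult_left_mono add_mono sum_mono g_le) simp_all
      also have "\<dots> = C * (\<gamma> ^ k + (\<Sum>r<k. \<gamma> ^ (k - 1 - r) * (\<alpha> r * s r)))"
        by (simp add: C_def distrib_left sum_distrib_left mult_ac)
      finally show ?thesis unfolding fading_memory_closed_form s_def .
    qed
  qed (use n lip \<mu> C xyF \<zeta>F \<zeta>_distr \<open>0 < \<gamma>\<close> \<open>\<gamma> < 1\<close> \<alpha>0 in simp_all)
  have f: "objective = f" and f\<mu>: "smoothed_objective = f\<mu>"
    by (simp_all add: f_def f\<mu>_def objective_def[abs_def] smoothed_objective_def[abs_def])
  show ?thesis
  proof (intro conjI bexI[of _ limit] allI impI)
    show "AE \<omega> in M. limit \<omega> \<in> minimizers f\<mu>"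
      using limit_AE unfolding f\<mu> by eventually_elim simp
    fix i assume i: "i < n"
    show "AE \<omega> in M. (\<lambda>k. x i k \<omega>) \<longlonglongrightarrow> limit \<omega>" by (rule x_tendsto_limit_AE[OF i])
    show "integrable M (\<lambda>\<omega>. norm (x i k \<omega> - limit \<omega>))" for k by (rule x_L1_convergence(1)[OF i])
    show "(\<lambda>k. \<integral>\<omega>. norm (x i k \<omega> - limit \<omega>) \<partial>M) \<longlonglongrightarrow> 0" by (rule x_L1_convergence(2)[OF i])
    note obj = objective_convergence[OF i, unfolded f]
    show "integrable M (\<lambda>\<omega>. f (x i k \<omega>))" for k by (rule obj(1))
    show "convergent (\<lambda>k. \<integral>\<omega>. f (x i k \<omega>) \<partial>M)" using obj(2) by (rule convergentI)
    show "lim (\<lambda>k. \<integral>\<omega>. f (x i k \<omega>) \<partial>M) - min_value f \<le> 2 * real n * sqrt (real CARD('m)) * \<mu> * D"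
      using obj(3) limI[OF obj(2)] by simp
  qed (rule limit_M)
qed

end
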